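(* Let $\lambda>0$, $0<\alpha_1,\alpha_2\le1$ and $0<\beta\le1$. The distribution $p_{\alpha_1,\alpha_2}^\beta(n,t_1,t_2)=\mathrm{Pr}\{N_{\alpha_1,\alpha_2}^\beta(t_1,t_2)=n\}$, $(t_1,t_2)\in\mathbb{R}^2_+$, of the space-time fractional Poisson random field with parameter $\lambda$ is given by $$p_{\alpha_1,\alpha_2}^\beta(n,t_1,t_2)=\frac{(-1)^n}{n!}\,{}_3\Psi_3\left[\begin{matrix}(1,\beta),&(1,1),&(1,1)\\(1-n,\beta),&(1,\alpha_1),&(1,\alpha_2)\end{matrix}\,\bigg|\,-t_1^{\alpha_1}t_2^{\alpha_2}\lambda^\beta\right],\quad n\ge0,$$ where ${}_3\Psi_3$ is the generalized Wright function, that is, $$p_{\alpha_1,\alpha_2}^\beta(n,t_1,t_2)=\frac{(-1)^n}{n!}\sum_{k=0}^{\infty}\frac{\Gamma(1+\beta k)\,\Gamma(1+k)\,\Gamma(1+k)}{\Gamma(1-n+\beta k)\,\Gamma(1+\alpha_1 k)\,\Gamma(1+\alpha_2 k)\,k!}(-t_1^{\alpha_1}t_2^{\alpha_2}\lambda^\beta)^k,\quad n\ge0.$$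
   Context: $\mathbb{R}_+=[0,\infty)$. Space-time fractional Poisson random field (STFPRF): a nonnegative-integer-valued random field $\{N_{\alpha_1,\alpha_2}^\beta(t_1,t_2)\}$ on $\mathbb{R}^2_+$, depending on a parameter $\lambda>0$, whose distribution $p_{\alpha_1,\alpha_2}^\beta(n,t_1,t_2)$ (regarded also as a function of $\lambda\in(0,\infty)$) solves $$\frac{\partial^{\alpha_1+\alpha_2}}{\partial t_2^{\alpha_2}\partial t_1^{\alpha_1}}p_{\alpha_1,\alpha_2}^\beta(n,t_1,t_2)=-\bigg(\frac{\lambda^{\beta+1}}{\beta}\frac{\partial}{\partial\lambda}+\lambda^\beta\bigg)(I-B)^\beta p_{\alpha_1,\alpha_2}^\beta(n,t_1,t_2),\quad n\ge0,$$ with $p_{\alpha_1,\alpha_2}^\beta(0,0,t_2)=p_{\alpha_1,\alpha_2}^\beta(0,t_1,0)=p_{\alpha_1,\alpha_2}^\beta(0,0,0)=1$ and $p_{\alpha_1,\alpha_2}^\beta(n,\cdot,\cdot)=0$ for $n<0$. Here $B$ is the backward shift, $Bp(n,t_1,t_2)=p(n-1,t_1,t_2)$, $(I-B)^\beta=\sum_{k=0}^\infty\frac{(\beta)_k}{k!}(-B)^k$, $(\beta)_k=\beta(\beta-1)\cdots(\beta-k+1)$, $(\beta)_0=1$, and the $t_i$-derivatives are Caputo derivatives: $\frac{\mathrm{d}^\alpha}{\mathrm{d}t^\alpha}g(t)=\frac{1}{\Gamma(1-\alpha)}\int_0^t\frac{g'(s)}{(t-s)^\alpha}\,\mathrm{d}s$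 for $0<\alpha<1$, and $g'(t)$ for $\alpha=1$. Generalized Wright function: for real $a_i,b_j$ and nonzero real $\alpha_i,\beta_j$, ${}_m\Psi_l\left[\begin{matrix}(a_i,\alpha_i)_{1,m}\\(b_j,\beta_j)_{1,l}\end{matrix}\Big|x\right]=\sum_{n=0}^\infty\frac{\prod_{i=1}^m\Gamma(a_i+n\alpha_i)\,x^n}{\prod_{j=1}^l\Gamma(b_j+n\beta_j)\,n!}$, $x\in\mathbb{R}$, where $1/\Gamma$ is taken to be $0$ at the poles of $\Gamma$.
   Formalization: The series diverges for nonzero argument when α1+α2<1 (and beyond a finite radius when α1+α2=1), so the formula is asserted wherever it converges, with convergence proved for α1+α2>1; "solves" means a classical solution with p and its λ-derivative jointly continuous. *)

theory Defs
  imports "HOL-Probability.Probability"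
begin

definition caputo :: "real \<Rightarrow> (real \<Rightarrow> real) \<Rightarrow> real \<Rightarrow> real" where
  "caputo \<alpha> g t =
     (if \<alpha> = 1 then deriv g t
      else 1 / Gamma (1 - \<alpha>) * (LINT s:{0<..<t}|lborel. deriv g s / (t - s) powr \<alpha>))"

text \<open>The derivative exists at every \<open>t > 0\<close>. Continuity at \<open>0\<close> ties it to the initial value; \<open>g\<close> may
  have an unbounded derivative there, as \<open>t powr \<alpha>\<close> does.\<close>

definition caputo_differentiable :: "real \<Rightarrow> (real \<Rightarrow> real) \<Rightarrow> bool" where
  "caputo_differentiable \<alpha> g \<longleftrightarrow>
     continuous_on {0..} g \<and>
     (\<forall>t>0. g differentiable (at t)) \<and>
     (\<alpha> \<noteq> 1 \<longrightarrow>
       (\<forall>t>0. set_integrable lborel {0<..<t} (\<lambda>s. deriv g s / (t - s) powr \<alpha>)))"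

text \<open>\<open>(I - B)\<^sup>\<beta>\<close>: the generalized binomial coefficient is the falling factorial of \<open>\<beta>\<close> over \<open>k!\<close>.
  The series is a finite sum when \<open>q\<close> vanishes at negative integers.\<close>

definition frac_diff :: "real \<Rightarrow> (int \<Rightarrow> real) \<Rightarrow> int \<Rightarrow> real" where
  "frac_diff \<beta> q n = (\<Sum>k. (\<beta> gchoose k) * (-1) ^ k * q (n - int k))"

text \<open>Classical solutions \<open>p n l t1 t2\<close> of the governing system, with \<open>l > 0\<close> the intensity parameter:
  \<open>p\<close> is continuously differentiable in \<open>l\<close> (jointly in all variables, up to the axes \<open>t1 = 0\<close>,
  \<open>t2 = 0\<close>), the Caputo derivatives exist, and the equation holds off the axes. It cannot be
  imposed on the axes: there the Caputo integral is empty while the right-hand side need not be \<open>0\<close>.\<close>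

definition stfprf_system ::
  "real \<Rightarrow> real \<Rightarrow> real \<Rightarrow> (int \<Rightarrow> real \<Rightarrow> real \<Rightarrow> real \<Rightarrow> real) \<Rightarrow> bool" where
  "stfprf_system \<alpha>1 \<alpha>2 \<beta> p \<longleftrightarrow>
     (\<forall>n. continuous_on ({0<..} \<times> {0..} \<times> {0..}) (\<lambda>(l, t1, t2). p n l t1 t2)) \<and>
     (\<forall>n. \<forall>l>0. \<forall>t1\<ge>0. \<forall>t2\<ge>0. (\<lambda>r. p n r t1 t2) differentiable (at l)) \<and>
     (\<forall>n. continuous_on ({0<..} \<times> {0..} \<times> {0..})
            (\<lambda>(l, t1, t2). deriv (\<lambda>r. p n r t1 t2) l)) \<and>
     (\<forall>n. \<forall>l>0. \<forall>t2>0. caputo_differentiable \<alpha>1 (\<lambda>s. p n l s t2)) \<and>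
     (\<forall>n. \<forall>l>0. \<forall>t1>0.
        caputo_differentiable \<alpha>2 (\<lambda>r. caputo \<alpha>1 (\<lambda>s. p n l s r) t1)) \<and>
     (\<forall>n\<ge>0. \<forall>l>0. \<forall>t1>0. \<forall>t2>0.
        caputo \<alpha>2 (\<lambda>r. caputo \<alpha>1 (\<lambda>s. p n l s r) t1) t2 =
          - (l powr (\<beta> + 1) / \<beta> * deriv (\<lambda>r. frac_diff \<beta> (\<lambda>m. p m r t1 t2) n) l
             + l powr \<beta> * frac_diff \<beta> (\<lambda>m. p m l t1 t2) n)) \<and>
     (\<forall>l>0. \<forall>t\<ge>0. p 0 l 0 t = 1 \<and> p 0 l t 0 = 1) \<and>
     (\<forall>n<0. \<forall>l>0. \<forall>t1\<ge>0. \<forall>t2\<ge>0. p n l t1 t2 = 0)"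

definition field_dist ::
  "(real \<Rightarrow> 'a measure) \<Rightarrow> (real \<Rightarrow> real \<Rightarrow> real \<Rightarrow> 'a \<Rightarrow> nat)
     \<Rightarrow> int \<Rightarrow> real \<Rightarrow> real \<Rightarrow> real \<Rightarrow> real" where
  "field_dist M N n l t1 t2 = measure (M l) {\<omega> \<in> space (M l). int (N l t1 t2 \<omega>) = n}"

text \<open>The governing equation differentiates in the parameter, so the notion concerns the whole family
  of fields \<open>N l\<close>, \<open>l > 0\<close>; the underlying probability space may depend on \<open>l\<close>.\<close>

definition stfprf ::
  "real \<Rightarrow> real \<Rightarrow> real \<Rightarrow> (real \<Rightarrow> 'a measure)
     \<Rightarrow> (real \<Rightarrow> real \<Rightarrow> real \<Rightarrow> 'a \<Rightarrow> nat) \<Rightarrow> bool" where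
  "stfprf \<alpha>1 \<alpha>2 \<beta> M N \<longleftrightarrow>
     (\<forall>l>0. prob_space (M l)) \<and>
     (\<forall>l>0. \<forall>t1\<ge>0. \<forall>t2\<ge>0. N l t1 t2 \<in> measurable (M l) (count_space UNIV)) \<and>
     stfprf_system \<alpha>1 \<alpha>2 \<beta> (field_dist M N)"

definition gen_wright_term ::
  "(real \<times> real) list \<Rightarrow> (real \<times> real) list \<Rightarrow> real \<Rightarrow> nat \<Rightarrow> real" where
  "gen_wright_term as bs x k =
     (\<Prod>(a, \<alpha>)\<leftarrow>as. Gamma (a + real k * \<alpha>)) * x ^ k *
     (\<Prod>(b, \<beta>)\<leftarrow>bs. rGamma (b + real k * \<beta>)) / fact k"

definition gen_wright ::
  "(real \<times> real) list \<Rightarrow> (real \<times> real) list \<Rightarrow> real \<Rightarrow> real" where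
  "gen_wright as bs x = (\<Sum>k. gen_wright_term as bs x k)"

end

(* In the variable mu = l powr (-beta), the functions u_n = p_n / mu satisfy
   D2 D1 u_n = (d/dmu) (I - B)^beta u_n, where D1, D2 are the Caputo derivatives.
   Bounded solutions are unique: the Laplace transform in (t1, t2) turns the homogeneous equation into
   a linear ODE in mu whose nonzero solutions grow like exp (S mu) with S > 0.
   Both sum_n v^n p_n(l) and p_0((1 - v) l) solve the equation of p_0 after rescaling l, so they agree for
   |v| < 1. Since the p_n(l) are nonnegative with sum 1, this makes p_0 holomorphic and bounded by 1 in the
   disc of radius l around l, and Cauchy's inequality bounds the k-th mu-derivative of u_0 by
   C k! (r mu)^(-k) / mu. Iterating u_0 = 1/mu + I1 I2 (d/dmu) u_0, with I1, I2 the Riemann-Liouville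
   integrals, then gives the series of p_0 for small t1^a1 t2^a2 l^beta; analytic continuation in l
   reaches the whole open interval of convergence, comparing coefficients of v^n gives p_n, and Abel's
   limit theorem handles the end point. *)

theory Submission
  imports Defs "HOL-Complex_Analysis.Complex_Analysis"
begin

section \<open>Riemann--Liouville kernels\<close>

text \<open>The system grants \<open>p\<close> one continuous derivative in \<open>l\<close>, but
  every iteration of the integrated equation costs another one, so smoothness must come from
  elsewhere. It comes from scaling and positivity: weighting by v^n turns (I - B)^\<beta> into the
  number (1 - v)^\<beta>, which merges with l^\<beta> into ((1 - v) l)^\<beta>, while l d/dl is
  invariant under rescaling of l. All this is done on the equation integrated in both times, which
  survives summation over n and rescaling without differentiating series in time. In the iteration,
  k derivatives in mu produce k! and k double time integrals produce 1 / (Gamma (1 + a1 k) Gamma (1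
  + a2 k)); this is the origin of the coefficients. Their power series has infinite, finite or zero
  radius of convergence according as a1 + a2 is above, equal to or below 1. Hence convergence is a
  conclusion in the first case, and the formula is claimed wherever the series converges.\<close>

definition rl_kernel :: "real \<Rightarrow> real \<Rightarrow> real" where
  "rl_kernel \<alpha> r = (if 0 < r then r powr (\<alpha> - 1) / Gamma \<alpha> else 0)"

lemma rl_kernel_nonneg: "0 < \<alpha> \<Longrightarrow> 0 \<le> rl_kernel \<alpha> r"
  by (simp add: rl_kernel_def)

lemma measurable_rl_kernel [measurable]: "rl_kernel \<alpha> \<in> borel_measurable borel"
  unfolding rl_kernel_def by measurable

text \<open>The substitution r -> r / s leaves Euler's integral for Gamma; the value is the Laplace
  transform of the kernel.\<close>

lemma nn_integral_rl_kernel_exp: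
  assumes "0 < \<alpha>" "0 < s"
  shows "(\<integral>\<^sup>+r. ennreal (rl_kernel \<alpha> r * exp (- (s * r))) \<partial>lborel) = ennreal (s powr - \<alpha>)"
proof -
  have G: "0 < Gamma \<alpha>" using assms by simp
  have "(\<integral>\<^sup>+r. ennreal (rl_kernel \<alpha> r * exp (- (s * r))) \<partial>lborel) =
      ennreal \<bar>1 / s\<bar> * (\<integral>\<^sup>+r. ennreal (rl_kernel \<alpha> (0 + 1 / s * r) * exp (- (s * (0 + 1 / s * r)))) \<partial>lborel)"
    using assms by (intro nn_integral_real_affine) auto
  also have "(\<lambda>r. ennreal (rl_kernel \<alpha> (0 + 1 / s * r) * exp (- (s * (0 + 1 / s * r))))) =
      (\<lambda>r. ennreal (s powr (1 - \<alpha>) / Gamma \<alpha>) * ennreal (indicator {0..} r * r powr (\<alpha> - 1) / exp r))"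
  proof
    fix r
    have "rl_kernel \<alpha> (0 + 1 / s * r) * exp (- (s * (0 + 1 / s * r))) =
        s powr (1 - \<alpha>) / Gamma \<alpha> * (indicator {0..} r * r powr (\<alpha> - 1) / exp r)"
    proof (cases "r > 0")
      case True
      then have "(r / s) powr (\<alpha> - 1) = s powr (1 - \<alpha>) * r powr (\<alpha> - 1)"
        using assms by (simp add: powr_divide powr_diff field_simps)
      with True assms show ?thesis by (simp add: rl_kernel_def exp_minus field_simps)
    qed (use assms in \<open>auto simp: rl_kernel_def indicator_def not_less zero_less_divide_iff\<close>)
    then show "ennreal (rl_kernel \<alpha> (0 + 1 / s * r) * exp (- (s * (0 + 1 / s * r)))) =
        ennreal (s powr (1 - \<alpha>) / Gamma \<alpha>) * ennreal (indicator {0..} r * r powr (\<alpha> - 1) / exp r)"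
      using G by (subst ennreal_mult[symmetric]) auto
  qed
  also have "(\<integral>\<^sup>+r. ennreal (s powr (1 - \<alpha>) / Gamma \<alpha>) *
        ennreal (indicator {0..} r * r powr (\<alpha> - 1) / exp r) \<partial>lborel) =
      ennreal (s powr (1 - \<alpha>) / Gamma \<alpha>) * ennreal (Gamma \<alpha>)"
    using assms by (subst nn_integral_cmult) (auto simp: Gamma_conv_nn_integral_real)
  also have "\<dots> = ennreal (s powr (1 - \<alpha>))"
    using G by (subst ennreal_mult[symmetric]) auto
  also have "ennreal \<bar>1 / s\<bar> * \<dots> = ennreal (s powr - \<alpha>)"
    using assms by (subst ennreal_mult[symmetric]) (auto simp: powr_diff powr_minus field_simps)
  finally show ?thesis .
qed

text \<open>The substitution r -> t r leaves Euler's Beta integral, whose value in terms of Gamma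
  cancels the normalisations. This is the semigroup law of fractional integration; as a nonnegative
  integral it carries integrability with it.\<close>

lemma nn_integral_rl_kernel_convolution_0:
  assumes "0 < \<alpha>" "0 < \<gamma>"
  shows "(\<integral>\<^sup>+r. ennreal (rl_kernel \<alpha> (t - r) * rl_kernel \<gamma> r) \<partial>lborel) = ennreal (rl_kernel (\<alpha> + \<gamma>) t)"
proof (cases "0 < t")
  case False
  then have "(\<lambda>r. ennreal (rl_kernel \<alpha> (t - r) * rl_kernel \<gamma> r)) = (\<lambda>r. 0)"
    by (auto simp: rl_kernel_def fun_eq_iff)
  with False show ?thesis by (simp add: rl_kernel_def)
next
  case True
  have G: "0 < Gamma \<alpha>" "0 < Gamma \<gamma>" "0 < Gamma (\<alpha> + \<gamma>)" using assms by simp_all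
  define c where "c = t powr (\<alpha> + \<gamma> - 2) / (Gamma \<alpha> * Gamma \<gamma>)"
  have c: "0 \<le> c" using G True by (simp add: c_def)
  have B: "0 \<le> Beta \<gamma> \<alpha>" using G assms by (simp add: Beta_def add.commute)
  have "(\<integral>\<^sup>+r. ennreal (rl_kernel \<alpha> (t - r) * rl_kernel \<gamma> r) \<partial>lborel) =
      ennreal \<bar>t\<bar> * (\<integral>\<^sup>+r. ennreal (rl_kernel \<alpha> (t - (0 + t * r)) * rl_kernel \<gamma> (0 + t * r)) \<partial>lborel)"
    using True by (intro nn_integral_real_affine) auto
  also have "(\<lambda>r. ennreal (rl_kernel \<alpha> (t - (0 + t * r)) * rl_kernel \<gamma> (0 + t * r))) =
      (\<lambda>r. ennreal c * ennreal (indicator {0..1} r * (r powr (\<gamma> - 1) * (1 - r) powr (\<alpha> - 1))))"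
  proof
    fix r
    have "rl_kernel \<alpha> (t - (0 + t * r)) * rl_kernel \<gamma> (0 + t * r) =
        c * (indicator {0..1} r * (r powr (\<gamma> - 1) * (1 - r) powr (\<alpha> - 1)))"
    proof (cases "0 < r \<and> r < 1")
      case r: True
      have "t - t * r = t * (1 - r)" by (simp add: algebra_simps)
      then have e: "rl_kernel \<alpha> (t - (0 + t * r)) = t powr (\<alpha> - 1) * (1 - r) powr (\<alpha> - 1) / Gamma \<alpha>"
        using r True by (simp add: rl_kernel_def powr_mult)
      have e2: "rl_kernel \<gamma> (0 + t * r) = t powr (\<gamma> - 1) * r powr (\<gamma> - 1) / Gamma \<gamma>"
        using r True by (simp add: rl_kernel_def powr_mult)
      have "t powr (\<alpha> - 1) * t powr (\<gamma> - 1) = t powr (\<alpha> + \<gamma> - 2)"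
        by (simp add: powr_add[symmetric])
      then show ?thesis unfolding e e2 c_def using r by (simp add: mult_ac)
    next
      case r: False
      have "\<not> 0 < t * r \<or> \<not> 0 < t - t * r" using r True
        by (metis diff_gt_0_iff_gt mult_less_cancel_left_pos mult_1_right zero_less_mult_pos)
      then have "rl_kernel \<alpha> (t - (0 + t * r)) * rl_kernel \<gamma> (0 + t * r) = 0"
        by (auto simp: rl_kernel_def)
      moreover have "indicator {0..1} r * (r powr (\<gamma> - 1) * (1 - r) powr (\<alpha> - 1)) = 0"
        using r by (auto simp: indicator_def)
      ultimately show ?thesis by (simp only: mult_zero_right)
    qed
    then show "ennreal (rl_kernel \<alpha> (t - (0 + t * r)) * rl_kernel \<gamma> (0 + t * r)) =
        ennreal c * ennreal (indicator {0..1} r * (r powr (\<gamma> - 1) * (1 - r) powr (\<alpha> - 1)))"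
      using c by (subst ennreal_mult[symmetric]) auto
  qed
  also have "(\<integral>\<^sup>+r. ennreal c * ennreal (indicator {0..1} r * (r powr (\<gamma> - 1) * (1 - r) powr (\<alpha> - 1))) \<partial>lborel)
      = ennreal c * ennreal (Beta \<gamma> \<alpha>)"
    using nn_integral_has_integral_lebesgue[OF _ has_integral_Beta_real[of \<gamma> \<alpha>]] assms
    by (subst nn_integral_cmult) auto
  also have "ennreal \<bar>t\<bar> * \<dots> = ennreal (t * (c * Beta \<gamma> \<alpha>))"
    using True c B by (simp add: ennreal_mult[symmetric])
  also have "t * (c * Beta \<gamma> \<alpha>) = rl_kernel (\<alpha> + \<gamma>) t"
  proof -
    have "t powr (\<alpha> + \<gamma> - 1) = t powr 1 * t powr (\<alpha> + \<gamma> - 2)"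
      by (simp only: powr_add[symmetric]) simp
    then show ?thesis using True G
      by (simp add: rl_kernel_def c_def Beta_def add.commute)
  qed
  finally show ?thesis .
qed

lemma nn_integral_rl_kernel_convolution:
  assumes "0 < \<alpha>" "0 < \<gamma>"
  shows "(\<integral>\<^sup>+r. ennreal (rl_kernel \<alpha> (t - r) * rl_kernel \<gamma> (r - s)) \<partial>lborel)
    = ennreal (rl_kernel (\<alpha> + \<gamma>) (t - s))"
proof -
  have "(\<integral>\<^sup>+r. ennreal (rl_kernel \<alpha> (t - r) * rl_kernel \<gamma> (r - s)) \<partial>lborel) =
     ennreal \<bar>1\<bar> * (\<integral>\<^sup>+r. ennreal (rl_kernel \<alpha> (t - (s + 1 * r)) * rl_kernel \<gamma> (s + 1 * r - s)) \<partial>lborel)"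
    by (intro nn_integral_real_affine) auto
  also have "\<dots> = (\<integral>\<^sup>+r. ennreal (rl_kernel \<alpha> (t - s - r) * rl_kernel \<gamma> r) \<partial>lborel)"
    by (simp add: algebra_simps)
  also have "\<dots> = ennreal (rl_kernel (\<alpha> + \<gamma>) (t - s))"
    by (rule nn_integral_rl_kernel_convolution_0[OF assms])
  finally show ?thesis .
qed

text \<open>As a function of \<open>s\<close> the weight is supported on (0, t), so integrals over
  that interval become integrals over the line and values of the integrand elsewhere are multiplied
  by 0.\<close>

definition rl_weight :: "real \<Rightarrow> real \<Rightarrow> real \<Rightarrow> real" where
  "rl_weight \<alpha> t s = (if 0 < s then rl_kernel \<alpha> (t - s) else 0)"

lemma rl_weight_nonneg: "0 < \<alpha> \<Longrightarrow> 0 \<le> rl_weight \<alpha> t s"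
  by (simp add: rl_weight_def rl_kernel_nonneg)

lemma rl_weight_eq_0: "\<not> (0 < s \<and> s < t) \<Longrightarrow> rl_weight \<alpha> t s = 0"
  by (auto simp: rl_weight_def rl_kernel_def)

lemma measurable_rl_weight [measurable]:
  assumes [measurable]: "f \<in> borel_measurable M" "g \<in> borel_measurable M"
  shows "(\<lambda>x. rl_weight \<alpha> (f x) (g x)) \<in> borel_measurable M"
  unfolding rl_weight_def by measurable

text \<open>For s > 0, s^b / Gamma (1 + b) is the kernel of order 1 + b, so the power rule of
  fractional integration is an instance of the convolution law.\<close>

lemma has_bochner_integral_rl_weight_powr:
  assumes "0 < \<alpha>" "0 \<le> b" "0 \<le> t"
  shows "has_bochner_integral lborel (\<lambda>s. rl_weight \<alpha> t s * (s powr b / Gamma (1 + b)))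
    (t powr (\<alpha> + b) / Gamma (1 + \<alpha> + b))"
proof (rule has_bochner_integral_nn_integral)
  have eq: "rl_weight \<alpha> t s * (s powr b / Gamma (1 + b)) = rl_kernel \<alpha> (t - s) * rl_kernel (1 + b) s" for s
    by (simp add: rl_weight_def rl_kernel_def)
  show "(\<lambda>s. rl_weight \<alpha> t s * (s powr b / Gamma (1 + b))) \<in> borel_measurable lborel"
    by measurable
  show "AE s in lborel. 0 \<le> rl_weight \<alpha> t s * (s powr b / Gamma (1 + b))"
    by (rule AE_I2) (use assms in \<open>auto simp: rl_weight_nonneg intro!: mult_nonneg_nonneg divide_nonneg_nonneg\<close>)
  show "0 \<le> t powr (\<alpha> + b) / Gamma (1 + \<alpha> + b)"
    using assms by auto
  show "(\<integral>\<^sup>+ s. ennreal (rl_weight \<alpha> t s * (s powr b / Gamma (1 + b))) \<partial>lborel) =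
      ennreal (t powr (\<alpha> + b) / Gamma (1 + \<alpha> + b))"
    unfolding eq using nn_integral_rl_kernel_convolution_0[of \<alpha> "1 + b" t] assms
    by (cases "t = 0") (simp_all add: rl_kernel_def[of "1 + (\<alpha> + b)"] algebra_simps)
qed

lemma integrable_rl_weight:
  assumes "0 < \<alpha>"
  shows "integrable lborel (rl_weight \<alpha> t)"
proof (cases "0 \<le> t")
  case True
  have "integrable lborel (\<lambda>s. rl_weight \<alpha> t s * (s powr 0 / Gamma (1 + 0)))"
    using has_bochner_integral_rl_weight_powr[OF assms, of 0 t] True by (auto dest: integrable.intros)
  moreover have "(\<lambda>s. rl_weight \<alpha> t s * (s powr 0 / Gamma (1 + 0))) = rl_weight \<alpha> t"
    by (auto simp: rl_weight_def fun_eq_iff)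
  ultimately show ?thesis by simp
next
  case False
  then have "rl_weight \<alpha> t = (\<lambda>s. 0)" by (auto intro!: rl_weight_eq_0)
  then show ?thesis by simp
qed

lemma integral_rl_weight:
  assumes "0 < \<alpha>" "0 \<le> t"
  shows "(LBINT s. rl_weight \<alpha> t s) = t powr \<alpha> / Gamma (1 + \<alpha>)"
proof -
  have "has_bochner_integral lborel (\<lambda>s. rl_weight \<alpha> t s * (s powr 0 / Gamma (1 + 0)))
    (t powr (\<alpha> + 0) / Gamma (1 + \<alpha> + 0))"
    by (rule has_bochner_integral_rl_weight_powr) (use assms in auto)
  moreover have "(\<lambda>s. rl_weight \<alpha> t s * (s powr 0 / Gamma (1 + 0))) = rl_weight \<alpha> t"
    by (auto simp: rl_weight_def fun_eq_iff)
  ultimately show ?thesis by (simp add: has_bochner_integral_integral_eq)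
qed

section \<open>Laplace weights\<close>

definition exp_weight :: "real \<Rightarrow> real \<Rightarrow> real" where
  "exp_weight s t = (if 0 < t then exp (- (s * t)) else 0)"

lemma exp_weight_nonneg: "0 \<le> exp_weight s t"
  by (simp add: exp_weight_def)

lemma measurable_exp_weight [measurable]: "exp_weight s \<in> borel_measurable borel"
  unfolding exp_weight_def by measurable

lemma integrable_exp_weight_powr:
  assumes "0 < s" "0 \<le> b"
  shows "integrable lborel (\<lambda>t. exp_weight s t * t powr b)"
proof -
  have "has_bochner_integral lborel (\<lambda>r. rl_kernel (1 + b) r * exp (- (s * r))) (s powr - (1 + b))"
    using nn_integral_rl_kernel_exp[of "1 + b" s] assms
    by (intro has_bochner_integral_nn_integral) (auto simp: rl_kernel_nonneg)
  then have "integrable lborel (\<lambda>r. Gamma (1 + b) * (rl_kernel (1 + b) r * exp (- (s * r))))"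
    by (auto dest: integrable.intros)
  moreover have "Gamma (1 + b) \<noteq> 0" using assms by (simp add: Gamma_eq_zero_iff nonpos_Ints_def)
  then have "(\<lambda>r. Gamma (1 + b) * (rl_kernel (1 + b) r * exp (- (s * r)))) =
     (\<lambda>t. exp_weight s t * t powr b)"
    using assms by (auto simp: rl_kernel_def exp_weight_def fun_eq_iff)
  ultimately show ?thesis by simp
qed

lemma integrable_exp_weight:
  assumes "0 < s"
  shows "integrable lborel (exp_weight s)"
proof -
  have "(\<lambda>t. exp_weight s t * t powr 0) = exp_weight s"
    by (auto simp: exp_weight_def fun_eq_iff)
  with integrable_exp_weight_powr[OF assms, of 0] show ?thesis by simp
qed

text \<open>Shifting t by x splits off exp (- s x) and leaves the Laplace transform of the
  kernel.\<close>

lemma nn_integral_exp_weight_rl_weight: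
  assumes "0 < s" "0 < \<alpha>"
  shows "(\<integral>\<^sup>+t. ennreal (exp_weight s t * rl_weight \<alpha> t x) \<partial>lborel) = ennreal (s powr - \<alpha> * exp_weight s x)"
proof (cases "0 < x")
  case True
  have "(\<integral>\<^sup>+t. ennreal (exp_weight s t * rl_weight \<alpha> t x) \<partial>lborel) =
      ennreal \<bar>1\<bar> * (\<integral>\<^sup>+t. ennreal (exp_weight s (x + 1 * t) * rl_weight \<alpha> (x + 1 * t) x) \<partial>lborel)"
    by (intro nn_integral_real_affine) auto
  also have "(\<lambda>t. ennreal (exp_weight s (x + 1 * t) * rl_weight \<alpha> (x + 1 * t) x)) =
     (\<lambda>t. ennreal (exp_weight s x) * ennreal (rl_kernel \<alpha> t * exp (- (s * t))))"
    using True assms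
    by (auto simp: fun_eq_iff exp_weight_def rl_weight_def rl_kernel_def ennreal_mult[symmetric]
        exp_add[symmetric] algebra_simps)
  also have "(\<integral>\<^sup>+t. ennreal (exp_weight s x) * ennreal (rl_kernel \<alpha> t * exp (- (s * t))) \<partial>lborel) =
     ennreal (exp_weight s x) * ennreal (s powr - \<alpha>)"
    using assms by (subst nn_integral_cmult) (auto simp: nn_integral_rl_kernel_exp)
  finally show ?thesis using assms
    by (simp add: ennreal_mult[symmetric] exp_weight_nonneg mult.commute)
next
  case False
  then show ?thesis by (simp add: rl_weight_def exp_weight_def)
qed

lemma integral_exp_weight_rl_weight:
  assumes "0 < s" "0 < \<alpha>"
  shows "integrable lborel (\<lambda>t. exp_weight s t * rl_weight \<alpha> t x)"
    and "(LBINT t. exp_weight s t * rl_weight \<alpha> t x) = s powr - \<alpha> * exp_weight s x"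
proof -
  have "has_bochner_integral lborel (\<lambda>t. exp_weight s t * rl_weight \<alpha> t x) (s powr - \<alpha> * exp_weight s x)"
    using nn_integral_exp_weight_rl_weight[OF assms]
    by (intro has_bochner_integral_nn_integral) (auto simp: exp_weight_nonneg rl_weight_nonneg assms)
  then show "integrable lborel (\<lambda>t. exp_weight s t * rl_weight \<alpha> t x)"
    and "(LBINT t. exp_weight s t * rl_weight \<alpha> t x) = s powr - \<alpha> * exp_weight s x"
    by (auto dest: integrable.intros simp: has_bochner_integral_integral_eq)
qed

section \<open>Integration over the plane\<close>

lemma integrable_lborel_times:
  fixes k1 k2 :: "real \<Rightarrow> real"
  assumes "integrable lborel k1" "integrable lborel k2"
  shows "integrable lborel (\<lambda>s. k1 (fst s) * k2 (snd s))"
proof -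
  have "integrable (lborel \<Otimes>\<^sub>M lborel) (\<lambda>s. k1 (fst s) * k2 (snd s))"
  proof (rule lborel_pair.Fubini_integrable)
    have [measurable]: "k1 \<in> borel_measurable borel" "k2 \<in> borel_measurable borel"
      using assms by auto
    show "(\<lambda>s. k1 (fst s) * k2 (snd s)) \<in> borel_measurable (lborel \<Otimes>\<^sub>M lborel)"
      by measurable
    show "integrable lborel (\<lambda>x. LBINT y. norm (k1 (fst (x, y)) * k2 (snd (x, y))))"
      using assms by (simp add: abs_mult)
    show "AE x in lborel. integrable lborel (\<lambda>y. k1 (fst (x, y)) * k2 (snd (x, y)))"
      using assms by simp
  qed
  then show ?thesis by (simp add: lborel_prod)
qed

text \<open>A majorant of product type reduces the hypotheses of Fubini's theorem to two
  one-dimensional integrability conditions. Exchanges between the two time variables rest on such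
  bounds.\<close>

lemma dominated_lborel_prod:
  fixes f :: "real \<times> real \<Rightarrow> real" and k1 k2 :: "real \<Rightarrow> real"
  assumes "integrable lborel k1" "integrable lborel k2"
    and f: "f \<in> borel_measurable borel"
    and le: "\<And>x y. \<bar>f (x, y)\<bar> \<le> k1 x * k2 y"
  shows integrable_lborel_dominated: "integrable lborel f"
    and lborel_iterated_fst: "(LBINT s. f s) = (LBINT x. LBINT y. f (x, y))"
    and lborel_iterated_snd: "(LBINT s. f s) = (LBINT y. LBINT x. f (x, y))"
proof -
  show 1: "integrable lborel f"
    by (rule Bochner_Integration.integrable_bound[OF integrable_lborel_times[OF assms(1,2)]])
      (use f le in \<open>auto intro!: order_trans[OF le abs_ge_self]\<close>)
  then have 2: "integrable (lborel \<Otimes>\<^sub>M lborel) (\<lambda>(x, y). f (x, y))"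
    by (simp add: lborel_prod)
  show "(LBINT s. f s) = (LBINT x. LBINT y. f (x, y))"
    using lborel_pair.integral_fst[OF 2] by (simp add: lborel_prod)
  show "(LBINT s. f s) = (LBINT y. LBINT x. f (x, y))"
    using lborel_pair.integral_snd[OF 2] by (simp add: lborel_prod)
qed

lemma measurable_fst_snd_real [measurable]:
  "(fst :: real \<times> real \<Rightarrow> real) \<in> borel_measurable borel"
  "(snd :: real \<times> real \<Rightarrow> real) \<in> borel_measurable borel"
  by (simp_all add: borel_prod[symmetric])

section \<open>Riemann-Liouville integrals in one and two time variables\<close>

definition rl_int :: "real \<Rightarrow> (real \<Rightarrow> real) \<Rightarrow> real \<Rightarrow> real" where
  "rl_int \<alpha> g t = (LBINT s. rl_weight \<alpha> t s * g s)"

definition rl_weight2 :: "real \<Rightarrow> real \<Rightarrow> real \<times> real \<Rightarrow> real \<times> real \<Rightarrow> real" where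
  "rl_weight2 a1 a2 t s = rl_weight a1 (fst t) (fst s) * rl_weight a2 (snd t) (snd s)"

definition rl_int2 :: "real \<Rightarrow> real \<Rightarrow> (real \<times> real \<Rightarrow> real) \<Rightarrow> real \<times> real \<Rightarrow> real" where
  "rl_int2 a1 a2 g t = (LBINT s. rl_weight2 a1 a2 t s * g s)"

lemma measurable_rl_weight2 [measurable]:
  assumes [measurable]: "f \<in> M \<rightarrow>\<^sub>M borel" "g \<in> M \<rightarrow>\<^sub>M borel"
  shows "(\<lambda>x. rl_weight2 a1 a2 (f x) (g x)) \<in> borel_measurable M"
proof -
  have [measurable]: "f \<in> M \<rightarrow>\<^sub>M borel \<Otimes>\<^sub>M borel" "g \<in> M \<rightarrow>\<^sub>M borel \<Otimes>\<^sub>M borel"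
    using assms by (simp_all add: borel_prod)
  show ?thesis unfolding rl_weight2_def by measurable
qed

lemma rl_weight2_nonneg: "0 < a1 \<Longrightarrow> 0 < a2 \<Longrightarrow> 0 \<le> rl_weight2 a1 a2 t s"
  by (simp add: rl_weight2_def rl_weight_nonneg)

lemma integrable_rl_weight2:
  assumes "0 < a1" "0 < a2"
  shows "integrable lborel (rl_weight2 a1 a2 t)"
  unfolding rl_weight2_def[abs_def] by (intro integrable_lborel_times integrable_rl_weight assms)

lemma integrable_rl_weight2_times:
  assumes "0 < a1" "0 < a2" and g: "g \<in> borel_measurable borel"
    and B: "\<And>s. 0 < fst s \<Longrightarrow> fst s < fst t \<Longrightarrow> 0 < snd s \<Longrightarrow> snd s < snd t \<Longrightarrow> \<bar>g s\<bar> \<le> B"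
  shows "integrable lborel (\<lambda>s. rl_weight2 a1 a2 t s * g s)"
proof (rule Bochner_Integration.integrable_bound)
  show "integrable lborel (\<lambda>s. rl_weight2 a1 a2 t s * B)"
    using integrable_rl_weight2[OF assms(1,2)] by simp
  show "(\<lambda>s. rl_weight2 a1 a2 t s * g s) \<in> borel_measurable lborel" using g by measurable
  have "\<bar>rl_weight2 a1 a2 t s * g s\<bar> \<le> \<bar>rl_weight2 a1 a2 t s * B\<bar>" for s
  proof (cases "0 < fst s \<and> fst s < fst t \<and> 0 < snd s \<and> snd s < snd t")
    case True
    then have "\<bar>g s\<bar> \<le> \<bar>B\<bar>" using B[of s] by auto
    then show ?thesis by (simp add: abs_mult mult_left_mono)
  next
    case False
    then have "rl_weight2 a1 a2 t s = 0"
      by (auto simp: rl_weight2_def rl_weight_def rl_kernel_def)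
    then show ?thesis by simp
  qed
  then show "AE s in lborel. norm (rl_weight2 a1 a2 t s * g s) \<le> norm (rl_weight2 a1 a2 t s * B)" by simp
qed

lemma rl_int2_cong:
  assumes "\<And>s. 0 < fst s \<Longrightarrow> fst s < fst t \<Longrightarrow> 0 < snd s \<Longrightarrow> snd s < snd t \<Longrightarrow> g s = h s"
  shows "rl_int2 a1 a2 g t = rl_int2 a1 a2 h t"
proof -
  have "rl_weight2 a1 a2 t s * g s = rl_weight2 a1 a2 t s * h s" for s
    using assms[of s] by (auto simp: rl_weight2_def rl_weight_def rl_kernel_def)
  then show ?thesis unfolding rl_int2_def by presburger
qed

lemma rl_int2_iterated:
  assumes "0 < a1" "0 < a2" and g: "g \<in> borel_measurable borel" and B: "\<And>s. \<bar>g s\<bar> \<le> B"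
  shows "rl_int2 a1 a2 g t = rl_int a1 (\<lambda>s1. rl_int a2 (\<lambda>s2. g (s1, s2)) (snd t)) (fst t)"
proof -
  have "rl_int2 a1 a2 g t = (LBINT x. LBINT y. rl_weight2 a1 a2 t (x, y) * g (x, y))"
    unfolding rl_int2_def
  proof (rule lborel_iterated_fst)
    show "integrable lborel (\<lambda>x. B * rl_weight a1 (fst t) x)" "integrable lborel (rl_weight a2 (snd t))"
      using integrable_rl_weight assms by auto
    show "(\<lambda>s. rl_weight2 a1 a2 t s * g s) \<in> borel_measurable borel" using g by measurable
    show "\<bar>rl_weight2 a1 a2 t (x, y) * g (x, y)\<bar> \<le> B * rl_weight a1 (fst t) x * rl_weight a2 (snd t) y" for x y
      using mult_left_mono[OF B[of "(x, y)"] rl_weight2_nonneg[OF assms(1,2), of t "(x, y)"]]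
        rl_weight2_nonneg[OF assms(1,2), of t "(x, y)"]
      by (simp add: abs_mult abs_of_nonneg rl_weight_nonneg assms rl_weight2_def mult_ac)
  qed
  also have "\<dots> = (LBINT x. rl_weight a1 (fst t) x * (LBINT y. rl_weight a2 (snd t) y * g (x, y)))"
    unfolding rl_weight2_def by (simp add: mult.assoc)
  finally show ?thesis by (simp add: rl_int_def)
qed

text \<open>By the mean value theorem the bound on f' near x bounds all difference quotients, so
  dominated convergence applies along every sequence tending to x. Integrability is assumed at x
  alone and propagates from there; f' x is measurable as a limit of difference quotients.\<close>

lemma has_real_derivative_integral_dominated:
  fixes f f' :: "real \<Rightarrow> 'a \<Rightarrow> real"
  assumes "0 < d"
    and meas: "\<And>y. \<bar>y - x\<bar> < d \<Longrightarrow> f y \<in> borel_measurable M"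
    and int: "integrable M (f x)"
    and deriv: "\<And>y \<omega>. \<omega> \<in> space M \<Longrightarrow> \<bar>y - x\<bar> < d \<Longrightarrow>
      ((\<lambda>y. f y \<omega>) has_real_derivative f' y \<omega>) (at y)"
    and bound: "\<And>y \<omega>. \<omega> \<in> space M \<Longrightarrow> \<bar>y - x\<bar> < d \<Longrightarrow> \<bar>f' y \<omega>\<bar> \<le> w \<omega>"
    and w: "integrable M w"
  shows "((\<lambda>y. \<integral>\<omega>. f y \<omega> \<partial>M) has_real_derivative (\<integral>\<omega>. f' x \<omega> \<partial>M)) (at x)"
    and "f' x \<in> borel_measurable M"
proof -
  have quot: "\<bar>(f y \<omega> - f x \<omega>) / (y - x)\<bar> \<le> w \<omega>" if "\<omega> \<in> space M" "\<bar>y - x\<bar> < d" "y \<noteq> x" for y \<omega>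
  proof -
    have "\<exists>z. \<bar>z - x\<bar> < d \<and> f y \<omega> - f x \<omega> = (y - x) * f' z \<omega>"
    proof (cases "x < y")
      case True
      have "\<exists>z. x < z \<and> z < y \<and> f y \<omega> - f x \<omega> = (y - x) * f' z \<omega>"
        using that True by (intro MVT2 deriv) auto
      then show ?thesis using that True by (metis abs_of_pos diff_gt_0_iff_gt diff_strict_right_mono order_less_trans)
    next
      case False
      then have "\<exists>z. y < z \<and> z < x \<and> f x \<omega> - f y \<omega> = (x - y) * f' z \<omega>"
        using that by (intro MVT2 deriv) auto
      then obtain z where "y < z" "z < x" "f x \<omega> - f y \<omega> = (x - y) * f' z \<omega>" by auto
      then have "\<bar>z - x\<bar> < d \<and> f y \<omega> - f x \<omega> = (y - x) * f' z \<omega>"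
        using that by (auto simp: algebra_simps)
      then show ?thesis by blast
    qed
    then obtain z where z: "\<bar>z - x\<bar> < d" "f y \<omega> - f x \<omega> = (y - x) * f' z \<omega>"
      by blast
    then have "(f y \<omega> - f x \<omega>) / (y - x) = f' z \<omega>" using that by simp
    with bound[OF that(1) z(1)] show ?thesis by simp
  qed
  define q where "q y \<omega> = (f y \<omega> - f x \<omega>) / (y - x)" for y \<omega>
  have lim: "(\<lambda>n. q (X n) \<omega>) \<longlonglongrightarrow> f' x \<omega>"
    if "\<omega> \<in> space M" "X \<longlonglongrightarrow> x" "\<And>n. X n \<noteq> x" for X \<omega>
  proof -
    have "((\<lambda>y. q y \<omega>) \<longlongrightarrow> f' x \<omega>) (at x)"
      using deriv[OF that(1), of x] \<open>0 < d\<close> by (simp add: has_field_derivative_iff q_def)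
    then show ?thesis using that unfolding tendsto_at_iff_sequentially comp_def by blast
  qed
  have key: "(\<lambda>n. \<integral>\<omega>. q (X n) \<omega> \<partial>M) \<longlonglongrightarrow> (\<integral>\<omega>. f' x \<omega> \<partial>M) \<and> f' x \<in> borel_measurable M"
    if "X \<longlonglongrightarrow> x" "\<And>n. X n \<noteq> x" "\<And>n. \<bar>X n - x\<bar> < d" for X
  proof -
    have m: "q (X n) \<in> borel_measurable M" for n
      using meas[OF that(3)] meas[of x] \<open>0 < d\<close> unfolding q_def[abs_def]
      by (intro borel_measurable_divide borel_measurable_diff) auto
    have m': "f' x \<in> borel_measurable M"
      by (rule borel_measurable_LIMSEQ_real[OF lim[OF _ that(1,2)] m])
    have "(\<lambda>n. \<integral>\<omega>. q (X n) \<omega> \<partial>M) \<longlonglongrightarrow> (\<integral>\<omega>. f' x \<omega> \<partial>M)"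
      by (rule integral_dominated_convergence[OF m' m w])
        (use lim[OF _ that(1,2)] quot[OF _ that(3) that(2)] in \<open>auto simp: q_def\<close>)
    with m' show ?thesis by simp
  qed
  \<comment> \<open>One concrete sequence that avoids x and, because of n + 2, stays strictly closer
    than d. It yields measurability of the derivative.\<close>
  have "(\<lambda>n. x + d / real (n + 2)) \<longlonglongrightarrow> x + 0"
    by (intro tendsto_add tendsto_const LIMSEQ_ignore_initial_segment[OF lim_const_over_n])
  moreover have "\<bar>x + d / real (n + 2) - x\<bar> < d" for n
    using \<open>0 < d\<close> by (simp add: divide_less_eq add_strict_increasing)
  ultimately show "f' x \<in> borel_measurable M"
    using key[of "\<lambda>n. x + d / real (n + 2)"] \<open>0 < d\<close> by auto
  \<comment> \<open>By the quotient bound f y differs from f x by at most |y - x| w.\<close>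
  have I: "integrable M (f y)" if "\<bar>y - x\<bar> < d" for y
  proof (cases "y = x")
    case False
    show ?thesis
    proof (rule Bochner_Integration.integrable_bound)
      show "integrable M (\<lambda>\<omega>. \<bar>f x \<omega>\<bar> + \<bar>y - x\<bar> * w \<omega>)" using int w by auto
      have "\<bar>f y \<omega>\<bar> \<le> \<bar>f x \<omega>\<bar> + \<bar>y - x\<bar> * w \<omega>" if "\<omega> \<in> space M" for \<omega>
      proof -
        have "\<bar>f y \<omega> - f x \<omega>\<bar> \<le> \<bar>y - x\<bar> * w \<omega>"
          using quot[OF that \<open>\<bar>y - x\<bar> < d\<close> False] False by (simp add: abs_divide field_simps)
        then show ?thesis by linarith
      qed
      then show "AE \<omega> in M. norm (f y \<omega>) \<le> norm (\<bar>f x \<omega>\<bar> + \<bar>y - x\<bar> * w \<omega>)"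
        by (auto intro!: AE_I2 order_trans[OF _ abs_ge_self])
    qed (use meas that in auto)
  qed (use int in simp)
  show "((\<lambda>y. \<integral>\<omega>. f y \<omega> \<partial>M) has_real_derivative (\<integral>\<omega>. f' x \<omega> \<partial>M)) (at x)"
    unfolding has_field_derivative_iff tendsto_at_iff_sequentially comp_def
  proof (intro allI impI)
    fix X assume X: "\<forall>i. X i \<in> UNIV - {x}" "X \<longlonglongrightarrow> x"
    then obtain n0 where n0: "\<And>n. n \<ge> n0 \<Longrightarrow> \<bar>X n - x\<bar> < d"
      using \<open>0 < d\<close> unfolding LIMSEQ_def dist_real_def by blast
    have "(\<lambda>n. \<integral>\<omega>. q (X (n + n0)) \<omega> \<partial>M) \<longlonglongrightarrow> (\<integral>\<omega>. f' x \<omega> \<partial>M)"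
      using key[of "\<lambda>n. X (n + n0)"] X n0 LIMSEQ_ignore_initial_segment[OF X(2), of n0] by auto
    also have "(\<lambda>n. \<integral>\<omega>. q (X (n + n0)) \<omega> \<partial>M) =
      (\<lambda>n. ((\<integral>\<omega>. f (X (n + n0)) \<omega> \<partial>M) - (\<integral>\<omega>. f x \<omega> \<partial>M)) / (X (n + n0) - x))"
      using I n0 int unfolding q_def by (auto simp: fun_eq_iff Bochner_Integration.integral_diff)
    finally show "(\<lambda>n. ((\<integral>\<omega>. f (X n) \<omega> \<partial>M) - (\<integral>\<omega>. f x \<omega> \<partial>M)) / (X n - x)) \<longlonglongrightarrow> (\<integral>\<omega>. f' x \<omega> \<partial>M)"
      by (rule LIMSEQ_offset)
  qed
qed

section \<open>Caputo derivatives and Laplace transforms\<close>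

text \<open>The fundamental theorem of fractional calculus. For \<alpha> < 1 the Caputo derivative
  is the integral of order 1 - \<alpha> of g'; exchanging integrals convolves the two kernels into
  the kernel of order 1, an indicator, and leaves the integral of g'. The function \<open>h\<close>
  is a Borel function on the line that agrees with the Caputo derivative inside (0, t).\<close>

lemma rl_int_caputo:
  assumes \<alpha>: "0 < \<alpha>" "\<alpha> \<le> 1" and t: "0 < t"
    and g: "caputo_differentiable \<alpha> g"
    and h: "\<And>s. 0 < s \<Longrightarrow> s < t \<Longrightarrow> caputo \<alpha> g s = h s"
    and h_meas: "h \<in> borel_measurable borel"
    and h_bound: "\<And>s. 0 < s \<Longrightarrow> s < t \<Longrightarrow> \<bar>h s\<bar> \<le> B"
  shows "rl_int \<alpha> h t = g t - g 0"
proof -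
  have gd: "(g has_real_derivative deriv g s) (at s)" if "0 < s" for s
    using g that unfolding caputo_differentiable_def
    by (auto simp: real_differentiable_def dest: DERIV_imp_deriv)
  \<comment> \<open>\<open>g\<close> may fail to be differentiable at 0, so the version with
    continuity on [0, t] and a derivative in the interior is used.\<close>
  have ftc: "(deriv g has_integral g t - g 0) {0..t}"
  proof (rule fundamental_theorem_of_calculus_interior)
    show "continuous_on {0..t} g"
      using g by (auto simp: caputo_differentiable_def intro: continuous_on_subset)
  qed (use t gd in \<open>auto simp: has_real_derivative_iff_has_vector_derivative[symmetric]\<close>)
  then have ftc': "(deriv g has_integral g t - g 0) {0<..<t}"
    by (simp add: has_integral_Icc_iff_Ioo)
  show ?thesis
  proof (cases "\<alpha> = 1")
    case True
    have w: "rl_weight \<alpha> t = indicator {0<..<t}"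
      using True by (auto simp: rl_weight_def rl_kernel_def fun_eq_iff)
    have int: "set_integrable lborel {0<..<t} h"
      unfolding set_integrable_def
    proof (rule Bochner_Integration.integrable_bound)
      show "integrable lborel (\<lambda>s. indicator {0<..<t} s * B)"
        using integrable_rl_weight[OF \<alpha>(1), of t] by (simp add: w)
      show "(\<lambda>s. indicat_real {0<..<t} s *\<^sub>R h s) \<in> borel_measurable lborel"
        using h_meas by measurable
      show "AE s in lborel. norm (indicat_real {0<..<t} s *\<^sub>R h s) \<le> norm (indicator {0<..<t} s * B)"
        using h_bound by (auto simp: indicator_def intro!: AE_I2 order_trans[OF _ abs_ge_self])
    qed
    have "rl_int \<alpha> h t = (LINT s:{0<..<t}|lborel. h s)"
      by (simp add: rl_int_def w set_lebesgue_integral_def)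
    also have "\<dots> = integral {0<..<t} h"
      by (rule set_borel_integral_eq_integral[OF int])
    also have "\<dots> = integral {0<..<t} (deriv g)"
      by (rule integral_cong) (use h True in \<open>auto simp: caputo_def\<close>)
    also have "\<dots> = g t - g 0"
      by (rule integral_unique[OF ftc'])
    finally show ?thesis .
  next
    case False
    with \<alpha> have a1: "0 < 1 - \<alpha>" "\<alpha> < 1" by auto
    define G where "G r = indicator {0<..<t} r * deriv g r" for r
    have int0: "integrable lborel (\<lambda>r. indicator {0<..<t} r * (deriv g r / (t - r) powr \<alpha>))"
      using g t False by (simp add: caputo_differentiable_def set_integrable_def)
    \<comment> \<open>Neither measurability nor integrability of \<open>deriv g\<close> is assumed.
      Both are read off from the Caputo integrand, from which it differs by the factor (t -
      r)^\<alpha>, at most t^\<alpha>.\<close>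
    have G: "integrable lborel G"
    proof (rule Bochner_Integration.integrable_bound)
      show "integrable lborel (\<lambda>r. t powr \<alpha> * (indicator {0<..<t} r * (deriv g r / (t - r) powr \<alpha>)))"
        using int0 by (rule integrable_mult_right)
      have [measurable]: "(\<lambda>r. indicator {0<..<t} r * (deriv g r / (t - r) powr \<alpha>)) \<in> borel_measurable borel"
        using borel_measurable_integrable[OF int0] by simp
      have "(\<lambda>r. (t - r) powr \<alpha> * (indicator {0<..<t} r * (deriv g r / (t - r) powr \<alpha>))) \<in> borel_measurable borel"
        by measurable
      also have "(\<lambda>r. (t - r) powr \<alpha> * (indicator {0<..<t} r * (deriv g r / (t - r) powr \<alpha>))) = G"
        by (auto simp: G_def indicator_def fun_eq_iff)
      finally show "G \<in> borel_measurable lborel" by simp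
      have "\<bar>G r\<bar> \<le> t powr \<alpha> * \<bar>indicator {0<..<t} r * (deriv g r / (t - r) powr \<alpha>)\<bar>" for r
      proof (cases "0 < r \<and> r < t")
        case True
        then have "(t - r) powr \<alpha> \<le> t powr \<alpha>" "0 < (t - r) powr \<alpha>" using \<alpha> by (auto intro: powr_mono2)
        then have "\<bar>deriv g r\<bar> * (t - r) powr \<alpha> \<le> t powr \<alpha> * \<bar>deriv g r\<bar>"
          using mult_right_mono[of "(t - r) powr \<alpha>" "t powr \<alpha>" "\<bar>deriv g r\<bar>"] by (simp add: mult.commute)
        then show ?thesis using True \<open>0 < (t - r) powr \<alpha>\<close> by (simp add: G_def abs_mult field_simps)
      qed (auto simp: G_def)
      then show "AE r in lborel. norm (G r) \<le>
          norm (t powr \<alpha> * (indicator {0<..<t} r * (deriv g r / (t - r) powr \<alpha>)))"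
        by (simp add: abs_mult)
    qed
    then have [measurable]: "G \<in> borel_measurable borel" by auto
    have G_int: "(LBINT r. G r) = g t - g 0"
    proof -
      have "set_integrable lborel {0<..<t} (deriv g)"
        using G by (simp add: set_integrable_def G_def[abs_def])
      then have "(LINT r:{0<..<t}|lborel. deriv g r) = integral {0<..<t} (deriv g)"
        by (rule set_borel_integral_eq_integral)
      then show ?thesis
        using integral_unique[OF ftc'] by (simp add: G_def set_lebesgue_integral_def)
    qed
    \<comment> \<open>Orders \<alpha> and 1 - \<alpha> add up to 1, and the kernel of order 1 is the
      constant 1 on its support.\<close>
    have ker: "has_bochner_integral lborel (\<lambda>s. rl_weight \<alpha> t s * rl_weight (1 - \<alpha>) s r)
        (indicator {0<..<t} r)" for r
    proof (rule has_bochner_integral_nn_integral)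
      have eq: "rl_weight \<alpha> t s * rl_weight (1 - \<alpha>) s r =
          indicator {0<..} r * (rl_kernel \<alpha> (t - s) * rl_kernel (1 - \<alpha>) (s - r))" for s
        by (auto simp: rl_weight_def rl_kernel_def)
      show "(\<integral>\<^sup>+ s. ennreal (rl_weight \<alpha> t s * rl_weight (1 - \<alpha>) s r) \<partial>lborel) =
          ennreal (indicator {0<..<t} r)"
        unfolding eq using nn_integral_rl_kernel_convolution[OF \<alpha>(1) a1(1), of t r]
        by (cases "0 < r") (auto simp: rl_kernel_def[of 1] indicator_def)
      show "AE s in lborel. 0 \<le> rl_weight \<alpha> t s * rl_weight (1 - \<alpha>) s r"
        using \<alpha> a1 by (auto simp: rl_weight_nonneg)
    qed (auto simp: indicator_def)
    have ker_abs: "\<bar>rl_weight \<alpha> t s * (rl_weight (1 - \<alpha>) s r * G r)\<bar> =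
        rl_weight \<alpha> t s * rl_weight (1 - \<alpha>) s r * \<bar>G r\<bar>" for s r
      using \<alpha> a1 by (simp add: abs_mult abs_of_nonneg rl_weight_nonneg)
    have "integrable (lborel \<Otimes>\<^sub>M lborel) (\<lambda>(r, s). rl_weight \<alpha> t s * (rl_weight (1 - \<alpha>) s r * G r))"
    proof (rule lborel_pair.Fubini_integrable)
      show "(\<lambda>(r, s). rl_weight \<alpha> t s * (rl_weight (1 - \<alpha>) s r * G r)) \<in> borel_measurable (lborel \<Otimes>\<^sub>M lborel)"
        by measurable
      have "(LBINT s. norm (rl_weight \<alpha> t s * (rl_weight (1 - \<alpha>) s r * G r))) = \<bar>G r\<bar>" for r
        using has_bochner_integral_integral_eq[OF ker[of r]]
        by (simp add: ker_abs) (auto simp: G_def indicator_def)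
      then show "integrable lborel (\<lambda>r. LBINT s. norm (case (r, s) of (r, s) \<Rightarrow>
          rl_weight \<alpha> t s * (rl_weight (1 - \<alpha>) s r * G r)))"
        using G by simp
      have "integrable lborel (\<lambda>s. rl_weight \<alpha> t s * rl_weight (1 - \<alpha>) s r * G r)" for r
        using ker[of r] by (auto dest: integrable.intros)
      then show "AE r in lborel. integrable lborel (\<lambda>s. case (r, s) of (r, s) \<Rightarrow>
          rl_weight \<alpha> t s * (rl_weight (1 - \<alpha>) s r * G r))"
        by (simp add: mult.assoc)
    qed
    then have swap: "(LBINT s. LBINT r. rl_weight \<alpha> t s * (rl_weight (1 - \<alpha>) s r * G r)) =
        (LBINT r. LBINT s. rl_weight \<alpha> t s * (rl_weight (1 - \<alpha>) s r * G r))"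
      by (rule lborel_pair.Fubini_integral)
    have "rl_weight \<alpha> t s * h s = (LBINT r. rl_weight \<alpha> t s * (rl_weight (1 - \<alpha>) s r * G r))" for s
    proof (cases "0 < s \<and> s < t")
      case True
      have "h s = 1 / Gamma (1 - \<alpha>) * (LBINT r. indicator {0<..<s} r * (deriv g r / (s - r) powr \<alpha>))"
        using h[of s] True False by (simp add: caputo_def set_lebesgue_integral_def)
      also have "\<dots> = (LBINT r. 1 / Gamma (1 - \<alpha>) * (indicator {0<..<s} r * (deriv g r / (s - r) powr \<alpha>)))"
        by (rule integral_mult_right_zero[symmetric])
      also have "\<dots> = (LBINT r. rl_weight (1 - \<alpha>) s r * G r)"
        by (rule Bochner_Integration.integral_cong)
          (use True in \<open>auto simp: rl_weight_def rl_kernel_def G_def indicator_def powr_minus field_simps\<close>)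
      finally show ?thesis by simp
    qed (simp add: rl_weight_eq_0)
    then have "rl_int \<alpha> h t = (LBINT s. LBINT r. rl_weight \<alpha> t s * (rl_weight (1 - \<alpha>) s r * G r))"
      unfolding rl_int_def by presburger
    also have "\<dots> = (LBINT r. LBINT s. rl_weight \<alpha> t s * rl_weight (1 - \<alpha>) s r * G r)"
      unfolding swap by (simp add: mult.assoc)
    also have "\<dots> = (LBINT r. indicator {0<..<t} r * G r)"
      using has_bochner_integral_integral_eq[OF ker] by simp
    also have "\<dots> = (LBINT r. G r)"
      by (rule Bochner_Integration.integral_cong) (auto simp: G_def indicator_def)
    finally show ?thesis by (simp add: G_int)
  qed
qed

text \<open>The absolute value on the right, together with the case of negative \<open>t\<close>,
  where the integral is 0, makes the bound valid on the whole line; it then serves as a majorant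
  under Laplace integrals.\<close>

lemma abs_rl_int_le:
  assumes \<alpha>: "0 < \<alpha>" and g: "g \<in> borel_measurable borel"
    and B: "\<And>s. 0 < s \<Longrightarrow> s < t \<Longrightarrow> \<bar>g s\<bar> \<le> B" "0 \<le> B"
  shows "\<bar>rl_int \<alpha> g t\<bar> \<le> B * \<bar>t powr \<alpha> / Gamma (1 + \<alpha>)\<bar>"
proof (cases "0 \<le> t")
  case True
  have "\<bar>rl_int \<alpha> g t\<bar> \<le> (LBINT s. rl_weight \<alpha> t s * B)"
    unfolding rl_int_def
  proof (rule integral_abs_bound_integral)
    show le: "\<bar>rl_weight \<alpha> t s * g s\<bar> \<le> rl_weight \<alpha> t s * B" for s
      using B rl_weight_nonneg[OF \<alpha>, of t s] rl_weight_eq_0[of s t \<alpha>]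
      by (cases "0 < s \<and> s < t") (auto simp: abs_mult mult_left_mono)
    show "integrable lborel (\<lambda>s. rl_weight \<alpha> t s * B)"
      using integrable_rl_weight[OF \<alpha>] by simp
    then show "integrable lborel (\<lambda>s. rl_weight \<alpha> t s * g s)"
      by (rule Bochner_Integration.integrable_bound)
        (use g in \<open>auto intro!: AE_I2 order_trans[OF le abs_ge_self]\<close>)
  qed
  also have "\<dots> = B * (t powr \<alpha> / Gamma (1 + \<alpha>))"
    using integral_rl_weight[OF \<alpha> True] by (simp add: mult.commute)
  also have "\<dots> \<le> B * \<bar>t powr \<alpha> / Gamma (1 + \<alpha>)\<bar>"
    by (intro mult_left_mono abs_ge_self B)
  finally show ?thesis .
next
  case False
  then have z: "rl_weight \<alpha> t s * g s = 0" for s by (simp add: rl_weight_eq_0)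
  show ?thesis unfolding rl_int_def z using B by simp
qed

section \<open>Laplace transforms of Riemann-Liouville integrals\<close>

lemma laplace_rl_int:
  assumes s: "0 < s" and \<alpha>: "0 < \<alpha>" and g [measurable]: "g \<in> borel_measurable borel"
    and B: "\<And>x. \<bar>g x\<bar> \<le> B"
  shows "(LBINT t. exp_weight s t * rl_int \<alpha> g t) = s powr - \<alpha> * (LBINT x. exp_weight s x * g x)"
proof -
  note ker = integral_exp_weight_rl_weight[OF s \<alpha>]
  have "integrable (lborel \<Otimes>\<^sub>M lborel) (\<lambda>(x, t). exp_weight s t * (rl_weight \<alpha> t x * g x))"
  proof (rule lborel_pair.Fubini_integrable)
    show "(\<lambda>(x, t). exp_weight s t * (rl_weight \<alpha> t x * g x)) \<in> borel_measurable (lborel \<Otimes>\<^sub>M lborel)"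
      by measurable
    have "norm (exp_weight s t * (rl_weight \<alpha> t x * g x)) = exp_weight s t * rl_weight \<alpha> t x * \<bar>g x\<bar>" for x t
      by (simp add: abs_mult abs_of_nonneg rl_weight_nonneg exp_weight_nonneg \<alpha>)
    then have eq: "(LBINT t. norm (exp_weight s t * (rl_weight \<alpha> t x * g x))) = s powr - \<alpha> * exp_weight s x * \<bar>g x\<bar>" for x
      using ker by simp
    have "integrable lborel (\<lambda>x. s powr - \<alpha> * exp_weight s x * \<bar>g x\<bar>)"
    proof (rule Bochner_Integration.integrable_bound)
      show "integrable lborel (\<lambda>x. s powr - \<alpha> * exp_weight s x * B)"
        using integrable_exp_weight[OF s] by simp
      show "AE x in lborel. norm (s powr - \<alpha> * exp_weight s x * \<bar>g x\<bar>) \<le> norm (s powr - \<alpha> * exp_weight s x * B)"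
        using B by (auto simp: abs_mult intro!: AE_I2 mult_left_mono order_trans[OF B abs_ge_self])
    qed measurable
    then show "integrable lborel (\<lambda>x. LBINT t. norm (case (x, t) of (x, t) \<Rightarrow> exp_weight s t * (rl_weight \<alpha> t x * g x)))"
      using eq by simp
    have "integrable lborel (\<lambda>t. exp_weight s t * rl_weight \<alpha> t x * g x)" for x
      using ker(1) by simp
    then show "AE x in lborel. integrable lborel (\<lambda>t. case (x, t) of (x, t) \<Rightarrow> exp_weight s t * (rl_weight \<alpha> t x * g x))"
      by (simp add: mult.assoc)
  qed
  then have "(LBINT t. LBINT x. exp_weight s t * (rl_weight \<alpha> t x * g x)) =
      (LBINT x. LBINT t. exp_weight s t * (rl_weight \<alpha> t x * g x))"
    by (rule lborel_pair.Fubini_integral)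
  also have "\<dots> = (LBINT x. LBINT t. exp_weight s t * rl_weight \<alpha> t x * g x)"
    by (simp add: mult.assoc)
  also have "\<dots> = (LBINT x. s powr - \<alpha> * exp_weight s x * g x)"
    using ker by simp
  finally show ?thesis by (simp add: rl_int_def mult.assoc)
qed

lemma measurable_rl_int2 [measurable]:
  assumes [measurable]: "g \<in> borel_measurable borel"
  shows "rl_int2 a1 a2 g \<in> borel_measurable borel"
  unfolding rl_int2_def[abs_def] by measurable

text \<open>Each time integral contributes its own power. The transform in t1 is taken inside, the
  order is exchanged, and the transform in t2 follows; the exchange is dominated because fractional
  integrals of bounded functions grow like powers of t.\<close>

lemma laplace_rl_int2:
  assumes s: "0 < s1" "0 < s2" and \<alpha>: "0 < a1" "0 < a2"
    and g [measurable]: "g \<in> borel_measurable borel" and B: "\<And>x. \<bar>g x\<bar> \<le> B"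
  shows "integrable lborel (\<lambda>t. exp_weight s1 (fst t) * exp_weight s2 (snd t) * rl_int2 a1 a2 g t)"
    and "(LBINT t. exp_weight s1 (fst t) * exp_weight s2 (snd t) * rl_int2 a1 a2 g t) =
      s1 powr - a1 * s2 powr - a2 * (LBINT x. exp_weight s1 (fst x) * exp_weight s2 (snd x) * g x)"
proof -
  have B0: "0 \<le> B" using B[of undefined] by linarith
  have [measurable]: "g \<in> borel_measurable (borel \<Otimes>\<^sub>M borel)" by (simp add: borel_prod)
  define A where "A x1 t2 = rl_int a2 (\<lambda>x2. g (x1, x2)) t2" for x1 t2
  have A_meas [measurable]: "(\<lambda>x. A (fst x) (snd x)) \<in> borel_measurable (borel \<Otimes>\<^sub>M borel)"
    unfolding A_def rl_int_def by measurable
  have A_meas': "(\<lambda>x. A (fst x) (snd x)) \<in> borel_measurable borel"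
    using A_meas by (simp add: borel_prod)
  have A_meas1 [measurable]: "(\<lambda>x1. A x1 t2) \<in> borel_measurable borel" for t2
    unfolding A_def rl_int_def by measurable
  define W where "W \<alpha> t = \<bar>t powr \<alpha> / Gamma (1 + \<alpha>)\<bar>" for \<alpha> t :: real
  have A_le: "\<bar>A x1 t2\<bar> \<le> B * W a2 t2" for x1 t2
    unfolding A_def W_def by (rule abs_rl_int_le[OF \<alpha>(2)]) (use B B0 in auto)
  have J: "rl_int2 a1 a2 g (t1, t2) = rl_int a1 (\<lambda>x1. A x1 t2) t1" for t1 t2
    using rl_int2_iterated[OF \<alpha> g B] by (simp add: A_def)
  have W0: "0 \<le> W \<alpha> t" for \<alpha> t by (simp add: W_def)
  have J_le: "\<bar>rl_int2 a1 a2 g (t1, t2)\<bar> \<le> B * W a1 t1 * W a2 t2" for t1 t2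
  proof -
    have "\<bar>rl_int2 a1 a2 g (t1, t2)\<bar> \<le> B * W a2 t2 * W a1 t1"
      unfolding J W_def[of a1] by (rule abs_rl_int_le[OF \<alpha>(1)]) (use A_le B0 W0 in auto)
    then show ?thesis by (simp add: mult_ac)
  qed
  have int: "integrable lborel (\<lambda>t. exp_weight s t * W \<alpha> t)" if "0 < s" "0 < \<alpha>" for s \<alpha>
  proof -
    have "integrable lborel (\<lambda>t. exp_weight s t * t powr \<alpha> / Gamma (1 + \<alpha>))"
      using integrable_exp_weight_powr[of s \<alpha>] that by simp
    moreover have "(\<lambda>t. exp_weight s t * t powr \<alpha> / Gamma (1 + \<alpha>)) = (\<lambda>t. exp_weight s t * W \<alpha> t)"
      using that by (auto simp: W_def fun_eq_iff)
    ultimately show ?thesis by simp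
  qed
  have e0: "0 \<le> exp_weight s1 x * exp_weight s2 y" for x y
    by (simp add: exp_weight_nonneg)
  have bnd: "\<bar>exp_weight s1 x * exp_weight s2 y * c\<bar> \<le> B * (exp_weight s1 x * p) * (exp_weight s2 y * q)"
    if "\<bar>c\<bar> \<le> B * p * q" for x y c p q
  proof -
    have "\<bar>exp_weight s1 x * exp_weight s2 y * c\<bar> = exp_weight s1 x * exp_weight s2 y * \<bar>c\<bar>"
      using e0[of x y] by (simp only: abs_mult[of _ c] abs_of_nonneg)
    also have "\<dots> \<le> exp_weight s1 x * exp_weight s2 y * (B * p * q)"
      by (rule mult_left_mono[OF that e0])
    finally show ?thesis by (simp add: mult_ac)
  qed
  have dom: "integrable lborel (\<lambda>x. B * (exp_weight s1 x * W a1 x))" "integrable lborel (\<lambda>y. exp_weight s2 y * W a2 y)"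
    using int s \<alpha> by auto
  have m: "(\<lambda>t. exp_weight s1 (fst t) * exp_weight s2 (snd t) * rl_int2 a1 a2 g t) \<in> borel_measurable borel"
    by measurable
  have b1: "\<bar>exp_weight s1 (fst (x, y)) * exp_weight s2 (snd (x, y)) * rl_int2 a1 a2 g (x, y)\<bar> \<le>
    B * (exp_weight s1 x * W a1 x) * (exp_weight s2 y * W a2 y)" for x y
    using bnd[OF J_le[of x y]] by simp
  show "integrable lborel (\<lambda>t. exp_weight s1 (fst t) * exp_weight s2 (snd t) * rl_int2 a1 a2 g t)"
    by (rule integrable_lborel_dominated[OF dom m b1])
  have "(LBINT t. exp_weight s1 (fst t) * exp_weight s2 (snd t) * rl_int2 a1 a2 g t) =
     (LBINT t2. LBINT t1. exp_weight s1 t1 * exp_weight s2 t2 * rl_int2 a1 a2 g (t1, t2))"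
    using lborel_iterated_snd[OF dom m b1] by simp
  also have "\<dots> = (LBINT t2. exp_weight s2 t2 * (LBINT t1. exp_weight s1 t1 * rl_int a1 (\<lambda>x1. A x1 t2) t1))"
    by (simp add: J mult.assoc mult.left_commute[of "exp_weight s1 _"])
  also have "\<dots> = (LBINT t2. exp_weight s2 t2 * (s1 powr - a1 * (LBINT x1. exp_weight s1 x1 * A x1 t2)))"
    by (subst laplace_rl_int[OF s(1) \<alpha>(1) A_meas1 A_le]) (rule refl)
  also have "\<dots> = s1 powr - a1 * (LBINT t2. LBINT x1. exp_weight s1 x1 * exp_weight s2 t2 * A x1 t2)"
    by (simp add: mult.assoc mult.left_commute[of "exp_weight s1 _"] mult.left_commute[of "exp_weight s2 _" "s1 powr _"])
  also have "(LBINT t2. LBINT x1. exp_weight s1 x1 * exp_weight s2 t2 * A x1 t2) =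
      (LBINT x1. LBINT t2. exp_weight s1 x1 * exp_weight s2 t2 * A x1 t2)"
  proof -
    have i1: "integrable lborel (\<lambda>x. B * (exp_weight s1 x * 1))"
      using integrable_exp_weight[OF s(1)] by simp
    have mA: "(\<lambda>t. exp_weight s1 (fst t) * exp_weight s2 (snd t) * A (fst t) (snd t)) \<in> borel_measurable borel"
      using A_meas' by measurable
    have bA: "\<bar>exp_weight s1 (fst (x, y)) * exp_weight s2 (snd (x, y)) * A (fst (x, y)) (snd (x, y))\<bar> \<le>
       B * (exp_weight s1 x * 1) * (exp_weight s2 y * W a2 y)" for x y
      using bnd[of "A x y" 1 "W a2 y" x y] A_le[of x y] by simp
    show ?thesis
      using lborel_iterated_snd[OF i1 dom(2) mA bA] lborel_iterated_fst[OF i1 dom(2) mA bA] by simp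
  qed
  also have "\<dots> = (LBINT x1. exp_weight s1 x1 * (LBINT t2. exp_weight s2 t2 * A x1 t2))"
    by (simp add: mult.assoc)
  also have "\<dots> = (LBINT x1. exp_weight s1 x1 * (s2 powr - a2 * (LBINT x2. exp_weight s2 x2 * g (x1, x2))))"
    unfolding A_def by (subst laplace_rl_int[OF s(2) \<alpha>(2) _ B]) (auto intro: measurable_compose[OF _ g])
  also have "\<dots> = s2 powr - a2 * (LBINT x1. LBINT x2. exp_weight s1 x1 * exp_weight s2 x2 * g (x1, x2))"
    by (simp add: mult.assoc mult.left_commute[of "exp_weight s1 _" "s2 powr _"])
  also have "(LBINT x1. LBINT x2. exp_weight s1 x1 * exp_weight s2 x2 * g (x1, x2)) =
     (LBINT x. exp_weight s1 (fst x) * exp_weight s2 (snd x) * g x)"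
  proof -
    have i: "integrable lborel (\<lambda>x. B * (exp_weight s1 x * 1))" "integrable lborel (\<lambda>x. exp_weight s2 x * 1)"
      using integrable_exp_weight s by simp_all
    have mg: "(\<lambda>x. exp_weight s1 (fst x) * exp_weight s2 (snd x) * g x) \<in> borel_measurable borel"
      by measurable
    have bg: "\<bar>exp_weight s1 (fst (x, y)) * exp_weight s2 (snd (x, y)) * g (x, y)\<bar> \<le>
       B * (exp_weight s1 x * 1) * (exp_weight s2 y * 1)" for x y
      using bnd[of "g (x, y)" 1 1 x y] B[of "(x, y)"] by simp
    show ?thesis using lborel_iterated_fst[OF i mg bg] by simp
  qed
  finally show "(LBINT t. exp_weight s1 (fst t) * exp_weight s2 (snd t) * rl_int2 a1 a2 g t) =
      s1 powr - a1 * s2 powr - a2 * (LBINT x. exp_weight s1 (fst x) * exp_weight s2 (snd x) * g x)"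
    by (simp add: mult.assoc)
qed

section \<open>Uniqueness of bounded solutions\<close>

lemma continuous_on_slice:
  assumes "continuous_on (A \<times> UNIV) (\<lambda>(x, y). f x y)" "x \<in> A"
  shows "continuous_on UNIV (f x)"
proof -
  have "continuous_on UNIV (\<lambda>y. case (x, y) of (x, y) \<Rightarrow> f x y)"
  proof (rule continuous_on_compose2[OF assms(1)])
    show "continuous_on UNIV (\<lambda>y. (x, y))"
      by (rule continuous_on_Pair[OF continuous_on_const continuous_on_id])
  qed (use assms in auto)
  then show ?thesis by simp
qed

lemma exp_weight_Suc: "exp_weight (real (Suc i)) t = exp_weight 1 t * exp (- t) ^ i"
  by (auto simp: exp_weight_def exp_of_nat_mult[symmetric] exp_add[symmetric] algebra_simps)

text \<open>The substitution \<open>y = exp (- t)\<close> turns the hypothesis into orthogonality to all polynomials on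
  \<open>[0, 1]\<close>, so that Weierstrass approximation applies.\<close>

lemma laplace_eq_0_imp_eq_0:
  fixes g :: "real \<Rightarrow> real"
  assumes cont: "continuous_on UNIV g" and B: "\<And>t. \<bar>g t\<bar> \<le> B"
    and zero: "\<And>n. (LBINT t. exp_weight (real (Suc n)) t * g t) = 0"
    and t: "0 \<le> t"
  shows "g t = 0"
proof -
  have B0: "0 \<le> B" using B[of 0] by linarith
  have g [measurable]: "g \<in> borel_measurable borel"
    using cont by (rule borel_measurable_continuous_onI)
  have int: "integrable lborel (\<lambda>t. exp_weight s t * h t)"
    if "0 < s" "h \<in> borel_measurable borel" "\<And>t. 0 < t \<Longrightarrow> \<bar>h t\<bar> \<le> C" for s h C
  proof (rule Bochner_Integration.integrable_bound)
    show "integrable lborel (\<lambda>t. exp_weight s t * C)"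
      using integrable_exp_weight[OF that(1)] by simp
    show "AE t in lborel. norm (exp_weight s t * h t) \<le> norm (exp_weight s t * C)"
      using that(3) by (auto simp: exp_weight_def abs_mult intro!: AE_I2 mult_left_mono order_trans[OF _ abs_ge_self])
  qed (use that in measurable)
  \<comment> \<open>g (- ln y) is bounded but need not have a limit at y = 0; the extra factor y
    makes \<open>\<phi>\<close> continuous there.\<close>
  define \<phi> where "\<phi> y = (if y \<le> 0 then 0 else y * g (- ln y))" for y
  have cont_\<phi>: "continuous_on {0..1} \<phi>"
    unfolding continuous_on_eq_continuous_within
  proof
    fix y :: real assume "y \<in> {0..1}"
    show "continuous (at y within {0..1}) \<phi>"
    proof (cases "y = 0")
      case True
      have "((\<lambda>y. \<phi> y) \<longlongrightarrow> 0) (at y within {0..1})"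
      proof (rule Lim_null_comparison)
        have "norm (\<phi> y) \<le> \<bar>y\<bar> * B" for y
        proof (cases "y \<le> 0")
          case True
          then show ?thesis using mult_nonneg_nonneg[OF abs_ge_zero[of y] B0] by (simp add: \<phi>_def)
        next
          case False
          then show ?thesis using B by (simp add: \<phi>_def abs_mult)
        qed
        then show "\<forall>\<^sub>F y in at y within {0..1}. norm (\<phi> y) \<le> \<bar>y\<bar> * B"
          by simp
        show "((\<lambda>y. \<bar>y\<bar> * B) \<longlongrightarrow> 0) (at y within {0..1})"
          using True by (auto intro!: tendsto_eq_intros)
      qed
      moreover have "\<phi> y = 0" using True by (simp add: \<phi>_def)
      ultimately show ?thesis by (simp add: continuous_within)
    next
      case False
      with \<open>y \<in> {0..1}\<close> have "0 < y" by auto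
      have "continuous_on {0<..} (\<lambda>y. y * g (- ln y))"
        by (intro continuous_intros continuous_on_compose2[OF cont]) auto
      then have "continuous_on {0<..} \<phi>"
        by (rule continuous_on_eq) (auto simp: \<phi>_def)
      then have "isCont \<phi> y"
        using \<open>0 < y\<close> by (simp add: continuous_on_eq_continuous_at)
      then show ?thesis by (rule continuous_at_imp_continuous_within)
    qed
  qed
  define I where "I = (LBINT t. exp_weight 2 t * (g t)\<^sup>2)"
  define c where "c = (LBINT t. exp_weight 1 t)"
  have intI: "integrable lborel (\<lambda>t. exp_weight 2 t * (g t)\<^sup>2)"
  proof (rule int[of _ _ "B\<^sup>2"])
    show "\<bar>(g t)\<^sup>2\<bar> \<le> B\<^sup>2" for t
      using power_mono[OF B[of t], of 2] by simp
  qed simp_all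
  \<comment> \<open>All polynomial moments vanish, so a polynomial close to \<open>\<phi>\<close>
    may be subtracted from it without changing the integral; what remains is small.\<close>
  have I_le: "I \<le> e * B * c" if e: "0 < e" for e
  proof -
    obtain P where P: "real_polynomial_function P" "\<And>y. y \<in> {0..1} \<Longrightarrow> \<bar>\<phi> y - P y\<bar> < e"
      using Stone_Weierstrass_real_polynomial_function[OF _ cont_\<phi> e] by auto
    then obtain a n where Pa: "P = (\<lambda>y. \<Sum>i\<le>n. a i * y ^ i)"
      by (auto simp: real_polynomial_function_iff_sum)
    have intP: "integrable lborel (\<lambda>t. exp_weight (real (Suc i)) t * g t)" for i
      by (rule int[of _ _ B]) (use B in auto)
    have expand: "exp_weight 1 t * (P (exp (- t)) * g t) = (\<Sum>i\<le>n. a i * (exp_weight (real (Suc i)) t * g t))" for t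
      unfolding exp_weight_Suc Pa by (simp add: sum_distrib_left sum_distrib_right mult_ac)
    have P0: "(LBINT t. exp_weight 1 t * (P (exp (- t)) * g t)) = 0"
      unfolding expand using intP zero by simp
    have intP': "integrable lborel (\<lambda>t. exp_weight 1 t * (P (exp (- t)) * g t))"
      unfolding expand using intP by simp
    \<comment> \<open>Of the factor exp (- 2 t), one half is the weight and the other half is the
      factor y inside \<open>\<phi>\<close>.\<close>
    have sq: "exp_weight 2 t * (g t)\<^sup>2 = exp_weight 1 t * (\<phi> (exp (- t)) * g t)" for t
      by (auto simp: exp_weight_def \<phi>_def power2_eq_square exp_add[symmetric])
    have "I = (LBINT t. exp_weight 2 t * (g t)\<^sup>2 - exp_weight 1 t * (P (exp (- t)) * g t))"
      unfolding I_def using intI intP' P0 by simp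
    also have "\<dots> \<le> (LBINT t. exp_weight 1 t * (e * B))"
    proof (rule integral_mono)
      show "integrable lborel (\<lambda>t. exp_weight 2 t * (g t)\<^sup>2 - exp_weight 1 t * (P (exp (- t)) * g t))"
        using intI intP' by simp
      show "integrable lborel (\<lambda>t. exp_weight 1 t * (e * B))"
        using integrable_exp_weight[of 1] by simp
      fix t
      show "exp_weight 2 t * (g t)\<^sup>2 - exp_weight 1 t * (P (exp (- t)) * g t) \<le> exp_weight 1 t * (e * B)"
      proof (cases "0 < t")
        case True
        have "\<bar>(\<phi> (exp (- t)) - P (exp (- t))) * g t\<bar> \<le> e * B"
          unfolding abs_mult using P(2)[of "exp (- t)"] True B[of t] e by (intro mult_mono) auto
        then have "(\<phi> (exp (- t)) - P (exp (- t))) * g t \<le> e * B" by linarith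
        then have "exp_weight 1 t * ((\<phi> (exp (- t)) - P (exp (- t))) * g t) \<le> exp_weight 1 t * (e * B)"
          by (intro mult_left_mono exp_weight_nonneg)
        then show ?thesis unfolding sq by (simp add: algebra_simps)
      qed (simp add: exp_weight_def)
    qed
    finally show ?thesis by (simp add: c_def mult_ac)
  qed
  have "((\<lambda>e. e * B * c) \<longlongrightarrow> 0 * B * c) (at_right 0)"
    by (intro tendsto_intros)
  then have "I \<le> 0 * B * c"
    by (rule tendsto_lowerbound) (auto simp: eventually_at_filter I_le intro!: always_eventually)
  moreover have "0 \<le> I" unfolding I_def by (auto simp: exp_weight_nonneg)
  ultimately have I0: "I = 0" by simp
  then have ae: "AE t in lborel. exp_weight 2 t * (g t)\<^sup>2 = 0"
    unfolding I_def using intI by (subst (asm) integral_nonneg_eq_0_iff_AE) (auto simp: exp_weight_nonneg)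
  \<comment> \<open>Continuity turns almost everywhere zero into zero at \<open>t\<close>. The
    interval ends at t + 1 so that it is nondegenerate even for t = 0.\<close>
  define h where "h t = exp (- (2 * t)) * (g t)\<^sup>2" for t
  have ch: "continuous_on S h" for S
    unfolding h_def by (intro continuous_intros continuous_on_subset[OF cont]) auto
  have "(LINT s:{0..t + 1}|lborel. h s) = 0"
    unfolding set_lebesgue_integral_def
  proof (rule integral_eq_zero_AE)
    show "AE s in lborel. indicator {0..t + 1} s *\<^sub>R h s = 0"
      using ae AE_lborel_singleton[of 0] by eventually_elim (auto simp: exp_weight_def h_def indicator_def)
  qed
  moreover have "set_integrable lborel {0..t + 1} h"
    by (rule borel_integrable_atLeastAtMost') (rule ch)
  ultimately have "(h has_integral 0) {0..t + 1}"
    by (metis has_integral_iff set_borel_integral_eq_integral)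
  then have "h t = 0"
    using has_integral_0_cbox_imp_0[of 0 "t + 1" h t] ch t by (auto simp: h_def)
  then show ?thesis by (simp add: h_def)
qed

text \<open>For fixed s2 the transform in the second variable is a bounded continuous function of
  the first one, and the one-dimensional result makes it vanish; a second application, in the second
  variable, makes f vanish.\<close>

lemma laplace2_eq_0_imp_eq_0:
  fixes f :: "real \<times> real \<Rightarrow> real"
  assumes cont: "continuous_on UNIV f" and B: "\<And>t. \<bar>f t\<bar> \<le> B"
    and zero: "\<And>s1 s2. 0 < s1 \<Longrightarrow> 0 < s2 \<Longrightarrow>
      (LBINT t. exp_weight s1 (fst t) * exp_weight s2 (snd t) * f t) = 0"
    and t: "0 \<le> fst t" "0 \<le> snd t"
  shows "f t = 0"
proof -
  have B0: "0 \<le> B" using B[of 0] by linarith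
  have f [measurable]: "f \<in> borel_measurable borel"
    using cont by (rule borel_measurable_continuous_onI)
  have cont1: "continuous_on UNIV (\<lambda>x. f (x, y))" and cont2: "continuous_on UNIV (\<lambda>y. f (x, y))" for x y
    by (intro continuous_on_compose2[OF cont] continuous_intros; simp)+
  have [measurable]: "(\<lambda>x. f (x, y)) \<in> borel_measurable borel" "(\<lambda>y. f (x, y)) \<in> borel_measurable borel" for x y
    using cont1 cont2 by (auto intro: borel_measurable_continuous_onI)
  have L0: "(LBINT y. exp_weight s2 y * f (x, y)) = 0" if "0 < s2" "0 \<le> x" for s2 x
  proof (rule laplace_eq_0_imp_eq_0[where t = x])
    have int: "integrable lborel (\<lambda>y. exp_weight s2 y * B)"
      using integrable_exp_weight[OF that(1)] by simp
    have bnd: "\<bar>exp_weight s2 y * f (x, y)\<bar> \<le> exp_weight s2 y * B" for x y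
      using B[of "(x, y)"] exp_weight_nonneg[of s2 y] by (simp add: abs_mult mult_left_mono)
    show "continuous_on UNIV (\<lambda>x. LBINT y. exp_weight s2 y * f (x, y))"
      unfolding continuous_on_sequentially comp_def
    proof (intro allI ballI impI)
      fix X and a :: real assume X: "(\<forall>n. X n \<in> UNIV) \<and> X \<longlonglongrightarrow> a"
      show "(\<lambda>n. LBINT y. exp_weight s2 y * f (X n, y)) \<longlonglongrightarrow> (LBINT y. exp_weight s2 y * f (a, y))"
      proof (rule integral_dominated_convergence[OF _ _ int])
        have "isCont (\<lambda>x. f (x, y)) a" for y
          using cont1 by (simp add: continuous_on_eq_continuous_at)
        then have "(\<lambda>n. f (X n, y)) \<longlonglongrightarrow> f (a, y)" for y
          using X by (intro isCont_tendsto_compose[of a "\<lambda>x. f (x, y)"]) auto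
        then show "AE y in lborel. (\<lambda>n. exp_weight s2 y * f (X n, y)) \<longlonglongrightarrow> exp_weight s2 y * f (a, y)"
          by (intro AE_I2 tendsto_mult tendsto_const)
      qed (use bnd in auto)
    qed
    show "\<bar>LBINT y. exp_weight s2 y * f (x, y)\<bar> \<le> (LBINT y. exp_weight s2 y * B)" for x
      by (rule integral_abs_bound_integral[OF _ int bnd], rule Bochner_Integration.integrable_bound[OF int])
        (auto intro!: AE_I2 order_trans[OF bnd abs_ge_self])
    show "(LBINT x. exp_weight (real (Suc n)) x * (LBINT y. exp_weight s2 y * f (x, y))) = 0" for n
    proof -
      let ?s = "real (Suc n)"
      have "(LBINT t. exp_weight ?s (fst t) * exp_weight s2 (snd t) * f t) =
          (LBINT x. LBINT y. exp_weight ?s (fst (x, y)) * exp_weight s2 (snd (x, y)) * f (x, y))"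
      proof (rule lborel_iterated_fst)
        show "integrable lborel (exp_weight ?s)" by (rule integrable_exp_weight) simp
        show "\<bar>exp_weight ?s (fst (x, y)) * exp_weight s2 (snd (x, y)) * f (x, y)\<bar> \<le>
            exp_weight ?s x * (exp_weight s2 y * B)" for x y
          using mult_left_mono[OF bnd[of y x] exp_weight_nonneg[of ?s x]]
          by (simp add: abs_mult abs_of_nonneg exp_weight_nonneg mult_ac)
        show "(\<lambda>s. exp_weight (real (Suc n)) (fst s) * exp_weight s2 (snd s) * f s) \<in> borel_measurable borel"
          by measurable
      qed (rule int)
      also have "\<dots> = (LBINT x. exp_weight ?s x * (LBINT y. exp_weight s2 y * f (x, y)))"
        by (simp add: mult.assoc)
      finally show ?thesis using zero[of ?s s2] that by simp
    qed
  qed (rule that)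
  show ?thesis
    using laplace_eq_0_imp_eq_0[OF cont2, of "fst t" B "snd t"] B L0 t by simp
qed

text \<open>\<open>f\<close> stands for a difference of two solutions, so the inhomogeneous term is
  gone. With F the double transform of f and c = s1^-a1 s2^-a2, the function X = c l^\<beta> F
  satisfies X' = - (\<beta> / c) l^(-\<beta> - 1) X, so X is a multiple of exp (l^-\<beta> / c).
  Boundedness of f forces X -> 0 as l -> 0, which leaves only the multiple 0.\<close>

lemma rl_int2_evolution_unique:
  fixes f :: "real \<Rightarrow> real \<times> real \<Rightarrow> real"
  assumes pos: "0 < a1" "0 < a2" "0 < \<beta>"
    and cont: "continuous_on ({0<..} \<times> UNIV) (\<lambda>(l, s). f l s)"
    and B: "\<And>l s. 0 < l \<Longrightarrow> \<bar>f l s\<bar> \<le> B"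
    and deriv: "\<And>l t. 0 < l \<Longrightarrow> ((\<lambda>r. rl_int2 a1 a2 (\<lambda>s. r powr \<beta> * f r s) t)
      has_real_derivative - (\<beta> / l * f l t)) (at l)"
    and l: "0 < l" and t: "0 \<le> fst t" "0 \<le> snd t"
  shows "f l t = 0"
proof -
  have cont_f: "continuous_on UNIV (f l)" if "0 < l" for l
    using continuous_on_slice[OF cont] that by simp
  then have f [measurable]: "f l \<in> borel_measurable borel" if "0 < l" for l
    using that by (intro borel_measurable_continuous_onI) auto
  have B0: "0 \<le> B" using B[of 1 undefined] by linarith
  have "(LBINT t. exp_weight s1 (fst t) * exp_weight s2 (snd t) * f l t) = 0"
    if s: "0 < s1" "0 < s2" for s1 s2
  proof -
    define E where "E t = exp_weight s1 (fst t) * exp_weight s2 (snd t)" for t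
    have E: "integrable lborel E"
      unfolding E_def[abs_def] by (intro integrable_lborel_times integrable_exp_weight s)
    have [measurable]: "E \<in> borel_measurable borel" using E by simp
    have E0: "0 \<le> E t" for t by (simp add: E_def exp_weight_nonneg)
    define F where "F l = (LBINT t. E t * f l t)" for l
    define c where "c = s1 powr - a1 * s2 powr - a2"
    have c: "0 < c" using s by (simp add: c_def)
    have lap: "integrable lborel (\<lambda>t. E t * rl_int2 a1 a2 (\<lambda>s. r powr \<beta> * f r s) t)"
      "(LBINT t. E t * rl_int2 a1 a2 (\<lambda>s. r powr \<beta> * f r s) t) = c * (r powr \<beta> * F r)"
      if r: "0 < r" for r
    proof -
      have m: "(\<lambda>s. r powr \<beta> * f r s) \<in> borel_measurable borel" using f[OF r] by measurable
      have b: "\<bar>r powr \<beta> * f r s\<bar> \<le> r powr \<beta> * B" for s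
        using B[OF r, of s] by (simp add: abs_mult mult_left_mono)
      show "integrable lborel (\<lambda>t. E t * rl_int2 a1 a2 (\<lambda>s. r powr \<beta> * f r s) t)"
        using laplace_rl_int2(1)[OF s pos(1,2) m b] by (simp add: E_def)
      show "(LBINT t. E t * rl_int2 a1 a2 (\<lambda>s. r powr \<beta> * f r s) t) = c * (r powr \<beta> * F r)"
        using laplace_rl_int2(2)[OF s pos(1,2) m b]
        by (simp add: E_def F_def c_def mult.left_commute[of _ "r powr \<beta>"])
    qed
    have dF: "((\<lambda>r. c * (r powr \<beta> * F r)) has_real_derivative - (\<beta> / l * F l)) (at l)" if l: "0 < l" for l
    proof -
      have "((\<lambda>r. LBINT t. E t * rl_int2 a1 a2 (\<lambda>s. r powr \<beta> * f r s) t)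
         has_real_derivative (LBINT t. E t * (- (\<beta> / l * f l t)))) (at l)"
      proof (rule has_real_derivative_integral_dominated(1)
          [where d = "l / 2" and w = "\<lambda>t. E t * (2 * \<beta> / l * B)" and f' = "\<lambda>l t. E t * (- (\<beta> / l * f l t))"])
        fix y assume "\<bar>y - l\<bar> < l / 2"
        then have y: "0 < y" "l / 2 < y" by (auto simp: abs_real_def split: if_splits)
        show "(\<lambda>t. E t * rl_int2 a1 a2 (\<lambda>s. y powr \<beta> * f y s) t) \<in> borel_measurable lborel"
          using f[OF y(1)] by measurable
        fix t
        show "((\<lambda>y. E t * rl_int2 a1 a2 (\<lambda>s. y powr \<beta> * f y s) t) has_real_derivative
            E t * (- (\<beta> / y * f y t))) (at y)"
          by (rule DERIV_cmult[OF deriv[OF y(1)]])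
        have "\<bar>\<beta> / y * f y t\<bar> \<le> 2 * \<beta> / l * B"
          unfolding abs_mult
        proof (rule mult_mono)
          show "\<bar>\<beta> / y\<bar> \<le> 2 * \<beta> / l" using y l pos by (simp add: field_simps)
        qed (use y l pos B B0 in auto)
        then show "\<bar>E t * (- (\<beta> / y * f y t))\<bar> \<le> E t * (2 * \<beta> / l * B)"
          using E0[of t] by (simp only: abs_mult[of "E t"] abs_minus_cancel abs_of_nonneg mult_left_mono)
      qed (use l E lap in auto)
      also have "(\<lambda>t. E t * (- (\<beta> / l * f l t))) = (\<lambda>t. - (\<beta> / l) * (E t * f l t))"
        by (simp add: fun_eq_iff)
      also have "(LBINT t. - (\<beta> / l) * (E t * f l t)) = - (\<beta> / l * F l)"
        unfolding F_def integral_mult_right_zero by simp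
      finally show ?thesis
        by (rule has_field_derivative_transform_within_open[where S = "{0<..}"])
          (use lap l in auto)
    qed
    \<comment> \<open>The quotient of X by the exponential solution, hence constant.\<close>
    define H where "H r = c * (r powr \<beta> * F r) * exp (- (1 / c) * r powr - \<beta>)" for r
    have "(H has_real_derivative 0) (at r)" if r: "0 < r" for r
    proof -
      define X where "X = exp (- (1 / c) * r powr - \<beta>)"
      define k where "k = (1 / c) * (\<beta> * r powr (- \<beta> - 1))"
      have e: "((\<lambda>r. exp (- (1 / c) * r powr - \<beta>)) has_real_derivative X * k) (at r)"
        unfolding X_def k_def using r c by (auto intro!: derivative_eq_intros)
      have "r powr \<beta> * r powr (- \<beta> - 1) = r powr (\<beta> + (- \<beta> - 1))"
        by (rule powr_add[symmetric])
      also have "\<dots> = 1 / r" using r by (simp add: powr_neg_one)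
      finally have "r powr \<beta> * r powr (- \<beta> - 1) = 1 / r" .
      moreover have "c * (r powr \<beta> * F r) * ((1 / c) * (\<beta> * r powr (- \<beta> - 1))) =
          (c * (1 / c)) * (\<beta> * (r powr \<beta> * r powr (- \<beta> - 1)) * F r)"
        by (simp only: mult_ac)
      ultimately have z: "c * (r powr \<beta> * F r) * k = \<beta> / r * F r"
        using c by (simp add: k_def)
      have "X * k * (c * (r powr \<beta> * F r)) = X * (c * (r powr \<beta> * F r) * k)"
        by (simp only: mult_ac)
      then have "- (\<beta> / r * F r) * X + X * k * (c * (r powr \<beta> * F r)) = 0"
        unfolding z by simp
      then show ?thesis
        unfolding H_def using DERIV_mult[OF dF[OF r] e] by (simp only: X_def)
    qed
    then have "\<exists>k. \<forall>r\<in>{0<..}. H r = k"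
      by (intro has_field_derivative_zero_constant) (auto intro: has_field_derivative_at_within)
    then obtain k where k: "\<And>r. 0 < r \<Longrightarrow> H r = k" by auto
    have F_le: "\<bar>F r\<bar> \<le> (LBINT t. E t * B)" if "0 < r" for r
      unfolding F_def
    proof (rule integral_abs_bound_integral)
      show i: "integrable lborel (\<lambda>t. E t * B)" using E by simp
      show b: "\<bar>E t * f r t\<bar> \<le> E t * B" for t
        using B[OF that, of t] E0[of t] by (simp add: abs_mult mult_left_mono)
      show "integrable lborel (\<lambda>t. E t * f r t)"
        by (rule Bochner_Integration.integrable_bound[OF i])
          (use f[OF that] in \<open>auto intro!: AE_I2 order_trans[OF b abs_ge_self]\<close>)
    qed
    \<comment> \<open>The exponential factor is at most 1 and F is bounded uniformly in r, so H is
      O(r^\<beta>).\<close>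
    have "(H \<longlongrightarrow> 0) (at_right 0)"
    proof (rule Lim_null_comparison)
      show "\<forall>\<^sub>F r in at_right 0. norm (H r) \<le> c * (r powr \<beta> * (LBINT t. E t * B))"
      proof (rule eventually_at_rightI[of 0 1])
        fix r :: real assume r: "r \<in> {0<..<1}"
        have "\<bar>H r\<bar> = c * (r powr \<beta> * \<bar>F r\<bar>) * exp (- (1 / c) * r powr - \<beta>)"
          using c by (simp add: H_def abs_mult)
        also have "\<dots> \<le> c * (r powr \<beta> * \<bar>F r\<bar>) * 1"
          using c by (intro mult_left_mono) auto
        also have "\<dots> \<le> c * (r powr \<beta> * (LBINT t. E t * B)) * 1"
          using c F_le[of r] r by (intro mult_right_mono mult_left_mono) auto
        finally show "norm (H r) \<le> c * (r powr \<beta> * (LBINT t. E t * B))" by simp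
      qed simp
      have "((\<lambda>r. c * (r powr \<beta> * (LBINT t. E t * B))) \<longlongrightarrow> c * (0 powr \<beta> * (LBINT t. E t * B))) (at_right 0)"
        using pos tendsto_zero_powrI[of "\<lambda>r. r" "at_right 0" "\<lambda>_. \<beta>" \<beta>]
        by (intro tendsto_intros) (auto simp: eventually_at_filter)
      then show "((\<lambda>r. c * (r powr \<beta> * (LBINT t. E t * B))) \<longlongrightarrow> 0) (at_right 0)" using pos by simp
    qed
    moreover have "(H \<longlongrightarrow> k) (at_right 0)"
      by (rule tendsto_eventually, rule eventually_at_rightI[of 0 1]) (use k in auto)
    ultimately have "k = 0"
      by (intro tendsto_unique[of "at_right (0::real)" H]) simp_all
    then have "F l = 0" using k[OF l] l c by (simp add: H_def)
    then show ?thesis by (simp add: F_def E_def)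
  qed
  then show ?thesis
    by (rule laplace2_eq_0_imp_eq_0[OF cont_f[OF l] B[OF l] _ t])
qed

section \<open>The generating function\<close>

lemma rl_int2_sums:
  assumes pos: "0 < a1" "0 < a2"
    and F [measurable]: "\<And>n. F n \<in> borel_measurable borel"
    and d: "\<And>n s. \<bar>F n s\<bar> \<le> d n" "summable d"
  shows "(\<lambda>n. rl_int2 a1 a2 (F n) t) sums rl_int2 a1 a2 (\<lambda>s. \<Sum>n. F n s) t"
proof -
  let ?w = "rl_weight2 a1 a2 t"
  have w0: "0 \<le> ?w s" for s by (rule rl_weight2_nonneg[OF pos])
  have le: "\<bar>?w s * F n s\<bar> \<le> ?w s * d n" for n s
    using d(1)[of n s] w0[of s] by (simp add: abs_mult mult_left_mono)
  have intd: "integrable lborel (\<lambda>s. ?w s * d n)" for n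
    using integrable_rl_weight2[OF pos] by simp
  have int: "integrable lborel (\<lambda>s. ?w s * F n s)" for n
    by (rule Bochner_Integration.integrable_bound[OF intd[of n]])
      (auto intro!: AE_I2 order_trans[OF le abs_ge_self])
  have sF: "summable (\<lambda>n. \<bar>F n s\<bar>)" for s
    by (rule summable_comparison_test[OF _ d(2)]) (use d(1) in auto)
  have s1: "summable (\<lambda>n. norm (?w s * F n s))" for s
    using summable_mult[OF sF[of s], of "?w s"] w0 by (simp add: abs_mult)
  have s2: "summable (\<lambda>n. LBINT s. norm (?w s * F n s))"
  proof (rule summable_comparison_test)
    show "summable (\<lambda>n. (LBINT s. ?w s) * d n)" by (rule summable_mult[OF d(2)])
    have "(LBINT s. norm (?w s * F n s)) \<le> (LBINT s. ?w s * d n)" for n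
      using int intd le by (intro integral_mono) auto
    then show "\<exists>N. \<forall>n\<ge>N. norm (LBINT s. norm (?w s * F n s)) \<le> (LBINT s. ?w s) * d n"
      by simp
  qed
  have "(\<lambda>n. LBINT s. ?w s * F n s) sums (LBINT s. (\<Sum>n. ?w s * F n s))"
    by (rule sums_integral[OF int _ s2]) (use s1 in auto)
  also have "(LBINT s. (\<Sum>n. ?w s * F n s)) = rl_int2 a1 a2 (\<lambda>s. \<Sum>n. F n s) t"
    unfolding rl_int2_def using sF by (subst suminf_mult) (auto intro: summable_rabs_cancel)
  finally show ?thesis by (simp add: rl_int2_def)
qed

lemma rl_int2_diff:
  assumes pos: "0 < a1" "0 < a2"
    and F: "F \<in> borel_measurable borel" "\<And>s. \<bar>F s\<bar> \<le> B" and G: "G \<in> borel_measurable borel" "\<And>s. \<bar>G s\<bar> \<le> C"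
  shows "rl_int2 a1 a2 (\<lambda>s. F s - G s) t = rl_int2 a1 a2 F t - rl_int2 a1 a2 G t"
  unfolding rl_int2_def
  using integrable_rl_weight2_times[OF pos F] integrable_rl_weight2_times[OF pos G]
  by (simp add: right_diff_distrib)

text \<open>The integrated equation, detached from probability spaces. The number 1 or 0 in
  \<open>evolution\<close> is the value of \<open>p n\<close> on the axes. By \<open>clamp\<close>
  the values outside the closed quadrant are those at its nearest point, which allows continuity on
  the whole plane, the setting of the uniqueness lemma.\<close>

locale poisson_field_system =
  fixes a1 a2 \<beta> :: real and p :: "nat \<Rightarrow> real \<Rightarrow> real \<times> real \<Rightarrow> real"
  assumes pos: "0 < a1" "0 < a2" "0 < \<beta>"
    and cont: "continuous_on ({0<..} \<times> UNIV) (\<lambda>(l, s). p n l s)"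
    and nonneg: "0 < l \<Longrightarrow> 0 \<le> p n l s"
    and total: "0 < l \<Longrightarrow> (\<lambda>n. p n l s) sums 1"
    and clamp: "p n l s = p n l (max 0 (fst s), max 0 (snd s))"
    and evolution: "0 < l \<Longrightarrow> ((\<lambda>r. rl_int2 a1 a2
        (\<lambda>s. r powr \<beta> * (\<Sum>k\<le>n. (\<beta> gchoose k) * (-1) ^ k * p (n - k) r s)) t)
      has_real_derivative \<beta> / l * ((if n = 0 then 1 else 0) - p n l t)) (at l)"
begin

lemma p_le_1: "0 < l \<Longrightarrow> p n l s \<le> 1"
  using sum_le_suminf[of "\<lambda>n. p n l s" "{n}"] total[of l s] nonneg[of l]
  by (auto simp: sums_iff)

lemma cont_p: "0 < l \<Longrightarrow> continuous_on UNIV (p n l)"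
  using continuous_on_slice[OF cont] by simp

lemma measurable_p: "0 < l \<Longrightarrow> p n l \<in> borel_measurable borel"
  by (intro borel_measurable_continuous_onI cont_p)

lemma summable_gen:
  assumes "\<bar>v\<bar> < 1" "0 < l"
  shows "summable (\<lambda>n. p n l s * v ^ n)" "summable (\<lambda>n. \<bar>p n l s * v ^ n\<bar>)"
proof -
  show s: "summable (\<lambda>n. \<bar>p n l s * v ^ n\<bar>)"
  proof (rule summable_comparison_test)
    show "summable (\<lambda>n. p n l s)" using total[OF assms(2)] by (rule sums_summable)
    show "\<exists>N. \<forall>n\<ge>N. norm \<bar>p n l s * v ^ n\<bar> \<le> p n l s"
      using nonneg[OF assms(2), of _ s] assms(1)
      by (auto simp: abs_mult power_abs intro!: exI mult_left_le power_le_one)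
  qed
  then show "summable (\<lambda>n. p n l s * v ^ n)" by (rule summable_rabs_cancel)
qed

text \<open>The binomial convolution is a Cauchy product, so the generating function g satisfies the
  equation of \<open>p 0\<close> with an extra factor (1 - v)^\<beta>. Replacing l by l / (1 - v)
  removes that factor, and the difference to \<open>p 0 l\<close> is a bounded solution of the
  homogeneous equation.\<close>

lemma gen_sums_scaled:
  assumes v: "\<bar>v\<bar> < 1" and l: "0 < l"
  shows "(\<lambda>n. p n l s * v ^ n) sums p 0 ((1 - v) * l) s"
proof -
  define g where "g l s = (\<Sum>n. p n l s * v ^ n)" for l s
  have v1: "0 < 1 - v" using v by auto
  have g_le: "\<bar>g l s\<bar> \<le> 1" if "0 < l" for l s
  proof -
    have "\<bar>g l s\<bar> \<le> (\<Sum>n. \<bar>p n l s * v ^ n\<bar>)"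
      unfolding g_def by (rule summable_rabs[OF summable_gen(2)[OF v that]])
    also have "\<dots> \<le> (\<Sum>n. p n l s)"
      using summable_gen(2)[OF v that, of s] total[OF that, of s] nonneg[OF that, of _ s] v
      by (intro suminf_le) (auto simp: sums_iff abs_mult power_abs intro!: mult_left_le power_le_one)
    finally show ?thesis using total[OF that] by (simp add: sums_iff)
  qed
  have cont_g: "continuous_on ({0<..} \<times> UNIV) (\<lambda>(l, s). g l s)"
  proof -
    have "uniform_limit ({0<..} \<times> UNIV) (\<lambda>N x. \<Sum>n<N. p n (fst x) (snd x) * v ^ n)
        (\<lambda>x. \<Sum>n. p n (fst x) (snd x) * v ^ n) sequentially"
    proof (rule Weierstrass_m_test)
      show "summable (\<lambda>n. \<bar>v\<bar> ^ n)" using v by (intro summable_geometric) auto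
      show "norm (p n (fst x) (snd x) * v ^ n) \<le> \<bar>v\<bar> ^ n" if "x \<in> {0<..} \<times> UNIV" for n x
        using that nonneg[of "fst x" n "snd x"] p_le_1[of "fst x" n "snd x"]
        by (auto simp: abs_mult power_abs intro!: mult_left_le_one_le)
    qed
    then have "continuous_on ({0<..} \<times> UNIV) (\<lambda>x. \<Sum>n. p n (fst x) (snd x) * v ^ n)"
      by (rule uniform_limit_theorem[rotated])
        (use cont in \<open>auto simp: case_prod_unfold intro!: always_eventually continuous_intros\<close>)
    then show ?thesis by (simp add: g_def case_prod_unfold)
  qed
  have meas_g: "g l \<in> borel_measurable borel" if "0 < l" for l
    using continuous_on_slice[OF cont_g] that by (intro borel_measurable_continuous_onI) simp
  define Q where "Q n r s = (\<Sum>k\<le>n. (\<beta> gchoose k) * (-1) ^ k * p (n - k) r s)" for n r s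
  \<comment> \<open>A majorant uniform in r and s: the Cauchy product of the absolute binomial
    series with the geometric series, which dominates p m r s v^m.\<close>
  define d where "d n = (\<Sum>k\<le>n. \<bar>(\<beta> gchoose k) * (- v) ^ k\<bar> * \<bar>v\<bar> ^ (n - k))" for n
  have binom: "(\<lambda>k. (\<beta> gchoose k) * (- v) ^ k) sums (1 - v) powr \<beta>"
    using gen_binomial_real[of "- v" \<beta>] v by simp
  have binom_abs: "summable (\<lambda>k. \<bar>(\<beta> gchoose k) * (- v) ^ k\<bar>)"
  proof -
    \<comment> \<open>Convergence at a slightly larger radius gives absolute convergence at -
      v.\<close>
    obtain w where w: "\<bar>v\<bar> < w" "w < 1" using dense v by blast
    have "summable (\<lambda>k. (\<beta> gchoose k) * w ^ k)"
      using gen_binomial_real[of w \<beta>] w by (auto simp: sums_iff)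
    then show ?thesis using powser_insidea[of "\<lambda>k. \<beta> gchoose k" w "- v"] w by simp
  qed
  have d: "summable d"
    unfolding d_def using binom_abs v
    by (intro summable_Cauchy_product) (simp_all add: power_abs summable_geometric)
  have vQ: "v ^ n * Q n r s = (\<Sum>k\<le>n. (\<beta> gchoose k) * (- v) ^ k * (p (n - k) r s * v ^ (n - k)))" for n r s
  proof -
    have "v ^ n * ((\<beta> gchoose k) * (-1) ^ k * p (n - k) r s) =
        (\<beta> gchoose k) * (- v) ^ k * (p (n - k) r s * v ^ (n - k))" if "k \<le> n" for k
    proof -
      have "v ^ n = v ^ k * v ^ (n - k)" using that by (simp add: power_add[symmetric])
      moreover have "(- v) ^ k = (-1) ^ k * v ^ k" by (rule power_minus)
      ultimately show ?thesis by (simp add: mult_ac)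
    qed
    then show ?thesis unfolding Q_def sum_distrib_left by (intro sum.cong) auto
  qed
  have vQ_le: "\<bar>v ^ n * Q n r s\<bar> \<le> d n" if r: "0 < r" for n r s
    unfolding vQ d_def
  proof (rule order_trans[OF sum_abs sum_mono])
    fix k
    have "\<bar>p (n - k) r s * v ^ (n - k)\<bar> \<le> \<bar>v\<bar> ^ (n - k)"
      using nonneg[OF r, of "n - k" s] p_le_1[OF r, of "n - k" s]
      by (auto simp: abs_mult power_abs intro!: mult_left_le_one_le)
    then show "\<bar>(\<beta> gchoose k) * (- v) ^ k * (p (n - k) r s * v ^ (n - k))\<bar> \<le>
        \<bar>(\<beta> gchoose k) * (- v) ^ k\<bar> * \<bar>v\<bar> ^ (n - k)"
      unfolding abs_mult[of "(\<beta> gchoose k) * (- v) ^ k"] by (intro mult_left_mono) auto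
  qed
  have vQ_sums: "(\<Sum>n. v ^ n * Q n r s) = (1 - v) powr \<beta> * g r s" if r: "0 < r" for r s
    unfolding vQ
    using Cauchy_product_sums[of "\<lambda>k. (\<beta> gchoose k) * (- v) ^ k" "\<lambda>m. p m r s * v ^ m"]
      binom_abs binom summable_gen(2)[OF v r, of s]
    by (simp add: g_def sums_iff)
  have meas_Q: "(\<lambda>s. r powr \<beta> * (v ^ n * Q n r s)) \<in> borel_measurable borel" if "0 < r" for n r
    unfolding Q_def using measurable_p[OF that] by measurable
  have J_sums: "(\<lambda>n. v ^ n * rl_int2 a1 a2 (\<lambda>s. r powr \<beta> * Q n r s) t) sums
      rl_int2 a1 a2 (\<lambda>s. r powr \<beta> * ((1 - v) powr \<beta> * g r s)) t" if r: "0 < r" for r t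
  proof -
    have "(\<lambda>n. rl_int2 a1 a2 (\<lambda>s. r powr \<beta> * (v ^ n * Q n r s)) t) sums
        rl_int2 a1 a2 (\<lambda>s. \<Sum>n. r powr \<beta> * (v ^ n * Q n r s)) t"
    proof (rule rl_int2_sums[OF pos(1,2) meas_Q[OF r]])
      show "\<bar>r powr \<beta> * (v ^ n * Q n r s)\<bar> \<le> r powr \<beta> * d n" for n s
        using vQ_le[OF r] by (simp add: abs_mult mult_left_mono)
      show "summable (\<lambda>n. r powr \<beta> * d n)" by (rule summable_mult[OF d])
    qed
    moreover have "(\<Sum>n. r powr \<beta> * (v ^ n * Q n r s)) = r powr \<beta> * ((1 - v) powr \<beta> * g r s)" for s
    proof -
      have "summable (\<lambda>n. v ^ n * Q n r s)"
        by (rule summable_comparison_test[OF _ d]) (use vQ_le[OF r] in auto)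
      then show ?thesis using vQ_sums[OF r] by (simp add: suminf_mult)
    qed
    moreover have "rl_int2 a1 a2 (\<lambda>s. r powr \<beta> * (v ^ n * Q n r s)) t =
        v ^ n * rl_int2 a1 a2 (\<lambda>s. r powr \<beta> * Q n r s) t" for n
      unfolding rl_int2_def by (subst integral_mult_right_zero[symmetric]) (simp add: mult_ac)
    ultimately show ?thesis by simp
  qed
  have ev_g: "((\<lambda>r. rl_int2 a1 a2 (\<lambda>s. r powr \<beta> * ((1 - v) powr \<beta> * g r s)) t)
      has_real_derivative \<beta> / l * (1 - g l t)) (at l)" if l: "0 < l" for l t
  proof -
    define c :: "nat \<Rightarrow> real" where "c n = (if n = 0 then 1 else 0)" for n
    \<comment> \<open>A neighbourhood of l away from 0, on which \<beta> / r is at most 2 \<beta> /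
      l; this gives the uniform convergence behind termwise differentiation.\<close>
    define S where "S = {l / 2<..<2 * l}"
    have S: "0 < r" "l / 2 < r" if "r \<in> S" for r using that l by (auto simp: S_def)
    have "((\<lambda>r. \<Sum>n. v ^ n * rl_int2 a1 a2 (\<lambda>s. r powr \<beta> * Q n r s) t) has_real_derivative
        (\<Sum>n. v ^ n * (\<beta> / l * (c n - p n l t)))) (at l)"
    proof (rule has_field_derivative_series'(2)[where S = S and x0 = l])
      show "((\<lambda>r. v ^ n * rl_int2 a1 a2 (\<lambda>s. r powr \<beta> * Q n r s) t) has_real_derivative
          v ^ n * (\<beta> / r * (c n - p n r t))) (at r within S)" if "r \<in> S" for n r
        using DERIV_cmult[OF evolution[OF S(1)[OF that], of n t], of "v ^ n"]
        by (auto simp: Q_def c_def intro: has_field_derivative_at_within)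
      show "uniformly_convergent_on S (\<lambda>n r. \<Sum>i<n. v ^ i * (\<beta> / r * (c i - p i r t)))"
      proof (rule Weierstrass_m_test')
        show "summable (\<lambda>n. \<bar>v\<bar> ^ n * (2 * \<beta> / l))"
          using v by (intro summable_mult2 summable_geometric) auto
        fix n r assume r: "r \<in> S"
        have "\<bar>c n - p n r t\<bar> \<le> 1"
          using nonneg[OF S(1)[OF r], of n t] p_le_1[OF S(1)[OF r], of n t] by (auto simp: c_def)
        moreover have "\<bar>\<beta> / r\<bar> \<le> 2 * \<beta> / l" using S[OF r] l pos by (simp add: field_simps)
        ultimately have "\<bar>\<beta> / r * (c n - p n r t)\<bar> \<le> 2 * \<beta> / l * 1"
          unfolding abs_mult by (intro mult_mono) (use l pos in auto)
        then show "norm (v ^ n * (\<beta> / r * (c n - p n r t))) \<le> \<bar>v\<bar> ^ n * (2 * \<beta> / l)"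
          unfolding real_norm_def abs_mult[of "v ^ n"] power_abs[symmetric] by (intro mult_left_mono) auto
      qed
      show "summable (\<lambda>n. v ^ n * rl_int2 a1 a2 (\<lambda>s. l powr \<beta> * Q n l s) t)"
        using J_sums[OF l] by (rule sums_summable)
    qed (use l in \<open>auto simp: S_def\<close>)
    moreover have "(\<Sum>n. v ^ n * (\<beta> / l * (c n - p n l t))) = \<beta> / l * (1 - g l t)"
    proof -
      have "(\<lambda>n. v ^ n * c n) sums (\<Sum>n\<in>{0}. v ^ n * c n)"
        by (rule sums_finite) (auto simp: c_def)
      then have "(\<lambda>n. v ^ n * c n) sums 1" by (simp add: c_def)
      then have "(\<lambda>n. \<beta> / l * (v ^ n * c n - p n l t * v ^ n)) sums (\<beta> / l * (1 - g l t))"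
        unfolding g_def using summable_sums[OF summable_gen(1)[OF v l]] by (intro sums_mult sums_diff)
      moreover have "(\<lambda>n. \<beta> / l * (v ^ n * c n - p n l t * v ^ n)) = (\<lambda>n. v ^ n * (\<beta> / l * (c n - p n l t)))"
        by (simp add: fun_eq_iff algebra_simps)
      ultimately show ?thesis by (simp add: sums_iff)
    qed
    ultimately have "((\<lambda>r. \<Sum>n. v ^ n * rl_int2 a1 a2 (\<lambda>s. r powr \<beta> * Q n r s) t) has_real_derivative
        \<beta> / l * (1 - g l t)) (at l)" by simp
    then show ?thesis
      by (rule has_field_derivative_transform_within_open[where S = "{0<..}"])
        (use J_sums l in \<open>auto simp: sums_iff\<close>)
  qed
  \<comment> \<open>The chain rule contributes 1 / (1 - v), which is cancelled by \<beta> / l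
    evaluated at l / (1 - v); so both functions obey an equation with the same coefficients.\<close>
  define f where "f l s = g (l / (1 - v)) s - p 0 l s" for l s
  have f0: "f l t = 0" if "0 < l" "0 \<le> fst t" "0 \<le> snd t" for l t
  proof (rule rl_int2_evolution_unique[OF pos, where B = 2 and f = f])
    show "continuous_on ({0<..} \<times> UNIV) (\<lambda>(l, s). f l s)"
    proof -
      have "continuous_on ({0<..} \<times> UNIV) (\<lambda>x. (\<lambda>(l, s). g l s) (fst x / (1 - v), snd x))"
        by (rule continuous_on_compose2[OF cont_g]) (use v1 in \<open>auto intro!: continuous_intros\<close>)
      then show ?thesis
        using cont[of 0] unfolding f_def by (auto simp: case_prod_unfold intro!: continuous_intros)
    qed
    show "\<bar>f l s\<bar> \<le> 2" if "0 < l" for l s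
      using g_le[of "l / (1 - v)" s] nonneg[OF that, of 0 s] p_le_1[OF that, of 0 s] that v1
      by (auto simp: f_def)
    fix l t assume l: "(0::real) < l"
    have lv: "0 < l / (1 - v)" using l v1 by simp
    have "((\<lambda>r. rl_int2 a1 a2 (\<lambda>s. (r / (1 - v)) powr \<beta> * ((1 - v) powr \<beta> * g (r / (1 - v)) s)) t)
        has_real_derivative \<beta> / (l / (1 - v)) * (1 - g (l / (1 - v)) t) * (1 / (1 - v))) (at l)"
      by (rule DERIV_chain2[where g = "\<lambda>r. r / (1 - v)", OF ev_g[OF lv, of t]])
        (use v1 in \<open>auto intro!: derivative_eq_intros\<close>)
    then have "((\<lambda>r. rl_int2 a1 a2 (\<lambda>s. (r / (1 - v)) powr \<beta> * ((1 - v) powr \<beta> * g (r / (1 - v)) s)) t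
          - rl_int2 a1 a2 (\<lambda>s. r powr \<beta> * (\<Sum>k\<le>0. (\<beta> gchoose k) * (-1) ^ k * p (0 - k) r s)) t)
        has_real_derivative \<beta> / (l / (1 - v)) * (1 - g (l / (1 - v)) t) * (1 / (1 - v))
          - \<beta> / l * ((if (0::nat) = 0 then 1 else 0) - p 0 l t)) (at l)"
      by (rule DERIV_diff[OF _ evolution[OF l, of 0]])
    also have "\<beta> / (l / (1 - v)) * (1 - g (l / (1 - v)) t) * (1 / (1 - v))
          - \<beta> / l * ((if (0::nat) = 0 then 1 else 0) - p 0 l t) = - (\<beta> / l * f l t)"
      using l v1 by (simp add: f_def field_simps)
    finally show "((\<lambda>r. rl_int2 a1 a2 (\<lambda>s. r powr \<beta> * f r s) t) has_real_derivative - (\<beta> / l * f l t)) (at l)"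
    proof (rule has_field_derivative_transform_within_open[where S = "{0<..}"])
      fix r :: real assume "r \<in> {0<..}"
      then have r: "0 < r" "0 < r / (1 - v)" using v1 by auto
      have e1: "(r / (1 - v)) powr \<beta> * ((1 - v) powr \<beta> * x) = r powr \<beta> * x" for x
        using r v1 by (simp add: powr_divide)
      have e2: "rl_int2 a1 a2 (\<lambda>s. r powr \<beta> * g (r / (1 - v)) s - r powr \<beta> * p 0 r s) t =
          rl_int2 a1 a2 (\<lambda>s. r powr \<beta> * g (r / (1 - v)) s) t - rl_int2 a1 a2 (\<lambda>s. r powr \<beta> * p 0 r s) t"
      proof (rule rl_int2_diff[OF pos(1,2), where B = "r powr \<beta>" and C = "r powr \<beta>"])
        show "(\<lambda>s. r powr \<beta> * g (r / (1 - v)) s) \<in> borel_measurable borel"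
          using meas_g[OF r(2)] by measurable
        show "(\<lambda>s. r powr \<beta> * p 0 r s) \<in> borel_measurable borel"
          using measurable_p[OF r(1)] by measurable
        show "\<bar>r powr \<beta> * g (r / (1 - v)) s\<bar> \<le> r powr \<beta>" for s
          using g_le[OF r(2), of s] by (simp add: abs_mult mult_left_le)
        show "\<bar>r powr \<beta> * p 0 r s\<bar> \<le> r powr \<beta>" for s
          using nonneg[OF r(1), of 0 s] p_le_1[OF r(1), of 0 s] by (simp add: abs_mult mult_left_le)
      qed
      show "rl_int2 a1 a2 (\<lambda>s. (r / (1 - v)) powr \<beta> * ((1 - v) powr \<beta> * g (r / (1 - v)) s)) t
          - rl_int2 a1 a2 (\<lambda>s. r powr \<beta> * (\<Sum>k\<le>0. (\<beta> gchoose k) * (-1) ^ k * p (0 - k) r s)) t =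
          rl_int2 a1 a2 (\<lambda>s. r powr \<beta> * f r s) t"
        unfolding e1 f_def right_diff_distrib e2 by simp
    qed (use l in auto)
  qed (use that in auto)
  \<comment> \<open>Uniqueness gives the identity on the closed quadrant; \<open>clamp\<close>
    carries it to all s.\<close>
  let ?s = "(max 0 (fst s), max 0 (snd s))"
  have "f ((1 - v) * l) ?s = 0" by (rule f0) (use v1 l in auto)
  then have "g l ?s = p 0 ((1 - v) * l) ?s" using v1 by (simp add: f_def)
  moreover have "g l ?s = g l s" unfolding g_def using clamp[of _ l s] by simp
  moreover have "p 0 ((1 - v) * l) ?s = p 0 ((1 - v) * l) s" using clamp[of 0 "(1 - v) * l" s] by simp
  ultimately show ?thesis
    using summable_sums[OF summable_gen(1)[OF v l, of s]] by (simp add: g_def)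
qed

end

section \<open>Power series expansion in the intensity\<close>

text \<open>Removing the first j terms and dividing by h^j leaves a power series with constant term
  a j. A coefficient is thus expressed through values of the sum, which serves both uniqueness and
  measurability in a parameter.\<close>

lemma powser_coeff_tendsto:
  fixes a :: "nat \<Rightarrow> real"
  assumes r: "0 < r" and sums: "\<And>h. \<bar>h\<bar> < r \<Longrightarrow> (\<lambda>n. a n * h ^ n) sums F h"
  shows "((\<lambda>h. (F h - (\<Sum>i<j. a i * h ^ i)) / h ^ j) \<longlongrightarrow> a j) (at 0)"
proof -
  have "(\<lambda>n. a (n + j) * h ^ n) sums ((F h - (\<Sum>i<j. a i * h ^ i)) / h ^ j)"
    if "h \<noteq> 0" "norm h < r" for h
  proof -
    have "(\<lambda>n. a (n + j) * h ^ (n + j)) sums (F h - (\<Sum>i<j. a i * h ^ i))"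
      using sums_split_initial_segment[OF sums[of h], of j] that by simp
    from sums_divide[OF this, of "h ^ j"] show ?thesis
      using that by (simp add: power_add)
  qed
  from powser_limit_0_strong[OF r this] show ?thesis by simp
qed

lemma powser_unique:
  fixes a b :: "nat \<Rightarrow> real"
  assumes "0 < r" "\<And>h. \<bar>h\<bar> < r \<Longrightarrow> (\<lambda>n. a n * h ^ n) sums F h"
    "\<And>h. \<bar>h\<bar> < r \<Longrightarrow> (\<lambda>n. b n * h ^ n) sums F h"
  shows "a j = b j"
proof (induction j rule: less_induct)
  case (less j)
  then have "(\<Sum>i<j. a i * h ^ i) = (\<Sum>i<j. b i * h ^ i)" for h by simp
  with powser_coeff_tendsto[OF assms(1,2), of j] powser_coeff_tendsto[OF assms(1,3), of j]
  show ?case by (intro tendsto_unique[of "at (0::real)"]) simp_all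
qed

text \<open>The coefficients are later chosen separately at every point, so nothing is known about
  how they vary; measurability follows because each one is a pointwise limit of expressions in F and
  earlier coefficients.\<close>

lemma measurable_powser_coeff:
  fixes C :: "nat \<Rightarrow> 'a \<Rightarrow> real"
  assumes r: "0 < r" and meas: "\<And>h. \<bar>h\<bar> < r \<Longrightarrow> F h \<in> borel_measurable M"
    and sums: "\<And>h x. \<bar>h\<bar> < r \<Longrightarrow> (\<lambda>n. C n x * h ^ n) sums F h x"
  shows "C j \<in> borel_measurable M"
proof (induction j rule: less_induct)
  case (less j)
  define h where "h m = r / real (m + 2)" for m
  have h: "h m \<noteq> 0" "\<bar>h m\<bar> < r" for m
    using r by (auto simp: h_def divide_less_eq add_strict_increasing)
  have "h \<longlonglongrightarrow> 0"
    unfolding h_def by (intro LIMSEQ_ignore_initial_segment[OF lim_const_over_n])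
  with h have lim: "(\<lambda>m. (F (h m) x - (\<Sum>i<j. C i x * h m ^ i)) / h m ^ j) \<longlonglongrightarrow> C j x" for x
    using powser_coeff_tendsto[OF r sums, of x j]
    unfolding tendsto_at_iff_sequentially comp_def by auto
  show ?case
    by (rule borel_measurable_LIMSEQ_real[OF lim])
      (use less.IH meas[OF h(2)] in \<open>auto intro!: borel_measurable_divide borel_measurable_diff borel_measurable_sum\<close>)
qed

text \<open>The radius \<open>r\<close> depends only on \<open>\<beta>\<close>: it is chosen so that \<open>w powr (-1/\<beta>)\<close> stays in the unit disc
  around \<open>1\<close>, where \<open>\<Sum>n. a n * (1 - w) ^ n\<close> is holomorphic and bounded by \<open>1\<close>. The coefficient bound
  is Cauchy's inequality.\<close>

lemma powr_expansion_bounded_coeffs: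
  fixes \<beta> :: real
  assumes "0 < \<beta>"
  obtains r :: real where "0 < r" "r < 1"
    and "\<And>h. \<bar>h\<bar> < r \<Longrightarrow> \<bar>1 - (1 + h) powr (- 1 / \<beta>)\<bar> < 1"
    and "\<And>a. (\<And>n. 0 \<le> a n) \<Longrightarrow> a sums 1 \<Longrightarrow> \<exists>c. (\<forall>j. \<bar>c j\<bar> \<le> 2 / r ^ j) \<and>
      (\<forall>h. \<bar>h\<bar> < r \<longrightarrow> (\<lambda>j. c j * h ^ j) sums
        ((\<Sum>n. a n * (1 - (1 + h) powr (- 1 / \<beta>)) ^ n) / (1 + h)))"
proof -
  define \<phi> :: "complex \<Rightarrow> complex" where "\<phi> z = z powr of_real (- 1 / \<beta>)" for z
  have hol_\<phi>: "\<phi> holomorphic_on ball 1 1"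
  proof -
    have "z \<notin> \<real>\<^sub>\<le>\<^sub>0" if "z \<in> ball 1 1" for z :: complex
    proof -
      have "\<bar>Re (1 - z)\<bar> < 1" using that abs_Re_le_cmod[of "1 - z"] by (simp add: dist_norm)
      then show ?thesis by (auto simp: complex_nonpos_Reals_iff)
    qed
    then show ?thesis unfolding \<phi>_def by (intro holomorphic_intros) auto
  qed
  then have "isCont \<phi> 1"
    by (metis centre_in_ball continuous_on_eq_continuous_at holomorphic_on_imp_continuous_on open_ball zero_less_one)
  then obtain \<delta> where \<delta>: "0 < \<delta>" "\<And>z. dist z 1 < \<delta> \<Longrightarrow> dist (\<phi> z) (\<phi> 1) < 1"
    unfolding continuous_at_eps_delta by (metis zero_less_one)
  \<comment> \<open>The bound \<delta> / 2 puts the closed disc of radius r inside the open disc of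
    radius 2 r where f is holomorphic. The bound 1 / 2 gives |z| \<ge> 1 / 2 on the circle of radius
    r around 1, so division by z costs a factor 2, the constant in the coefficient bound.\<close>
  define r where "r = min (\<delta> / 2) (1 / 2)"
  have r: "0 < r" "2 * r \<le> \<delta>" "2 * r \<le> 1" using \<delta> by (auto simp: r_def)
  have \<phi>_near: "norm (1 - \<phi> z) < 1" if "z \<in> ball 1 (2 * r)" for z
    using \<delta>(2)[of z] that r by (simp add: dist_commute \<phi>_def dist_norm norm_minus_commute)
  have \<phi>_real: "\<phi> (of_real (1 + h)) = of_real ((1 + h) powr (- 1 / \<beta>))" if "\<bar>h\<bar> < r" for h
    unfolding \<phi>_def using that r by (subst powr_of_real) auto
  have in_ball: "of_real (1 + h) \<in> ball (1 :: complex) r" if "\<bar>h\<bar> < r" for h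
    using that by (simp add: dist_norm flip: of_real_diff)
  show ?thesis
  proof (rule that)
    show "0 < r" "r < 1" using r by auto
    show "\<bar>1 - (1 + h) powr (- 1 / \<beta>)\<bar> < 1" if h: "\<bar>h\<bar> < r" for h
    proof -
      have "norm (1 - \<phi> (of_real (1 + h))) < 1"
        by (rule \<phi>_near) (use in_ball[OF h] r in auto)
      also have "1 - \<phi> (of_real (1 + h)) = of_real (1 - (1 + h) powr (- 1 / \<beta>))"
        unfolding \<phi>_real[OF h] by simp
      finally show ?thesis by (simp only: norm_of_real)
    qed
    fix a :: "nat \<Rightarrow> real"
    assume a: "\<And>n. 0 \<le> a n" "a sums 1"
    define G :: "complex \<Rightarrow> complex" where "G w = (\<Sum>n. of_real (a n) * w ^ n)" for w
    have abs_sum: "summable (\<lambda>n. norm (of_real (a n) * w ^ n))" if "norm w < 1" for w :: complex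
    proof (rule summable_comparison_test)
      show "\<exists>N. \<forall>n\<ge>N. norm (norm (of_real (a n) * w ^ n)) \<le> a n"
        using that a(1) by (auto simp: norm_mult norm_power intro!: mult_left_le power_le_one)
      show "summable a" using a(2) by (rule sums_summable)
    qed
    have G_sums: "(\<lambda>n. of_real (a n) * w ^ n) sums G w" if "norm w < 1" for w
      unfolding G_def by (rule summable_sums[OF summable_norm_cancel[OF abs_sum[OF that]]])
    have G_le: "norm (G w) \<le> 1" if "norm w < 1" for w
    proof -
      have "norm (G w) \<le> (\<Sum>n. norm (of_real (a n) * w ^ n))"
        unfolding G_def by (rule summable_norm[OF abs_sum[OF that]])
      also have "\<dots> \<le> (\<Sum>n. a n)"
        using abs_sum[OF that] a that
        by (intro suminf_le) (auto simp: sums_iff norm_mult norm_power intro!: mult_left_le power_le_one)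
      finally show ?thesis using a by (simp add: sums_iff)
    qed
    have hol_G: "G holomorphic_on ball 0 1"
      by (rule power_series_holomorphic[of _ _ "\<lambda>n. of_real (a n)"]) (use G_sums in auto)
    define f where "f z = G (1 - \<phi> z) / z" for z
    have hol_f: "f holomorphic_on ball 1 (2 * r)"
      unfolding f_def
    proof (intro holomorphic_on_divide holomorphic_on_compose_gen[OF _ hol_G, unfolded comp_def] holomorphic_on_ident)
      show "(\<lambda>z. 1 - \<phi> z) holomorphic_on ball 1 (2 * r)"
        by (intro holomorphic_intros holomorphic_on_subset[OF hol_\<phi>]) (use r in auto)
      show "z \<noteq> 0" if "z \<in> ball 1 (2 * r)" for z :: complex
        using that r by (auto simp: dist_norm)
    qed (use \<phi>_near in auto)
    have hol_f': "f holomorphic_on ball 1 r"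
      by (rule holomorphic_on_subset[OF hol_f]) (use r in auto)
    have f_le: "norm (f z) \<le> 2" if "norm (1 - z) = r" for z
    proof -
      have "z \<in> ball 1 (2 * r)" using that r by (simp add: dist_norm)
      then have "norm (G (1 - \<phi> z)) \<le> 1" by (intro G_le \<phi>_near)
      moreover have "1 / 2 \<le> norm z"
        using that norm_triangle_ineq[of "1 - z" z] r by simp
      ultimately show ?thesis by (simp add: f_def norm_divide divide_le_eq)
    qed
    define D where "D j = (deriv ^^ j) f 1 / fact j" for j
    have D_le: "norm (D j) \<le> 2 / r ^ j" for j
    proof -
      have "norm ((deriv ^^ j) f 1) \<le> fact j * 2 / r ^ j"
      proof (rule Cauchy_inequality[OF hol_f' _ r(1) f_le])
        show "continuous_on (cball 1 r) f"
          by (rule continuous_on_subset[OF holomorphic_on_imp_continuous_on[OF hol_f]]) (use r in auto)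
      qed
      then show ?thesis by (simp add: D_def norm_divide divide_le_eq mult_ac)
    qed
    have D_sums: "(\<lambda>j. Re (D j) * h ^ j) sums ((\<Sum>n. a n * (1 - (1 + h) powr (- 1 / \<beta>)) ^ n) / (1 + h))"
      if h: "\<bar>h\<bar> < r" for h
    proof -
      let ?v = "1 - (1 + h) powr (- 1 / \<beta>)"
      have "(\<lambda>j. D j * (of_real (1 + h) - 1) ^ j) sums f (of_real (1 + h))"
        using holomorphic_power_series[OF hol_f' in_ball[OF h]] by (simp add: D_def)
      then have 1: "(\<lambda>j. Re (D j * of_real (h ^ j))) sums Re (f (of_real (1 + h)))"
        by (intro sums_Re) simp
      have v: "1 - \<phi> (of_real (1 + h)) = of_real ?v" unfolding \<phi>_real[OF h] by simp
      have "norm (1 - \<phi> (of_real (1 + h))) < 1"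
        by (rule \<phi>_near) (use in_ball[OF h] r in auto)
      then have "(\<lambda>n. of_real (a n) * of_real ?v ^ n) sums G (of_real ?v)"
        unfolding v by (rule G_sums)
      then have "(\<lambda>n. complex_of_real (a n * ?v ^ n)) sums G (of_real ?v)" by simp
      then have "(\<lambda>n. a n * ?v ^ n) sums Re (G (of_real ?v))" and "Im (G (of_real ?v)) = 0"
        using sums_Re[of "\<lambda>n. complex_of_real (a n * ?v ^ n)"] sums_Im[of "\<lambda>n. complex_of_real (a n * ?v ^ n)"]
        by (auto simp: sums_iff)
      then have "G (of_real ?v) = of_real (\<Sum>n. a n * ?v ^ n)"
        by (simp add: complex_eq_iff sums_iff)
      then have "f (of_real (1 + h)) = of_real ((\<Sum>n. a n * ?v ^ n) / (1 + h))"
        unfolding f_def v by simp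
      then have "Re (f (of_real (1 + h))) = (\<Sum>n. a n * ?v ^ n) / (1 + h)"
        by (metis Re_complex_of_real)
      with 1 show ?thesis by simp
    qed
    show "\<exists>c. (\<forall>j. \<bar>c j\<bar> \<le> 2 / r ^ j) \<and> (\<forall>h. \<bar>h\<bar> < r \<longrightarrow> (\<lambda>j. c j * h ^ j) sums
        ((\<Sum>n. a n * (1 - (1 + h) powr (- 1 / \<beta>)) ^ n) / (1 + h)))"
      by (rule exI[of _ "\<lambda>j. Re (D j)"])
        (use D_sums order_trans[OF abs_Re_le_cmod D_le] in auto)
  qed
qed

section \<open>Iterating the integrated equation\<close>

definition rl_monomial :: "real \<Rightarrow> real \<Rightarrow> nat \<Rightarrow> real \<times> real \<Rightarrow> real" where
  "rl_monomial a1 a2 k t = fst t powr (a1 * real k) / Gamma (1 + a1 * real k) *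
     (snd t powr (a2 * real k) / Gamma (1 + a2 * real k))"

text \<open>So on the open quadrant \<open>rl_monomial a1 a2 k\<close> is the k-fold double integral
  of the constant 1. The integrand is a product, and each factor obeys the power rule in one
  variable.\<close>

lemma rl_int2_monomial:
  assumes pos: "0 < a1" "0 < a2" and t: "0 \<le> fst t" "0 \<le> snd t"
  shows "integrable lborel (\<lambda>s. rl_weight2 a1 a2 t s * rl_monomial a1 a2 k s)"
    and "rl_int2 a1 a2 (rl_monomial a1 a2 k) t = rl_monomial a1 a2 (Suc k) t"
proof -
  define q where "q \<alpha> t x = rl_weight \<alpha> t x * (x powr (\<alpha> * real k) / Gamma (1 + \<alpha> * real k))" for \<alpha> t x
  have q: "has_bochner_integral lborel (q \<alpha> t) (t powr (\<alpha> * real (Suc k)) / Gamma (1 + \<alpha> * real (Suc k)))"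
    if "0 < \<alpha>" "0 \<le> t" for \<alpha> t
    using has_bochner_integral_rl_weight_powr[of \<alpha> "\<alpha> * real k" t] that
    unfolding q_def by (simp add: algebra_simps)
  have q0: "0 \<le> q \<alpha> t x" if "0 < \<alpha>" for \<alpha> t x
  proof -
    have "0 < Gamma (1 + \<alpha> * real k)" using that by (intro Gamma_real_pos add_pos_nonneg) auto
    then show ?thesis using rl_weight_nonneg[OF that] by (simp add: q_def)
  qed
  have q1: "has_bochner_integral lborel (q a1 (fst t)) (fst t powr (a1 * real (Suc k)) / Gamma (1 + a1 * real (Suc k)))"
    and q2: "has_bochner_integral lborel (q a2 (snd t)) (snd t powr (a2 * real (Suc k)) / Gamma (1 + a2 * real (Suc k)))"
    using q pos t by auto
  have eq: "rl_weight2 a1 a2 t s * rl_monomial a1 a2 k s = q a1 (fst t) (fst s) * q a2 (snd t) (snd s)" for s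
    by (simp add: rl_weight2_def rl_monomial_def q_def)
  show "integrable lborel (\<lambda>s. rl_weight2 a1 a2 t s * rl_monomial a1 a2 k s)"
    unfolding eq using integrable.intros[OF q1] integrable.intros[OF q2] by (rule integrable_lborel_times)
  then have m: "(\<lambda>s. q a1 (fst t) (fst s) * q a2 (snd t) (snd s)) \<in> borel_measurable borel"
    unfolding eq by auto
  have "rl_int2 a1 a2 (rl_monomial a1 a2 k) t = (LBINT s. q a1 (fst t) (fst s) * q a2 (snd t) (snd s))"
    unfolding rl_int2_def eq ..
  also have "\<dots> = (LBINT x. LBINT y. q a1 (fst t) x * q a2 (snd t) y)"
    using lborel_iterated_fst[OF integrable.intros[OF q1] integrable.intros[OF q2] m]
    by (simp add: abs_mult abs_of_nonneg q0 pos)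
  also have "\<dots> = rl_monomial a1 a2 (Suc k) t"
    using has_bochner_integral_integral_eq[OF q1] has_bochner_integral_integral_eq[OF q2]
    by (simp add: rl_monomial_def)
  finally show "rl_int2 a1 a2 (rl_monomial a1 a2 k) t = rl_monomial a1 a2 (Suc k) t" .
qed

text \<open>At mu = (1 + h) l^-\<beta> the intensity is L h = (1 + h)^(-1/\<beta>) l, and C j is the
  j-th Taylor coefficient in h of p 0 (L h) / (1 + h), which is u_0 divided by l^\<beta>. Comparing
  coefficients in the integrated equation gives the recursion: (-1)^j comes from 1 / (1 + h) and
  \<open>Suc j\<close> from differentiating in h. As h measures mu relative to its base point, r
  does not depend on l.\<close>

lemma (in poisson_field_system) taylor_recursion:
  obtains r where "0 < r" "r < 1"
    and "\<And>l. 0 < l \<Longrightarrow> \<exists>C. (\<forall>j. C j \<in> borel_measurable borel) \<and> (\<forall>j s. \<bar>C j s\<bar> \<le> 2 / r ^ j) \<and>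
      C 0 = p 0 l \<and>
      (\<forall>j t. C j t = (-1) ^ j + real (Suc j) * l powr \<beta> * rl_int2 a1 a2 (C (Suc j)) t)"
proof -
  obtain r where r: "0 < r" "r < 1"
    and v: "\<And>h. \<bar>h\<bar> < r \<Longrightarrow> \<bar>1 - (1 + h) powr (- 1 / \<beta>)\<bar> < 1"
    and exp: "\<And>a. (\<And>n. 0 \<le> a n) \<Longrightarrow> a sums 1 \<Longrightarrow> \<exists>c. (\<forall>j. \<bar>c j\<bar> \<le> 2 / r ^ j) \<and>
      (\<forall>h. \<bar>h\<bar> < r \<longrightarrow> (\<lambda>j. c j * h ^ j) sums
        ((\<Sum>n. a n * (1 - (1 + h) powr (- 1 / \<beta>)) ^ n) / (1 + h)))"
    using powr_expansion_bounded_coeffs[OF pos(3)] by blast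
  show ?thesis
  proof (rule that[OF r])
    fix l :: real assume l: "0 < l"
    define L where "L h = (1 + h) powr (- 1 / \<beta>) * l" for h
    have L: "0 < L h" if "\<bar>h\<bar> < r" for h using that l r by (simp add: L_def)
    have "\<forall>s. \<exists>c. (\<forall>j. \<bar>c j\<bar> \<le> 2 / r ^ j) \<and>
      (\<forall>h. \<bar>h\<bar> < r \<longrightarrow> (\<lambda>j. c j * h ^ j) sums
        ((\<Sum>n. p n l s * (1 - (1 + h) powr (- 1 / \<beta>)) ^ n) / (1 + h)))"
      using exp[OF nonneg[OF l] total[OF l]] by blast
    then obtain c where c_le: "\<And>s j. \<bar>c s j\<bar> \<le> 2 / r ^ j"
      and c_sums: "\<And>s h. \<bar>h\<bar> < r \<Longrightarrow> (\<lambda>j. c s j * h ^ j) sums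
        ((\<Sum>n. p n l s * (1 - (1 + h) powr (- 1 / \<beta>)) ^ n) / (1 + h))"
      by metis
    define C where "C j s = c s j" for j s
    have C_le: "\<bar>C j s\<bar> \<le> 2 / r ^ j" for j s using c_le by (simp add: C_def)
    have C_sums: "(\<lambda>j. C j s * h ^ j) sums (p 0 (L h) s / (1 + h))" if "\<bar>h\<bar> < r" for s h
      using c_sums[OF that, of s] gen_sums_scaled[OF v[OF that] l, of s]
      by (simp add: C_def L_def sums_iff)
    have C_meas: "C j \<in> borel_measurable borel" for j
    proof (rule measurable_powser_coeff[OF r(1) _ C_sums])
      show "(\<lambda>s. p 0 (L h) s / (1 + h)) \<in> borel_measurable borel" if "\<bar>h\<bar> < r" for h
        using measurable_p[OF L[OF that]] by measurable
    qed
    have C0: "C 0 = p 0 l"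
      using C_sums[of 0] r by (auto simp: L_def powser_sums_zero_iff fun_eq_iff)
    have rec: "C j t = (-1) ^ j + real (Suc j) * l powr \<beta> * rl_int2 a1 a2 (C (Suc j)) t" for j t
    proof -
      define J where "J j = l powr \<beta> * rl_int2 a1 a2 (C j) t" for j
      \<comment> \<open>The double integral of u_0 as a function of h. It is expanded in powers of h
        under the integral sign and differentiated through \<open>evolution\<close>; equating the
        two gives the recursion.\<close>
      define m where "m h = rl_int2 a1 a2 (\<lambda>s. L h powr \<beta> * p 0 (L h) s) t" for h
      have m_sums: "(\<lambda>j. J j * h ^ j) sums m h" if h: "\<bar>h\<bar> < r" for h
      proof -
        have "(\<lambda>j. rl_int2 a1 a2 (\<lambda>s. l powr \<beta> * (C j s * h ^ j)) t) sums
            rl_int2 a1 a2 (\<lambda>s. \<Sum>j. l powr \<beta> * (C j s * h ^ j)) t"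
        proof (rule rl_int2_sums[OF pos(1,2)])
          show "(\<lambda>s. l powr \<beta> * (C j s * h ^ j)) \<in> borel_measurable borel" for j
            using C_meas[of j] by measurable
          show "\<bar>l powr \<beta> * (C j s * h ^ j)\<bar> \<le> l powr \<beta> * (2 * (\<bar>h\<bar> / r) ^ j)" for j s
          proof -
            have "\<bar>C j s\<bar> * \<bar>h\<bar> ^ j \<le> 2 * (\<bar>h\<bar> / r) ^ j"
              using mult_right_mono[OF C_le[of j s], of "\<bar>h\<bar> ^ j"] by (simp add: power_divide)
            from mult_left_mono[OF this, of "l powr \<beta>"] show ?thesis by (simp add: abs_mult power_abs)
          qed
          show "summable (\<lambda>j. l powr \<beta> * (2 * (\<bar>h\<bar> / r) ^ j))"
            using h r by (intro summable_mult summable_geometric) auto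
        qed
        moreover have "rl_int2 a1 a2 (\<lambda>s. l powr \<beta> * (C j s * h ^ j)) t = J j * h ^ j" for j
        proof -
          have "(\<lambda>s. rl_weight2 a1 a2 t s * (l powr \<beta> * (C j s * h ^ j))) =
            (\<lambda>s. (l powr \<beta> * h ^ j) * (rl_weight2 a1 a2 t s * C j s))" by (simp add: fun_eq_iff)
          then show ?thesis
            unfolding rl_int2_def J_def by (simp only: integral_mult_right_zero) simp
        qed
        moreover have "(\<Sum>j. l powr \<beta> * (C j s * h ^ j)) = L h powr \<beta> * p 0 (L h) s" for s
        proof -
          have "L h powr \<beta> = ((1 + h) powr (- 1 / \<beta>)) powr \<beta> * l powr \<beta>"
            unfolding L_def by (rule powr_mult)
          also have "((1 + h) powr (- 1 / \<beta>)) powr \<beta> = 1 / (1 + h)"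
            using h r pos by (simp add: powr_powr powr_neg_one)
          finally show ?thesis
            using sums_mult[OF C_sums[OF h, of s], of "l powr \<beta>"] by (simp add: sums_iff)
        qed
        ultimately show ?thesis by (simp add: m_def)
      qed
      have m_deriv: "(m has_real_derivative p 0 (L h) t / (1 + h) - 1 / (1 + h)) (at h)" if h: "\<bar>h\<bar> < r" for h
      proof -
        have h1: "0 < 1 + h" using h r by auto
        have "(L has_real_derivative - L h / (\<beta> * (1 + h))) (at h)"
        proof -
          have "(L has_real_derivative (- 1 / \<beta>) * (1 + h) powr (- 1 / \<beta> - 1) * l) (at h)"
            unfolding L_def using h1 by (auto intro!: derivative_eq_intros)
          also have "(- 1 / \<beta>) * (1 + h) powr (- 1 / \<beta> - 1) * l = - L h / (\<beta> * (1 + h))"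
            using h1 by (simp add: L_def powr_diff)
          finally show ?thesis .
        qed
        note DERIV_chain2[OF evolution[OF L[OF h], of 0 t] this]
        also have "(\<lambda>h. rl_int2 a1 a2 (\<lambda>s. L h powr \<beta> *
            (\<Sum>k\<le>0. (\<beta> gchoose k) * (-1) ^ k * p (0 - k) (L h) s)) t) = m"
          by (simp add: m_def fun_eq_iff)
        also have "\<beta> / L h * ((if (0::nat) = 0 then 1 else 0) - p 0 (L h) t) * (- L h / (\<beta> * (1 + h))) = p 0 (L h) t / (1 + h) - 1 / (1 + h)"
        proof -
          have "\<beta> / a * x * (- a / (\<beta> * b)) = - x / b" if "a \<noteq> 0" "b \<noteq> 0" for a b x :: real
            using that pos by (simp add: field_simps)
          from this[of "L h" "1 + h" "1 - p 0 (L h) t"] show ?thesis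
            using L[OF h] h1 by (simp add: diff_divide_distrib[symmetric])
        qed
        finally show ?thesis .
      qed
      have "diffs J j = C j t - (-1) ^ j"
      proof (rule powser_unique[OF r(1)])
        fix h :: real assume h: "\<bar>h\<bar> < r"
        then obtain K where K: "\<bar>h\<bar> < K" "K < r" using dense by blast
        then have sK: "summable (\<lambda>n. J n * K ^ n)" using m_sums[of K] by (auto dest: sums_summable)
        have "((\<lambda>h. \<Sum>n. J n * h ^ n) has_real_derivative (\<Sum>n. diffs J n * h ^ n)) (at h)"
          by (rule termdiffs_strong[OF sK]) (use K in auto)
        then have "(m has_real_derivative (\<Sum>n. diffs J n * h ^ n)) (at h)"
          by (rule has_field_derivative_transform_within_open[where S = "{- r<..<r}"])
            (use m_sums h in \<open>auto simp: sums_iff abs_less_iff\<close>)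
        then have "(\<Sum>n. diffs J n * h ^ n) = p 0 (L h) t / (1 + h) - 1 / (1 + h)"
          using m_deriv[OF h] by (rule DERIV_unique)
        moreover have "summable (\<lambda>n. diffs J n * h ^ n)"
          by (rule termdiff_converges[of h r J]) (use h m_sums in \<open>auto dest: sums_summable\<close>)
        ultimately show "(\<lambda>n. diffs J n * h ^ n) sums (p 0 (L h) t / (1 + h) - 1 / (1 + h))"
          by (simp add: sums_iff)
        have "(\<lambda>n. (- h) ^ n) sums (1 / (1 - (- h)))"
          using h r by (intro geometric_sums) auto
        then have "(\<lambda>n. C n t * h ^ n - (- h) ^ n) sums (p 0 (L h) t / (1 + h) - 1 / (1 + h))"
          using C_sums[OF h, of t] by (intro sums_diff) auto
        then show "(\<lambda>n. (C n t - (-1) ^ n) * h ^ n) sums (p 0 (L h) t / (1 + h) - 1 / (1 + h))"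
          by (simp add: left_diff_distrib power_minus[of h])
      qed
      then show ?thesis by (simp add: diffs_def J_def algebra_simps)
    qed
    show "\<exists>C. (\<forall>j. C j \<in> borel_measurable borel) \<and> (\<forall>j s. \<bar>C j s\<bar> \<le> 2 / r ^ j) \<and>
      C 0 = p 0 l \<and> (\<forall>j t. C j t = (-1) ^ j + real (Suc j) * l powr \<beta> * rl_int2 a1 a2 (C (Suc j)) t)"
      using C_meas C_le C0 rec by (intro exI[of _ C]) blast
  qed
qed

text \<open>Unfolding the recursion K times: the factors \<open>Suc j\<close> multiply up to a
  factorial, each step adds one double integral, and the coefficient left at the end is estimated by
  2 / r^K.\<close>

lemma (in poisson_field_system) taylor_remainder:
  obtains r where "0 < r" "r < 1"
    and "\<And>l t K. 0 < l \<Longrightarrow> 0 < fst t \<Longrightarrow> 0 < snd t \<Longrightarrow>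
      \<bar>p 0 l t - (\<Sum>k<K. (-1) ^ k * (l powr \<beta>) ^ k * fact k * rl_monomial a1 a2 k t)\<bar> \<le>
        2 * (l powr \<beta>) ^ K * fact K / r ^ K * rl_monomial a1 a2 K t"
proof -
  obtain r where r: "0 < r" "r < 1"
    and ex: "\<And>l. 0 < l \<Longrightarrow> \<exists>C. (\<forall>j. C j \<in> borel_measurable borel) \<and> (\<forall>j s. \<bar>C j s\<bar> \<le> 2 / r ^ j) \<and>
      C 0 = p 0 l \<and> (\<forall>j t. C j t = (-1) ^ j + real (Suc j) * l powr \<beta> * rl_int2 a1 a2 (C (Suc j)) t)"
    using taylor_recursion by blast
  show ?thesis
  proof (rule that[OF r])
    fix l :: real and t :: "real \<times> real" and K
    assume l: "0 < l" and t: "0 < fst t" "0 < snd t"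
    from ex[OF l] obtain C :: "nat \<Rightarrow> real \<times> real \<Rightarrow> real" where C_meas: "\<And>j. C j \<in> borel_measurable borel"
      and C_le: "\<And>j s. \<bar>C j s\<bar> \<le> 2 / r ^ j" and C0: "C 0 = p 0 l"
      and rec: "\<And>j t. C j t = (-1) ^ j + real (Suc j) * l powr \<beta> * rl_int2 a1 a2 (C (Suc j)) t" by blast
    define x where "x = l powr \<beta>"
    have x: "0 < x" using l by (simp add: x_def)
    let ?m = "rl_monomial a1 a2" and ?w = "rl_weight2 a1 a2"
    have m0: "?m 0 t = 1" if "0 < fst t" "0 < snd t" for t using that by (simp add: rl_monomial_def)
    \<comment> \<open>Each unfolding raises the index of C by one, so the induction on K has to
      treat all j at once.\<close>
    have "\<bar>C j t - (\<Sum>k<K. (-1) ^ (j + k) * x ^ k * (fact (j + k) / fact j) * ?m k t)\<bar> \<le>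
        2 * x ^ K * (fact (j + K) / fact j) / r ^ (j + K) * ?m K t"
      if "0 < fst t" "0 < snd t" for j t
      using that
    proof (induction K arbitrary: j t)
      case 0
      then show ?case using C_le[of j t] by (simp add: m0)
    next
      case (Suc K)
      define c where "c k = (-1) ^ (Suc j + k) * x ^ k * (fact (Suc j + k) / fact (Suc j))" for k
      define b where "b = 2 * x ^ K * (fact (Suc j + K) / fact (Suc j)) / r ^ (Suc j + K)"
      define D where "D s = C (Suc j) s - (\<Sum>k<K. c k * ?m k s)" for s
      have t0: "0 \<le> fst t" "0 \<le> snd t" using Suc.prems by auto
      have intC: "integrable lborel (\<lambda>s. ?w t s * C (Suc j) s)"
        by (rule integrable_rl_weight2_times[OF pos(1,2) C_meas C_le])
      note intm = rl_int2_monomial(1)[OF pos(1,2) t0]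
      have wD: "?w t s * D s = ?w t s * C (Suc j) s - (\<Sum>k<K. c k * (?w t s * ?m k s))" for s
        by (simp add: D_def right_diff_distrib sum_distrib_left mult_ac)
      have intD: "integrable lborel (\<lambda>s. ?w t s * D s)"
        unfolding wD using intC intm by auto
      have JD: "rl_int2 a1 a2 D t = rl_int2 a1 a2 (C (Suc j)) t - (\<Sum>k<K. c k * ?m (Suc k) t)"
        unfolding rl_int2_monomial(2)[OF pos(1,2) t0, symmetric] rl_int2_def wD
        using intC intm by simp
      have "\<bar>rl_int2 a1 a2 D t\<bar> \<le> (LBINT s. b * (?w t s * ?m K s))"
        unfolding rl_int2_def
      proof (rule integral_abs_bound_integral[OF intD])
        show "integrable lborel (\<lambda>s. b * (?w t s * ?m K s))" using intm by simp
        fix s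
        show "\<bar>?w t s * D s\<bar> \<le> b * (?w t s * ?m K s)"
        proof (cases "0 < fst s \<and> 0 < snd s")
          case True
          then have "\<bar>D s\<bar> \<le> b * ?m K s"
            using Suc.IH[of s "Suc j"] by (simp add: D_def c_def b_def)
          from mult_left_mono[OF this rl_weight2_nonneg[OF pos(1,2), of t s]] show ?thesis
            using rl_weight2_nonneg[OF pos(1,2), of t s] by (simp add: abs_mult mult_ac)
        next
          case False
          then have "?w t s = 0" by (auto simp: rl_weight2_def rl_weight_def)
          then show ?thesis by simp
        qed
      qed
      also have "\<dots> = b * ?m (Suc K) t"
        using rl_int2_monomial(2)[OF pos(1,2) t0, of K] by (simp add: rl_int2_def)
      finally have JD_le: "\<bar>rl_int2 a1 a2 D t\<bar> \<le> b * ?m (Suc K) t" .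
      have f: "fact (j + Suc k) / fact j = real (Suc j) * (fact (Suc j + k) / fact (Suc j) :: real)" for k
        by simp
      have coef: "(-1) ^ (j + Suc k) * x ^ Suc k * (fact (j + Suc k) / fact j) * ?m (Suc k) t =
          real (Suc j) * x * (c k * ?m (Suc k) t)" for k
        unfolding f c_def by simp
      have "(\<Sum>k<Suc K. (-1) ^ (j + k) * x ^ k * (fact (j + k) / fact j) * ?m k t) =
          (-1) ^ j + (\<Sum>k<K. real (Suc j) * x * (c k * ?m (Suc k) t))"
        unfolding sum.lessThan_Suc_shift coef using m0[OF Suc.prems] by simp
      then have "C j t - (\<Sum>k<Suc K. (-1) ^ (j + k) * x ^ k * (fact (j + k) / fact j) * ?m k t) =
          real (Suc j) * x * rl_int2 a1 a2 D t"
        unfolding JD by (subst rec) (simp add: x_def sum_distrib_left right_diff_distrib)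
      then have "\<bar>C j t - (\<Sum>k<Suc K. (-1) ^ (j + k) * x ^ k * (fact (j + k) / fact j) * ?m k t)\<bar> =
          real (Suc j) * x * \<bar>rl_int2 a1 a2 D t\<bar>"
        using x by (simp add: abs_mult)
      also have "\<dots> \<le> real (Suc j) * x * (b * ?m (Suc K) t)"
        using x by (intro mult_left_mono[OF JD_le]) auto
      also have "\<dots> = 2 * x ^ Suc K * (fact (j + Suc K) / fact j) / r ^ (j + Suc K) * ?m (Suc K) t"
        unfolding f b_def by simp
      finally show ?case .
    qed
    from this[OF t, of 0]
    show "\<bar>p 0 l t - (\<Sum>k<K. (-1) ^ k * (l powr \<beta>) ^ k * fact k * ?m k t)\<bar> \<le>
        2 * (l powr \<beta>) ^ K * fact K / r ^ K * ?m K t"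
      by (simp add: C0 x_def)
  qed
qed

section \<open>The series of \<open>p 0\<close>\<close>

definition stf_coeff :: "real \<Rightarrow> real \<Rightarrow> nat \<Rightarrow> real" where
  "stf_coeff a1 a2 k = fact k / (Gamma (1 + a1 * real k) * Gamma (1 + a2 * real k))"

lemma stf_coeff_pos:
  assumes "0 < a1" "0 < a2" shows "0 < stf_coeff a1 a2 k"
  unfolding stf_coeff_def using assms
  by (intro divide_pos_pos mult_pos_pos Gamma_real_pos add_pos_nonneg) auto

lemma fact_rl_monomial:
  assumes "0 < fst t" "0 < snd t"
  shows "fact k * rl_monomial a1 a2 k t = stf_coeff a1 a2 k * (fst t powr a1 * snd t powr a2) ^ k"
proof -
  have "u powr (\<alpha> * real k) = (u powr \<alpha>) ^ k" if "0 < u" for u \<alpha> :: real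
    using that by (simp add: powr_powr[symmetric] powr_realpow)
  then show ?thesis
    using assms by (simp add: rl_monomial_def stf_coeff_def power_mult_distrib)
qed

text \<open>The hypothesis on \<open>A\<close> says that Y does not exceed the radius of
  convergence. The remainder carries an additional 1 / r^K, so the expansion is reached only for
  arguments below r Y. This threshold is the same for all l, as the continuation in l
  requires.\<close>

lemma (in poisson_field_system) p0_sums_near_0:
  assumes t: "0 < fst t" "0 < snd t" and Y: "0 < Y" and A: "\<And>k. stf_coeff a1 a2 k * Y ^ k \<le> A"
  obtains \<rho> where "0 < \<rho>" and "\<And>l. 0 < l \<Longrightarrow> fst t powr a1 * snd t powr a2 * l powr \<beta> < \<rho> \<Longrightarrow>
    (\<lambda>k. stf_coeff a1 a2 k * (- (fst t powr a1 * snd t powr a2 * l powr \<beta>)) ^ k) sums p 0 l t"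
proof -
  define T where "T = fst t powr a1 * snd t powr a2"
  have T: "0 < T" using t by (simp add: T_def)
  let ?a = "stf_coeff a1 a2"
  obtain r where r: "0 < r" "r < 1" and rem: "\<And>l t K. 0 < l \<Longrightarrow> 0 < fst t \<Longrightarrow> 0 < snd t \<Longrightarrow>
      \<bar>p 0 l t - (\<Sum>k<K. (-1) ^ k * (l powr \<beta>) ^ k * fact k * rl_monomial a1 a2 k t)\<bar> \<le>
        2 * (l powr \<beta>) ^ K * fact K / r ^ K * rl_monomial a1 a2 K t"
    using taylor_remainder by blast
  show ?thesis
  proof (rule that[of "r * Y"])
    fix l :: real
    assume l: "0 < l" and less: "fst t powr a1 * snd t powr a2 * l powr \<beta> < r * Y"
    define y where "y = T * l powr \<beta>"
    have y: "0 \<le> y" "y < r * Y" using T less by (auto simp: y_def T_def)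
    have bound: "\<bar>p 0 l t - (\<Sum>k<K. ?a k * (- y) ^ k)\<bar> \<le> 2 * A * (y / (r * Y)) ^ K" for K
    proof -
      have e: "(-1) ^ k * (l powr \<beta>) ^ k * fact k * rl_monomial a1 a2 k t = ?a k * (- y) ^ k" for k
      proof -
        have "(-1) ^ k * (l powr \<beta>) ^ k * fact k * rl_monomial a1 a2 k t =
            (-1) ^ k * (l powr \<beta>) ^ k * (fact k * rl_monomial a1 a2 k t)" by simp
        then show ?thesis
          unfolding fact_rl_monomial[OF t] T_def[symmetric] y_def power_minus[of "T * l powr \<beta>"] power_mult_distrib
          by simp
      qed
      have "2 * (l powr \<beta>) ^ K * fact K / r ^ K * rl_monomial a1 a2 K t =
          2 * (l powr \<beta>) ^ K * (fact K * rl_monomial a1 a2 K t) / r ^ K" by simp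
      also have "\<dots> = 2 * (?a K * Y ^ K) * (y / (r * Y)) ^ K"
        unfolding fact_rl_monomial[OF t] T_def[symmetric] y_def using Y r
        by (simp add: power_mult_distrib power_divide)
      also have "\<dots> \<le> 2 * A * (y / (r * Y)) ^ K"
        using A[of K] y r Y by (intro mult_right_mono mult_left_mono) auto
      finally show ?thesis using rem[OF l t, of K] unfolding e by linarith
    qed
    have "norm (y / (r * Y)) < 1" using y r Y by (simp add: abs_of_nonneg divide_less_eq)
    then have "(\<lambda>K. 2 * A * (y / (r * Y)) ^ K) \<longlonglongrightarrow> 0"
      by (rule tendsto_mult_right_zero[OF LIMSEQ_power_zero])
    then have "(\<lambda>K. p 0 l t - (\<Sum>k<K. ?a k * (- y) ^ k)) \<longlonglongrightarrow> 0"
      by (rule Lim_null_comparison[rotated]) (simp add: bound)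
    then have "(\<lambda>K. p 0 l t - (p 0 l t - (\<Sum>k<K. ?a k * (- y) ^ k))) \<longlonglongrightarrow> p 0 l t - 0"
      by (intro tendsto_diff tendsto_const)
    then show "(\<lambda>k. ?a k * (- (fst t powr a1 * snd t powr a2 * l powr \<beta>)) ^ k) sums p 0 l t"
      by (simp add: sums_def y_def T_def)
  qed (use r Y in auto)
qed

text \<open>Two holomorphic functions of the intensity z are compared: \<open>\<Phi>\<close>, the
  generating function at v = 1 - z / l, which continues \<open>p 0\<close> to the disc of radius l
  around l, and \<open>\<Psi>\<close>, the series with z^\<beta> inserted. They agree at small
  positive z, hence at l.\<close>

lemma (in poisson_field_system) p0_sums:
  assumes t: "0 < fst t" "0 < snd t" and l: "0 < l" and A: "\<And>k. stf_coeff a1 a2 k * Y ^ k \<le> A"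
    and less: "fst t powr a1 * snd t powr a2 * l powr \<beta> < Y"
  shows "(\<lambda>k. stf_coeff a1 a2 k * (- (fst t powr a1 * snd t powr a2 * l powr \<beta>)) ^ k) sums p 0 l t"
proof -
  define T where "T = fst t powr a1 * snd t powr a2"
  have T: "0 < T" using t by (simp add: T_def)
  have Y: "0 < Y" using less mult_pos_pos[OF T, of "l powr \<beta>"] l by (simp add: T_def)
  let ?a = "stf_coeff a1 a2"
  have a0: "0 < ?a k" for k by (rule stf_coeff_pos[OF pos(1,2)])
  obtain \<rho> where \<rho>: "0 < \<rho>" and near: "\<And>l. 0 < l \<Longrightarrow> T * l powr \<beta> < \<rho> \<Longrightarrow>
      (\<lambda>k. ?a k * (- (T * l powr \<beta>)) ^ k) sums p 0 l t"
    using p0_sums_near_0[OF t Y A] unfolding T_def by blast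
  \<comment> \<open>|z| < R puts |z^\<beta>| below Y / T, inside the disc on which G
    converges.\<close>
  define R where "R = (Y / T) powr (1 / \<beta>)"
  have R: "0 < R" "R powr \<beta> = Y / T" using Y T pos by (simp_all add: R_def powr_powr)
  have "l powr \<beta> < R powr \<beta>" using less T R by (simp add: T_def field_simps)
  then have lR: "l < R" using l R pos by (metis less_imp_le linorder_not_less powr_mono2)
  define G :: "complex \<Rightarrow> complex" where "G w = (\<Sum>k. of_real (?a k * (- T) ^ k) * w ^ k)" for w
  have G_summable: "summable (\<lambda>k. norm (of_real (?a k * (- T) ^ k) * w ^ k))" if "norm w < Y / T" for w :: complex
  proof -
    have "summable (\<lambda>k. norm (?a k) * (T * norm w) ^ k)"
      by (rule Abel_lemma[of _ Y _ A]) (use that T A a0 in \<open>auto simp: field_simps abs_of_pos\<close>)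
    then show ?thesis using T by (simp add: norm_mult norm_power abs_mult power_abs power_mult_distrib mult_ac)
  qed
  have G_sums: "(\<lambda>k. of_real (?a k * (- T) ^ k) * w ^ k) sums G w" if "norm w < Y / T" for w
    unfolding G_def by (rule summable_sums[OF summable_norm_cancel[OF G_summable[OF that]]])
  have hol_G: "G holomorphic_on ball 0 (Y / T)"
    by (rule power_series_holomorphic[of _ _ "\<lambda>k. of_real (?a k * (- T) ^ k)"]) (use G_sums in auto)
  define \<Phi> :: "complex \<Rightarrow> complex" where "\<Phi> z = (\<Sum>n. of_real (p n l t * (- 1 / l) ^ n) * (z - of_real l) ^ n)" for z
  have \<Phi>_sums: "(\<lambda>n. of_real (p n l t * (- 1 / l) ^ n) * (z - of_real l) ^ n) sums \<Phi> z"
    if "norm (z - of_real l) < l" for z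
    unfolding \<Phi>_def
  proof (rule summable_sums, rule summable_norm_cancel)
    have "summable (\<lambda>n. \<bar>p n l t * (norm (z - of_real l) / l) ^ n\<bar>)"
      by (rule summable_gen(2)) (use that l in \<open>auto simp: divide_less_eq\<close>)
    then show "summable (\<lambda>n. norm (of_real (p n l t * (- 1 / l) ^ n) * (z - of_real l) ^ n))"
      using l by (simp add: norm_mult norm_power norm_divide abs_mult power_abs power_divide)
  qed
  have hol_\<Phi>: "\<Phi> holomorphic_on ball (of_real l) l"
    by (rule power_series_holomorphic[of _ _ "\<lambda>n. of_real (p n l t * (- 1 / l) ^ n)"])
      (use \<Phi>_sums in \<open>auto simp: dist_norm norm_minus_commute\<close>)
  \<comment> \<open>Convex, hence connected; contained in the right half-plane, where the principal
    power is holomorphic; and with 0 on its boundary, so that it contains the small positive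
    reals.\<close>
  define V where "V = ball (of_real l) l \<inter> ball (0 :: complex) R"
  have Re_pos: "0 < Re z" if "z \<in> V" for z
  proof -
    have "\<bar>Re (of_real l - z)\<bar> < l"
      using that abs_Re_le_cmod[of "of_real l - z"] by (simp add: V_def dist_norm)
    then show ?thesis by simp
  qed
  have powr_V: "norm (z powr of_real \<beta>) < Y / T" if "z \<in> V" for z
  proof -
    have "z \<noteq> 0" using Re_pos[OF that] by auto
    then have "norm (z powr of_real \<beta>) = norm z powr \<beta>"
      by (simp add: norm_powr_real_powr')
    also have "\<dots> < R powr \<beta>" using that pos by (intro powr_less_mono2) (auto simp: V_def)
    finally show ?thesis using R by simp
  qed
  define \<Psi> where "\<Psi> z = G (z powr of_real \<beta>)" for z
  have hol_\<Psi>: "\<Psi> holomorphic_on V"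
    unfolding \<Psi>_def
  proof (rule holomorphic_on_compose_gen[OF _ hol_G, unfolded comp_def])
    show "(\<lambda>z. z powr of_real \<beta>) holomorphic_on V"
    proof (intro holomorphic_intros)
      show "z \<notin> \<real>\<^sub>\<le>\<^sub>0" if "z \<in> V" for z
        using Re_pos[OF that] by (simp add: complex_nonpos_Reals_iff)
    qed
  qed (use powr_V in auto)
  have \<Phi>_real: "\<Phi> (of_real y) = of_real (p 0 y t)" if "0 < y" "y < 2 * l" for y
  proof -
    have "(\<lambda>n. p n l t * (1 - y / l) ^ n) sums p 0 ((1 - (1 - y / l)) * l) t"
      by (rule gen_sums_scaled) (use that l in \<open>auto simp: abs_less_iff field_simps\<close>)
    then have 1: "(\<lambda>n. complex_of_real (p n l t * (1 - y / l) ^ n)) sums of_real (p 0 y t)"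
      using l by (subst sums_of_real_iff) simp
    have 2: "complex_of_real (p n l t * (1 - y / l) ^ n) =
        of_real (p n l t * (- 1 / l) ^ n) * (of_real y - of_real l) ^ n" for n
    proof -
      have "1 - y / l = (- 1 / l) * (y - l)" using l by (simp add: field_simps)
      then have "p n l t * (1 - y / l) ^ n = p n l t * (- 1 / l) ^ n * (y - l) ^ n"
        by (simp only: power_mult_distrib mult.assoc)
      then show ?thesis by (simp only: of_real_mult of_real_power of_real_diff)
    qed
    show ?thesis
      unfolding \<Phi>_def by (rule sums_unique[symmetric]) (rule 1[unfolded 2])
  qed
  have \<Psi>_real: "(\<lambda>k. complex_of_real (?a k * (- (T * y powr \<beta>)) ^ k)) sums \<Psi> (of_real y)"
    if "0 < y" "y < R" for y
  proof -
    have e: "of_real y powr of_real \<beta> = complex_of_real (y powr \<beta>)"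
      using that by (intro powr_of_real) auto
    have "y powr \<beta> < Y / T" using powr_less_mono2[of \<beta> y R] that pos R by simp
    then have 1: "(\<lambda>k. of_real (?a k * (- T) ^ k) * of_real (y powr \<beta>) ^ k) sums \<Psi> (of_real y)"
      unfolding \<Psi>_def e by (intro G_sums) simp
    have 2: "of_real (?a k * (- T) ^ k) * of_real (y powr \<beta>) ^ k =
        complex_of_real (?a k * (- (T * y powr \<beta>)) ^ k)" for k
    proof -
      have "?a k * (- (T * y powr \<beta>)) ^ k = ?a k * (- T) ^ k * (y powr \<beta>) ^ k"
        by (simp only: mult_minus_left[symmetric] power_mult_distrib mult.assoc)
      then show ?thesis by (simp only: of_real_mult of_real_power)
    qed
    show ?thesis by (rule 1[unfolded 2])
  qed
  \<comment> \<open>Below this bound a positive y satisfies T y^\<beta> < \<rho>, where the series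
    is already known, and it lies below both 2 l and R.\<close>
  define \<epsilon> where "\<epsilon> = min l ((\<rho> / T) powr (1 / \<beta>))"
  have \<epsilon>: "0 < \<epsilon>" "\<epsilon> \<le> l" using l \<rho> T by (auto simp: \<epsilon>_def)
  have \<epsilon>_near: "T * y powr \<beta> < \<rho>" if "0 < y" "y < \<epsilon>" for y
  proof -
    have "y powr \<beta> < ((\<rho> / T) powr (1 / \<beta>)) powr \<beta>"
      using that pos by (intro powr_less_mono2) (auto simp: \<epsilon>_def)
    then show ?thesis using \<rho> T pos by (simp add: powr_powr field_simps)
  qed
  have in_V: "of_real y \<in> V" if "0 < y" "y < 2 * l" "y < R" for y
    using that by (auto simp: V_def dist_norm norm_of_real simp flip: of_real_diff)
  have "\<Phi> w - \<Psi> w = 0" if "w \<in> V" for w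
  proof (rule analytic_continuation[where f = "\<lambda>w. \<Phi> w - \<Psi> w" and S = V and U = "of_real ` {0<..<\<epsilon>}" and \<xi> = "of_real (\<epsilon> / 2)"])
    show "(\<lambda>w. \<Phi> w - \<Psi> w) holomorphic_on V"
      by (intro holomorphic_intros hol_\<Psi> holomorphic_on_subset[OF hol_\<Phi>]) (auto simp: V_def)
    show "open V" "connected V"
      by (auto simp: V_def intro!: convex_connected convex_Int)
    show "complex_of_real ` {0<..<\<epsilon>} \<subseteq> V" "complex_of_real (\<epsilon> / 2) \<in> V"
      using \<epsilon> lR l by (auto intro!: in_V simp del: of_real_divide)
    show "complex_of_real (\<epsilon> / 2) islimpt of_real ` {0<..<\<epsilon>}"
      unfolding islimpt_approachable
    proof (intro allI impI)
      fix e :: real assume e: "0 < e"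
      define y where "y = \<epsilon> / 2 + min (e / 2) (\<epsilon> / 4)"
      have "y \<in> {0<..<\<epsilon>}" "y \<noteq> \<epsilon> / 2" "\<bar>y - \<epsilon> / 2\<bar> < e" using e \<epsilon> by (auto simp: y_def min_def)
      then have "of_real y \<in> complex_of_real ` {0<..<\<epsilon>}" "complex_of_real y \<noteq> of_real (\<epsilon> / 2)"
        "dist (complex_of_real y) (of_real (\<epsilon> / 2)) < e"
        by (auto simp: dist_norm simp del: of_real_divide simp flip: of_real_diff)
      then show "\<exists>x'\<in>complex_of_real ` {0<..<\<epsilon>}. x' \<noteq> of_real (\<epsilon> / 2) \<and> dist x' (of_real (\<epsilon> / 2)) < e"
        by blast
    qed
    fix z assume "z \<in> complex_of_real ` {0<..<\<epsilon>}"
    then obtain y where y: "0 < y" "y < \<epsilon>" "z = of_real y" by auto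
    have "(\<lambda>k. complex_of_real (?a k * (- (T * y powr \<beta>)) ^ k)) sums of_real (p 0 y t)"
      using near[OF y(1) \<epsilon>_near[OF y(1,2)]] by (subst sums_of_real_iff)
    then have "\<Psi> z = of_real (p 0 y t)"
      using \<Psi>_real[of y] y \<epsilon> lR by (auto intro: sums_unique2)
    then show "\<Phi> z - \<Psi> z = 0" using \<Phi>_real[of y] y \<epsilon> by simp
  qed (rule that)
  then have "\<Psi> (of_real l) = \<Phi> (of_real l)" using in_V[of l] l lR by simp
  with \<Psi>_real[OF l lR] \<Phi>_real[of l] l
  have "(\<lambda>k. complex_of_real (?a k * (- (T * l powr \<beta>)) ^ k)) sums of_real (p 0 l t)" by simp
  then show ?thesis unfolding T_def by (subst (asm) sums_of_real_iff)
qed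

section \<open>From \<open>p 0\<close> to \<open>p n\<close>\<close>

lemma abs_gbinomial_le:
  fixes z :: real assumes "0 \<le> z"
  shows "\<bar>z gchoose n\<bar> \<le> (-1) ^ n * (- z gchoose n)"
proof -
  have "fact n * ((-1) ^ n * (- z gchoose n)) = (\<Prod>i=0..<n. z + real i)"
  proof -
    have "fact n * ((-1) ^ n * (- z gchoose n)) = (-1) ^ n * (fact n * (- z gchoose n))" by simp
    also have "\<dots> = (\<Prod>i=0..<n. (-1) * (- z - real i))"
      unfolding gbinomial_mult_fact prod.distrib by simp
    finally show ?thesis by (simp add: algebra_simps)
  qed
  moreover have "fact n * \<bar>z gchoose n\<bar> = (\<Prod>i=0..<n. \<bar>z - real i\<bar>)"
  proof -
    have "fact n * \<bar>z gchoose n\<bar> = \<bar>fact n * (z gchoose n)\<bar>" by (simp add: abs_mult)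
    then show ?thesis by (simp only: gbinomial_mult_fact abs_prod)
  qed
  moreover have "(\<Prod>i=0..<n. \<bar>z - real i\<bar>) \<le> (\<Prod>i=0..<n. z + real i)"
    using assms by (intro prod_mono) auto
  ultimately have "fact n * \<bar>z gchoose n\<bar> \<le> fact n * ((-1) ^ n * (- z gchoose n))" by simp
  then show ?thesis by (simp add: mult_le_cancel_left_pos)
qed

text \<open>Since |z - i| \<le> z + i factor by factor, the absolute series is dominated by the
  binomial series with exponent - z at - |v|, whose terms are nonnegative.\<close>

lemma abs_binomial_series:
  fixes z v :: real assumes "0 \<le> z" "\<bar>v\<bar> < 1"
  shows "summable (\<lambda>n. \<bar>(z gchoose n) * v ^ n\<bar>)"
    and "(\<Sum>n. \<bar>(z gchoose n) * v ^ n\<bar>) \<le> (1 - \<bar>v\<bar>) powr - z"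
proof -
  have s: "(\<lambda>n. (- z gchoose n) * (- \<bar>v\<bar>) ^ n) sums (1 - \<bar>v\<bar>) powr - z"
    using gen_binomial_real[of "- \<bar>v\<bar>" "- z"] assms by simp
  have le: "\<bar>(z gchoose n) * v ^ n\<bar> \<le> (- z gchoose n) * (- \<bar>v\<bar>) ^ n" for n
    using mult_right_mono[OF abs_gbinomial_le[OF assms(1), of n], of "\<bar>v\<bar> ^ n"]
    by (simp add: abs_mult power_abs power_minus[of "\<bar>v\<bar>"] mult_ac)
  show 1: "summable (\<lambda>n. \<bar>(z gchoose n) * v ^ n\<bar>)"
    by (rule summable_comparison_test[OF _ sums_summable[OF s]]) (use le in auto)
  show "(\<Sum>n. \<bar>(z gchoose n) * v ^ n\<bar>) \<le> (1 - \<bar>v\<bar>) powr - z"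
    using suminf_le[OF le 1 sums_summable[OF s]] s by (simp add: sums_iff)
qed

text \<open>Inserting (1 - v) l into the series of \<open>p 0\<close> produces the powers (1 -
  v)^(\<beta> k). Expanding them and exchanging the sums gives a power series in v, to be compared
  with the generating function.\<close>

lemma (in poisson_field_system) pn_sums:
  assumes t: "0 < fst t" "0 < snd t" and l: "0 < l" and A: "\<And>k. stf_coeff a1 a2 k * Y ^ k \<le> A"
    and less: "fst t powr a1 * snd t powr a2 * l powr \<beta> < Y"
  shows "(\<lambda>k. stf_coeff a1 a2 k * (- (fst t powr a1 * snd t powr a2 * l powr \<beta>)) ^ k * (\<beta> * real k gchoose n))
    sums ((-1) ^ n * p n l t)"
proof -
  define T where "T = fst t powr a1 * snd t powr a2"
  have T: "0 < T" using t by (simp add: T_def)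
  define y where "y = T * l powr \<beta>"
  have y: "0 < y" "y < Y" using T l less by (auto simp: y_def T_def)
  let ?a = "stf_coeff a1 a2"
  have a0: "0 < ?a k" for k by (rule stf_coeff_pos[OF pos(1,2)])
  \<comment> \<open>|v| < \<eta> amounts to y (1 - |v|)^-\<beta> < Y, which makes the double series
    absolutely convergent.\<close>
  define \<eta> where "\<eta> = 1 - (y / Y) powr (1 / \<beta>)"
  have "(y / Y) powr (1 / \<beta>) < 1 powr (1 / \<beta>)"
    using y pos by (intro powr_less_mono2) (auto simp: divide_less_eq)
  then have \<eta>: "0 < \<eta>" "\<eta> \<le> 1" by (auto simp: \<eta>_def)
  define S where "S n = (\<Sum>k. ?a k * (- y) ^ k * (\<beta> * real k gchoose n))" for n
  have key: "summable (\<lambda>k. \<bar>?a k * (- y) ^ k * ((\<beta> * real k gchoose n) * v ^ n)\<bar>) \<and>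
      (\<lambda>n. (\<Sum>k. ?a k * (- y) ^ k * ((\<beta> * real k gchoose n) * (- v) ^ n))) sums p 0 ((1 - v) * l) t"
    if v: "\<bar>v\<bar> < \<eta>" for v n
  proof -
    have v1: "\<bar>v\<bar> < 1" "0 < 1 - v" "0 < 1 - \<bar>v\<bar>" using v \<eta> by auto
    define u where "u = (1 - \<bar>v\<bar>) powr - \<beta>"
    have u: "0 < u" using v1 by (simp add: u_def)
    have yu: "y * u < Y"
    proof -
      have "((y / Y) powr (1 / \<beta>)) powr \<beta> < (1 - \<bar>v\<bar>) powr \<beta>"
        using v pos y by (intro powr_less_mono2) (auto simp: \<eta>_def)
      then have "y / Y < (1 - \<bar>v\<bar>) powr \<beta>" using pos y by (simp add: powr_powr)
      then show ?thesis using y v1 by (simp add: u_def powr_minus field_simps)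
    qed
    define f where "f k n = ?a k * (- y) ^ k * ((\<beta> * real k gchoose n) * (- v) ^ n)" for k n
    have bin: "summable (\<lambda>n. \<bar>(\<beta> * real k gchoose n) * (- v) ^ n\<bar>)"
      "(\<Sum>n. \<bar>(\<beta> * real k gchoose n) * (- v) ^ n\<bar>) \<le> u ^ k" for k
    proof -
      have k0: "0 \<le> \<beta> * real k" "\<bar>- v\<bar> < 1" using pos v1 by auto
      show "summable (\<lambda>n. \<bar>(\<beta> * real k gchoose n) * (- v) ^ n\<bar>)"
        by (rule abs_binomial_series(1)[OF k0])
      have "u ^ k = (1 - \<bar>v\<bar>) powr - (\<beta> * real k)"
        using v1 by (simp add: u_def powr_realpow[symmetric] powr_powr)
      then show "(\<Sum>n. \<bar>(\<beta> * real k gchoose n) * (- v) ^ n\<bar>) \<le> u ^ k"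
        using abs_binomial_series(2)[OF k0] by simp
    qed
    have absf: "\<bar>f k n\<bar> = ?a k * y ^ k * \<bar>(\<beta> * real k gchoose n) * (- v) ^ n\<bar>" for k n
      using a0[of k] y by (simp add: f_def abs_mult power_abs)
    have sf: "summable (\<lambda>n. \<bar>f k n\<bar>)" for k
      unfolding absf by (rule summable_mult[OF bin(1)])
    have sf_le: "(\<Sum>n. \<bar>f k n\<bar>) \<le> ?a k * (y * u) ^ k" for k
      unfolding absf suminf_mult[OF bin(1)] using bin(2)[of k] a0[of k] y
      by (simp add: power_mult_distrib mult_left_mono mult.assoc)
    have dom: "summable (\<lambda>k. ?a k * (y * u) ^ k)"
    proof -
      have "summable (\<lambda>k. norm (?a k) * (y * u) ^ k)"
        by (rule Abel_lemma[of _ Y _ A]) (use yu y u A a0 in \<open>auto simp: abs_of_pos\<close>)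
      then show ?thesis using a0 by (simp add: abs_of_pos)
    qed
    have f_le: "\<bar>f k n\<bar> \<le> ?a k * (y * u) ^ k" for k n
      using sum_le_suminf[OF sf[of k], of "{n}"] sf_le[of k] by simp
    have sk: "summable (\<lambda>k. \<bar>f k n\<bar>)" for n
      by (rule summable_comparison_test[OF _ dom]) (use f_le in auto)
    \<comment> \<open>The sum over n is an integral for counting measure, so termwise integration
      performs the exchange.\<close>
    have int: "integrable (count_space UNIV) (f k)" for k
      using sf[of k] by (simp add: integrable_count_space_nat_iff)
    have nrm: "summable (\<lambda>k. \<integral>n. norm (f k n) \<partial>count_space UNIV)"
    proof (rule summable_comparison_test[OF _ dom])
      have "(\<integral>n. norm (f k n) \<partial>count_space UNIV) = (\<Sum>n. \<bar>f k n\<bar>)" for k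
        using integral_count_space_nat[of "\<lambda>n. norm (f k n)"] sf[of k]
        by (simp add: integrable_count_space_nat_iff)
      then show "\<exists>N. \<forall>k\<ge>N. norm (\<integral>n. norm (f k n) \<partial>count_space UNIV) \<le> ?a k * (y * u) ^ k"
        using sf_le by (simp add: suminf_nonneg[OF sf])
    qed
    have AEs: "AE n in count_space UNIV. summable (\<lambda>k. norm (f k n))" using sk by simp
    have 1: "(\<lambda>k. \<integral>n. f k n \<partial>count_space UNIV) sums (\<integral>n. (\<Sum>k. f k n) \<partial>count_space UNIV)"
      by (rule sums_integral[OF int AEs nrm])
    have ints: "integrable (count_space UNIV) (\<lambda>n. \<Sum>k. f k n)"
      by (rule integrable_suminf[OF int AEs nrm])
    then have 2: "(\<integral>n. (\<Sum>k. f k n) \<partial>count_space UNIV) = (\<Sum>n. \<Sum>k. f k n)"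
      by (rule integral_count_space_nat)
    have 3: "(\<integral>n. f k n \<partial>count_space UNIV) = ?a k * (- (T * ((1 - v) * l) powr \<beta>)) ^ k" for k
    proof -
      have "(\<integral>n. f k n \<partial>count_space UNIV) = (\<Sum>n. f k n)"
        by (rule integral_count_space_nat[OF int])
      also have "\<dots> = ?a k * (- y) ^ k * (\<Sum>n. (\<beta> * real k gchoose n) * (- v) ^ n)"
        unfolding f_def by (rule suminf_mult[OF summable_rabs_cancel[OF bin(1)]])
      also have "(\<Sum>n. (\<beta> * real k gchoose n) * (- v) ^ n) = (1 - v) powr (\<beta> * real k)"
        using gen_binomial_real[of "- v" "\<beta> * real k"] v1 by (simp add: sums_iff)
      also have "(1 - v) powr (\<beta> * real k) = ((1 - v) powr \<beta>) ^ k"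
        using v1 by (simp add: powr_realpow[symmetric] powr_powr)
      also have "?a k * (- y) ^ k * ((1 - v) powr \<beta>) ^ k = ?a k * (- y * (1 - v) powr \<beta>) ^ k"
        by (simp only: power_mult_distrib mult.assoc)
      also have "- y * (1 - v) powr \<beta> = - (T * ((1 - v) * l) powr \<beta>)"
        using v1 l by (simp add: y_def powr_mult)
      finally show ?thesis .
    qed
    \<comment> \<open>For negative v the intensity (1 - v) l exceeds l; this bound keeps the
      argument y (1 - v)^\<beta> below Y, where \<open>p0_sums\<close> applies.\<close>
    have "(1 - v) powr \<beta> \<le> u"
    proof -
      have "(1 - v) * (1 - \<bar>v\<bar>) \<le> (1 + \<bar>v\<bar>) * (1 - \<bar>v\<bar>)"
        using v1 by (intro mult_right_mono) auto
      also have "\<dots> \<le> 1" by (simp add: algebra_simps)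
      finally have "((1 - v) * (1 - \<bar>v\<bar>)) powr \<beta> \<le> 1 powr \<beta>"
        using pos v1 by (intro powr_mono2) auto
      then have "(1 - v) powr \<beta> * (1 - \<bar>v\<bar>) powr \<beta> \<le> 1"
        using v1 by (simp only: powr_mult powr_one_eq_one)
      then show ?thesis using v1 by (simp add: u_def powr_minus field_simps)
    qed
    then have "y * (1 - v) powr \<beta> \<le> y * u"
      using y by (intro mult_left_mono) auto
    then have "y * (1 - v) powr \<beta> < Y" using yu by linarith
    then have "fst t powr a1 * snd t powr a2 * ((1 - v) * l) powr \<beta> < Y"
      using v1 l by (simp add: y_def T_def powr_mult mult_ac)
    from p0_sums[OF t _ A this]
    have 4: "(\<lambda>k. ?a k * (- (T * ((1 - v) * l) powr \<beta>)) ^ k) sums p 0 ((1 - v) * l) t"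
      using v1 l by (simp add: T_def)
    have "p 0 ((1 - v) * l) t = (\<Sum>n. \<Sum>k. f k n)"
      using sums_unique2[OF 1[unfolded 3] 4] 2 by simp
    moreover have "summable (\<lambda>n. \<Sum>k. f k n)"
      using ints by (auto simp: integrable_count_space_nat_iff intro: summable_rabs_cancel)
    ultimately have "(\<lambda>n. \<Sum>k. f k n) sums p 0 ((1 - v) * l) t"
      by (simp add: sums_iff)
    moreover have "summable (\<lambda>k. \<bar>?a k * (- y) ^ k * ((\<beta> * real k gchoose n) * v ^ n)\<bar>)"
      using sk[of n] by (simp add: f_def abs_mult power_abs)
    ultimately show ?thesis by (simp add: f_def)
  qed
  have summ: "summable (\<lambda>k. ?a k * (- y) ^ k * (\<beta> * real k gchoose n))" for n
  proof -
    have "summable (\<lambda>k. ?a k * (- y) ^ k * ((\<beta> * real k gchoose n) * (\<eta> / 2) ^ n))"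
      using key[of "\<eta> / 2" n] \<eta> by (auto intro: summable_rabs_cancel)
    then have "summable (\<lambda>k. ?a k * (- y) ^ k * ((\<beta> * real k gchoose n) * (\<eta> / 2) ^ n) / (\<eta> / 2) ^ n)"
      by (rule summable_divide)
    moreover have "?a k * (- y) ^ k * ((\<beta> * real k gchoose n) * (\<eta> / 2) ^ n) / (\<eta> / 2) ^ n =
        ?a k * (- y) ^ k * (\<beta> * real k gchoose n)" for k
      using \<eta> by simp
    ultimately show ?thesis by (simp only:)
  qed
  have "p n l t = (-1) ^ n * S n"
  proof (rule powser_unique[OF \<eta>(1)])
    fix v :: real assume v: "\<bar>v\<bar> < \<eta>"
    show "(\<lambda>n. p n l t * v ^ n) sums p 0 ((1 - v) * l) t"
      by (rule gen_sums_scaled) (use v \<eta> l in auto)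
    have "(\<Sum>k. ?a k * (- y) ^ k * ((\<beta> * real k gchoose n) * (- v) ^ n)) = (-1) ^ n * S n * v ^ n" for n
    proof -
      have "(\<lambda>k. ?a k * (- y) ^ k * ((\<beta> * real k gchoose n) * (- v) ^ n)) =
          (\<lambda>k. ?a k * (- y) ^ k * (\<beta> * real k gchoose n) * (- v) ^ n)" by (simp add: mult.assoc)
      then have "(\<Sum>k. ?a k * (- y) ^ k * ((\<beta> * real k gchoose n) * (- v) ^ n)) = S n * (- v) ^ n"
        unfolding S_def by (simp only: suminf_mult2[OF summ])
      then show ?thesis by (simp add: power_minus[of v])
    qed
    then show "(\<lambda>n. (-1) ^ n * S n * v ^ n) sums p 0 ((1 - v) * l) t"
      using key[OF v] by simp
  qed
  then have "(-1) ^ n * p n l t = S n" by simp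
  then show ?thesis
    using summable_sums[OF summ[of n]] by (simp add: S_def y_def T_def)
qed

section \<open>From the governing system to its integrated form\<close>

lemma field_dist_facts:
  assumes "prob_space (M l)" and "N l t1 t2 \<in> measurable (M l) (count_space UNIV)"
  shows field_dist_nonneg: "0 \<le> field_dist M N n l t1 t2"
    and field_dist_sums: "(\<lambda>n. field_dist M N (int n) l t1 t2) sums 1"
proof -
  interpret prob_space "M l" by fact
  note [measurable] = assms(2)
  show "0 \<le> field_dist M N n l t1 t2" by (simp add: field_dist_def)
  have "(\<lambda>n. prob {\<omega> \<in> space (M l). N l t1 t2 \<omega> = n}) sums prob (\<Union>n. {\<omega> \<in> space (M l). N l t1 t2 \<omega> = n})"
  proof (rule finite_measure_UNION)
    show "range (\<lambda>n. {\<omega> \<in> space (M l). N l t1 t2 \<omega> = n}) \<subseteq> events" by auto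
  qed (auto simp: disjoint_family_on_def)
  also have "(\<Union>n. {\<omega> \<in> space (M l). N l t1 t2 \<omega> = n}) = space (M l)" by auto
  finally show "(\<lambda>n. field_dist M N (int n) l t1 t2) sums 1"
    by (simp add: field_dist_def prob_space)
qed

lemma frac_diff_eq_sum:
  assumes "\<And>m. m < 0 \<Longrightarrow> q m = 0"
  shows "frac_diff \<beta> q (int n) = (\<Sum>k\<le>n. (\<beta> gchoose k) * (-1) ^ k * q (int (n - k)))"
proof -
  have "frac_diff \<beta> q (int n) = (\<Sum>k\<le>n. (\<beta> gchoose k) * (-1) ^ k * q (int n - int k))"
    unfolding frac_diff_def by (rule suminf_finite) (auto simp: assms)
  also have "\<dots> = (\<Sum>k\<le>n. (\<beta> gchoose k) * (-1) ^ k * q (int (n - k)))"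
    by (intro sum.cong) (auto simp: of_nat_diff)
  finally show ?thesis .
qed

lemma caputo_eq_0:
  assumes "\<And>s. 0 \<le> s \<Longrightarrow> g s = c" "0 < t"
  shows "caputo \<alpha> g t = 0"
proof -
  have d: "deriv g s = 0" if "0 < s" for s
  proof (rule DERIV_imp_deriv)
    show "(g has_real_derivative 0) (at s)"
      by (rule has_field_derivative_transform_within_open[OF DERIV_const, where S = "{0<..}"])
        (use that assms(1) in auto)
  qed
  have "(LINT s:{0<..<t}|lborel. deriv g s / (t - s) powr \<alpha>) = (LINT s:{0<..<t}|lborel. 0)"
    by (rule set_lebesgue_integral_cong) (auto simp: d)
  then show ?thesis using d[OF assms(2)] by (simp add: caputo_def set_lebesgue_integral_def)
qed

text \<open>The right-hand side of the equation is - l / \<beta> times the l-derivative of l^\<beta>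
  (I - B)^\<beta> p. Integrating fractionally in t2 and then in t1 turns the left-hand side into p
  minus its axis values, and the l-derivative is pulled out of the double integral.\<close>

lemma stfprf_imp_poisson_field_system:
  assumes \<alpha>: "0 < a1" "a1 \<le> 1" "0 < a2" "a2 \<le> 1" and \<beta>: "0 < \<beta>"
    and stf: "stfprf a1 a2 \<beta> M N"
  shows "poisson_field_system a1 a2 \<beta>
    (\<lambda>n l s. field_dist M N (int n) l (max 0 (fst s)) (max 0 (snd s)))"
proof -
  let ?q = "field_dist M N"
  define p where "p n l s = ?q (int n) l (max 0 (fst s)) (max 0 (snd s))" for n l s
  define dp where "dp n l s = deriv (\<lambda>r. ?q (int n) r (max 0 (fst s)) (max 0 (snd s))) l" for n l s
  define c :: "nat \<Rightarrow> real" where "c n = (if n = 0 then 1 else 0)" for n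
  have sys: "stfprf_system a1 a2 \<beta> ?q" using stf by (simp add: stfprf_def)
  have q_cont: "continuous_on ({0<..} \<times> {0..} \<times> {0..}) (\<lambda>(l, t1, t2). ?q n l t1 t2)" for n
    using sys by (simp add: stfprf_system_def)
  have q_diff: "(\<lambda>r. ?q n r t1 t2) differentiable (at l)" if "0 < l" "0 \<le> t1" "0 \<le> t2" for n l t1 t2
    using sys that by (simp add: stfprf_system_def)
  have dq_cont: "continuous_on ({0<..} \<times> {0..} \<times> {0..}) (\<lambda>(l, t1, t2). deriv (\<lambda>r. ?q n r t1 t2) l)" for n
    using sys by (simp add: stfprf_system_def)
  have cap1: "caputo_differentiable a1 (\<lambda>s. ?q n l s t2)" if "0 < l" "0 < t2" for n l t2
    using sys that by (simp add: stfprf_system_def)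
  have cap2: "caputo_differentiable a2 (\<lambda>r. caputo a1 (\<lambda>s. ?q n l s r) t1)" if "0 < l" "0 < t1" for n l t1
    using sys that by (simp add: stfprf_system_def)
  have eq: "caputo a2 (\<lambda>r. caputo a1 (\<lambda>s. ?q n l s r) t1) t2 =
          - (l powr (\<beta> + 1) / \<beta> * deriv (\<lambda>r. frac_diff \<beta> (\<lambda>m. ?q m r t1 t2) n) l
             + l powr \<beta> * frac_diff \<beta> (\<lambda>m. ?q m l t1 t2) n)"
    if "0 \<le> n" "0 < l" "0 < t1" "0 < t2" for n l t1 t2
    using sys that by (simp add: stfprf_system_def)
  have bd: "?q 0 l 0 t = 1" "?q 0 l t 0 = 1" if "0 < l" "0 \<le> t" for l t
    using sys that by (simp_all add: stfprf_system_def)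
  have neg: "?q n l t1 t2 = 0" if "n < 0" "0 < l" "0 \<le> t1" "0 \<le> t2" for n l t1 t2
    using sys that by (simp add: stfprf_system_def)
  have nonneg: "0 \<le> ?q n l t1 t2" and sums: "(\<lambda>n. ?q (int n) l t1 t2) sums 1"
    if "0 < l" "0 \<le> t1" "0 \<le> t2" for n l t1 t2
    using field_dist_facts[of M l N t1 t2] stf that by (auto simp: stfprf_def)
  \<comment> \<open>The system prescribes only p_0 on the axes; there it exhausts the total mass 1,
    so the other probabilities vanish.\<close>
  have axis: "?q (int n) l t1 t2 = c n" if l: "0 < l" and t: "0 \<le> t1" "0 \<le> t2" and z: "t1 = 0 \<or> t2 = 0" for n l t1 t2
  proof (cases "n = 0")
    case True
    then show ?thesis using bd l t z by (auto simp: c_def)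
  next
    case False
    have "(\<Sum>i\<in>{0, n}. ?q (int i) l t1 t2) \<le> (\<Sum>i. ?q (int i) l t1 t2)"
      using nonneg[OF l t] sums[OF l t] by (intro sum_le_suminf) (auto simp: sums_iff)
    then have "?q 0 l t1 t2 + ?q (int n) l t1 t2 \<le> 1"
      using False sums[OF l t] by (simp add: sums_iff)
    moreover have "?q 0 l t1 t2 = 1" using bd l t z by auto
    ultimately show ?thesis using nonneg[OF l t, of "int n"] False by (simp add: c_def)
  qed
  have clamp_cont: "continuous_on ({0<..} \<times> UNIV) (\<lambda>(l, s). f l (max 0 (fst s)) (max 0 (snd s)))"
    if "continuous_on ({0<..} \<times> {0..} \<times> {0..}) (\<lambda>(l, t1, t2). f l t1 t2)"
    for f :: "real \<Rightarrow> real \<Rightarrow> real \<Rightarrow> real"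
  proof -
    have "continuous_on ({0<..} \<times> UNIV)
        (\<lambda>x. (\<lambda>(l, t1, t2). f l t1 t2) (fst x, max 0 (fst (snd x)), max 0 (snd (snd x))))"
      by (rule continuous_on_compose2[OF that]) (auto intro!: continuous_intros)
    then show ?thesis by (simp add: case_prod_unfold)
  qed
  have p_cont: "continuous_on ({0<..} \<times> UNIV) (\<lambda>(l, s). p n l s)" for n
    unfolding p_def by (rule clamp_cont[OF q_cont])
  have dp_cont: "continuous_on ({0<..} \<times> UNIV) (\<lambda>(l, s). dp n l s)" for n
    unfolding dp_def by (rule clamp_cont[OF dq_cont])
  have p_deriv: "((\<lambda>r. p n r s) has_real_derivative dp n l s) (at l)" if "0 < l" for n l s
    using q_diff[OF that, of "max 0 (fst s)" "max 0 (snd s)" "int n"]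
    unfolding p_def dp_def by (auto simp: real_differentiable_def dest: DERIV_imp_deriv)
  define Q where "Q n r s = (\<Sum>k\<le>n. (\<beta> gchoose k) * (-1) ^ k * p (n - k) r s)" for n r s
  define dQ where "dQ n r s = (\<Sum>k\<le>n. (\<beta> gchoose k) * (-1) ^ k * dp (n - k) r s)" for n r s
  have Q_deriv: "((\<lambda>r. Q n r s) has_real_derivative dQ n l s) (at l)" if "0 < l" for n l s
    unfolding Q_def dQ_def by (intro DERIV_sum DERIV_cmult p_deriv that)
  have Q_cont: "continuous_on ({0<..} \<times> UNIV) (\<lambda>x. Q n (fst x) (snd x))" for n
    unfolding Q_def using p_cont by (intro continuous_intros) (auto simp: case_prod_unfold)
  have dQ_cont: "continuous_on ({0<..} \<times> UNIV) (\<lambda>x. dQ n (fst x) (snd x))" for n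
    unfolding dQ_def using dp_cont by (intro continuous_intros) (auto simp: case_prod_unfold)
  have frac: "frac_diff \<beta> (\<lambda>m. ?q m r (fst s) (snd s)) (int n) = Q n r s"
    if "0 < r" "0 \<le> fst s" "0 \<le> snd s" for n r s
    using neg that by (subst frac_diff_eq_sum) (auto simp: Q_def p_def)
  define E where "E n r s = \<beta> * r powr (\<beta> - 1) * Q n r s + r powr \<beta> * dQ n r s" for n r s
  have E_cont: "continuous_on ({0<..} \<times> UNIV) (\<lambda>x. E n (fst x) (snd x))" for n
    unfolding E_def using Q_cont dQ_cont by (intro continuous_intros) auto
  have E_deriv: "((\<lambda>r. r powr \<beta> * Q n r s) has_real_derivative E n l s) (at l)" if "0 < l" for n l s
    unfolding E_def
    by (rule DERIV_cong[OF DERIV_mult[OF has_real_derivative_powr[OF that] Q_deriv[OF that]]]) simp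
  have E_slice: "continuous_on UNIV (E n l)" if "0 < l" for n l
    using continuous_on_slice[of "{0<..}" "E n" l] E_cont[of n] that by (simp add: case_prod_unfold)
  \<comment> \<open>Continuity up to the axes gives a bound on compact rectangles, uniform for r in
    a compact interval; it dominates the integrand when differentiating in l.\<close>
  have E_bound: "\<exists>B\<ge>0. \<forall>r s. r \<in> {a..b} \<longrightarrow> s \<in> {0..fst t} \<times> {0..snd t} \<longrightarrow> \<bar>E n r s\<bar> \<le> B"
    if "0 < a" for n a b and t :: "real \<times> real"
  proof -
    let ?K = "{a..b} \<times> ({0..fst t} \<times> {0..snd t})"
    have "compact ((\<lambda>x. E n (fst x) (snd x)) ` ?K)"
      by (intro compact_continuous_image continuous_on_subset[OF E_cont] compact_Times compact_Icc)
        (use that in auto)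
    then obtain B where B: "\<And>x. x \<in> ?K \<Longrightarrow> \<bar>E n (fst x) (snd x)\<bar> \<le> B"
      by (force dest!: compact_imp_bounded simp: bounded_iff)
    then show ?thesis by (intro exI[of _ "max B 0"]) force
  qed
  have main: "rl_int2 a1 a2 (E n l) t = \<beta> / l * (c n - p n l t)" if l: "0 < l" for n l t
  proof (cases "0 < fst t \<and> 0 < snd t")
    case False
    have "rl_weight2 a1 a2 t s = 0" for s
      using False by (auto simp: rl_weight2_def rl_weight_def rl_kernel_def)
    moreover have "p n l t = c n"
      unfolding p_def by (rule axis[OF l]) (use False in auto)
    ultimately show ?thesis by (simp add: rl_int2_def)
  next
    case True
    define t1 where "t1 = fst t"
    define t2 where "t2 = snd t"
    have t: "0 < t1" "0 < t2" "t = (t1, t2)" using True by (auto simp: t1_def t2_def)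
    obtain B where B: "0 \<le> B" "\<And>s. s \<in> {0..t1} \<times> {0..t2} \<Longrightarrow> \<bar>E n l s\<bar> \<le> B"
      using E_bound[OF l, of l t n] by (auto simp: t1_def t2_def)
    \<comment> \<open>The right-hand side of the equation on the rectangle up to (t1, t2), extended
      to the plane by its value at the nearest point; this makes it bounded and continuous
      everywhere.\<close>
    define G where "G s = - (l / \<beta>) * E n l (max 0 (min t1 (fst s)), max 0 (min t2 (snd s)))" for s
    have G_le: "\<bar>G s\<bar> \<le> l / \<beta> * B" for s
      unfolding G_def abs_mult using B l \<beta> t by (intro mult_mono) auto
    have "continuous_on UNIV G"
      unfolding G_def
      by (intro continuous_on_mult continuous_on_const continuous_on_compose2[OF E_slice[OF l]] continuous_on_Pair)
        (auto intro!: continuous_intros)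
    then have G_meas: "G \<in> borel_measurable borel" by (rule borel_measurable_continuous_onI)
    have G_meas2: "(\<lambda>r. G (s, r)) \<in> borel_measurable borel" for s
      by (rule measurable_compose[OF _ G_meas]) (simp add: borel_prod[symmetric])
    have G_eq: "caputo a2 (\<lambda>r. caputo a1 (\<lambda>s. ?q (int n) l s r) s1) s2 = G (s1, s2)"
      if s: "0 < s1" "s1 \<le> t1" "0 < s2" "s2 \<le> t2" for s1 s2
    proof -
      have "((\<lambda>r. frac_diff \<beta> (\<lambda>m. ?q m r s1 s2) (int n)) has_real_derivative dQ n l (s1, s2)) (at l)"
        by (rule has_field_derivative_transform_within_open[OF Q_deriv[OF l], where S = "{0<..}"])
          (use l s frac[of _ "(s1, s2)"] in auto)
      then have "deriv (\<lambda>r. frac_diff \<beta> (\<lambda>m. ?q m r s1 s2) (int n)) l = dQ n l (s1, s2)"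
        by (rule DERIV_imp_deriv)
      then have "caputo a2 (\<lambda>r. caputo a1 (\<lambda>s. ?q (int n) l s r) s1) s2 =
          - (l powr (\<beta> + 1) / \<beta> * dQ n l (s1, s2) + l powr \<beta> * Q n l (s1, s2))"
        using eq[of "int n" l s1 s2] frac[of l "(s1, s2)" n] l s by simp
      also have "\<dots> = - (l / \<beta>) * E n l (s1, s2)"
      proof -
        have "l powr (\<beta> + 1) = l * l powr \<beta>" "l powr (\<beta> - 1) = l powr \<beta> / l"
          using l by (simp_all add: powr_add powr_diff)
        then show ?thesis using l \<beta> by (simp add: E_def field_simps)
      qed
      finally show ?thesis using s t by (simp add: G_def)
    qed
    \<comment> \<open>The initial value to subtract is the Caputo derivative along the axis t2 = 0,
      which vanishes because the distribution is constant there.\<close>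
    have inner: "rl_int a2 (\<lambda>r. G (s1, r)) t2 = caputo a1 (\<lambda>s. ?q (int n) l s t2) s1"
      if s1: "0 < s1" "s1 \<le> t1" for s1
    proof -
      have "rl_int a2 (\<lambda>r. G (s1, r)) t2 =
          caputo a1 (\<lambda>s. ?q (int n) l s t2) s1 - caputo a1 (\<lambda>s. ?q (int n) l s 0) s1"
        by (rule rl_int_caputo[OF \<alpha>(3,4) t(2) cap2[OF l s1(1)] _ G_meas2 G_le]) (use s1 G_eq in auto)
      also have "caputo a1 (\<lambda>s. ?q (int n) l s 0) s1 = 0"
        by (rule caputo_eq_0[of _ "c n"]) (use axis[OF l] s1 in auto)
      finally show ?thesis by simp
    qed
    define H where "H s1 = rl_int a2 (\<lambda>r. G (s1, r)) t2" for s1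
    have H_meas: "H \<in> borel_measurable borel"
    proof -
      have [measurable]: "G \<in> borel_measurable (borel \<Otimes>\<^sub>M borel)" using G_meas by (simp add: borel_prod)
      show ?thesis unfolding H_def rl_int_def by measurable
    qed
    have H_le: "\<bar>H s1\<bar> \<le> l / \<beta> * B * \<bar>t2 powr a2 / Gamma (1 + a2)\<bar>" for s1
      unfolding H_def by (rule abs_rl_int_le[OF \<alpha>(3) G_meas2 G_le]) (use l \<beta> B in auto)
    have "rl_int2 a1 a2 G t = rl_int a1 H t1"
      using rl_int2_iterated[OF \<alpha>(1,3) G_meas G_le, of t] by (simp add: t(3) H_def[abs_def])
    also have "\<dots> = ?q (int n) l t1 t2 - ?q (int n) l 0 t2"
      by (rule rl_int_caputo[OF \<alpha>(1,2) t(1) cap1[OF l t(2)] _ H_meas H_le]) (use inner in \<open>auto simp: H_def\<close>)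
    also have "?q (int n) l 0 t2 = c n" by (rule axis) (use l t in auto)
    also have "?q (int n) l t1 t2 = p n l t" using t by (simp add: p_def)
    finally have G_int: "rl_int2 a1 a2 G t = p n l t - c n" .
    have "rl_int2 a1 a2 (E n l) t = rl_int2 a1 a2 (\<lambda>s. - (\<beta> / l) * G s) t"
      by (rule rl_int2_cong) (use l \<beta> t in \<open>auto simp: G_def\<close>)
    also have "rl_int2 a1 a2 (\<lambda>s. - (\<beta> / l) * G s) t = - (\<beta> / l) * rl_int2 a1 a2 G t"
      unfolding rl_int2_def by (subst integral_mult_right_zero[symmetric]) (simp add: mult_ac)
    also have "\<dots> = \<beta> / l * (c n - p n l t)"
      unfolding G_int by (simp add: right_diff_distrib)
    finally show ?thesis .
  qed
  have "poisson_field_system a1 a2 \<beta> p"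
  proof
    show "0 < a1" "0 < a2" "0 < \<beta>" by fact+
    show "continuous_on ({0<..} \<times> UNIV) (\<lambda>(l, s). p n l s)" for n by (rule p_cont)
    show "0 \<le> p n l s" if "0 < l" for n l s unfolding p_def using that by (intro nonneg) auto
    show "(\<lambda>n. p n l s) sums 1" if "0 < l" for l s unfolding p_def using that by (intro sums) auto
    show "p n l s = p n l (max 0 (fst s), max 0 (snd s))" for n l s by (simp add: p_def)
    fix l :: real and n and t :: "real \<times> real"
    assume l: "0 < l"
    have "((\<lambda>r. rl_int2 a1 a2 (\<lambda>s. r powr \<beta> * Q n r s) t) has_real_derivative
        rl_int2 a1 a2 (E n l) t) (at l)"
    proof -
      have "0 < l / 2" using l by simp
      from E_bound[OF this] obtain B where
        "\<forall>r s. r \<in> {l / 2..2 * l} \<longrightarrow> s \<in> {0..fst t} \<times> {0..snd t} \<longrightarrow> \<bar>E n r s\<bar> \<le> B"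
        by blast
      then have B: "\<bar>E n r s\<bar> \<le> B" if "r \<in> {l / 2..2 * l}" "s \<in> {0..fst t} \<times> {0..snd t}" for r s
        using that by blast
      have meas: "(\<lambda>s. r powr \<beta> * Q n r s) \<in> borel_measurable borel" if "0 < r" for r
      proof -
        have "continuous_on UNIV (Q n r)"
          using continuous_on_slice[of "{0<..}" "Q n" r] Q_cont[of n] that by (simp add: case_prod_unfold)
        then have "Q n r \<in> borel_measurable borel" by (rule borel_measurable_continuous_onI)
        then show ?thesis by measurable
      qed
      have Q_le: "\<bar>l powr \<beta> * Q n l s\<bar> \<le> l powr \<beta> * (\<Sum>k\<le>n. \<bar>\<beta> gchoose k\<bar>)" for s
      proof -
        have "\<bar>(\<beta> gchoose k) * (-1) ^ k * p (n - k) l s\<bar> \<le> \<bar>\<beta> gchoose k\<bar>" for k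
        proof -
          have "(\<Sum>i\<in>{n - k}. p i l s) \<le> (\<Sum>i. p i l s)" unfolding p_def
            using nonneg[OF l] sums[OF l] by (intro sum_le_suminf) (auto simp: sums_iff)
          then have "p (n - k) l s \<le> 1" "0 \<le> p (n - k) l s"
            using sums[OF l] nonneg[OF l] by (auto simp: p_def sums_iff)
          then show ?thesis by (simp add: abs_mult mult_left_le)
        qed
        then have "\<bar>Q n l s\<bar> \<le> (\<Sum>k\<le>n. \<bar>\<beta> gchoose k\<bar>)"
          unfolding Q_def by (intro order_trans[OF sum_abs sum_mono])
        then show ?thesis by (simp add: abs_mult mult_left_mono)
      qed
      show ?thesis
        unfolding rl_int2_def
      proof (rule has_real_derivative_integral_dominated(1)
          [where d = "l / 2" and w = "\<lambda>s. rl_weight2 a1 a2 t s * B" and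
            f' = "\<lambda>r s. rl_weight2 a1 a2 t s * E n r s"])
        show "0 < l / 2" using l by simp
        show "integrable lborel (\<lambda>s. rl_weight2 a1 a2 t s * (l powr \<beta> * Q n l s))"
          by (rule integrable_rl_weight2_times[OF \<alpha>(1,3) meas[OF l] Q_le])
        show "integrable lborel (\<lambda>s. rl_weight2 a1 a2 t s * B)"
          using integrable_rl_weight2[OF \<alpha>(1,3)] by simp
        fix r assume "\<bar>r - l\<bar> < l / 2"
        then have r: "0 < r" "r \<in> {l / 2..2 * l}"
          using l by (auto simp: abs_real_def split: if_splits)
        show "(\<lambda>s. rl_weight2 a1 a2 t s * (r powr \<beta> * Q n r s)) \<in> borel_measurable lborel"
          using meas[OF r(1)] by measurable
        fix s
        show "((\<lambda>r. rl_weight2 a1 a2 t s * (r powr \<beta> * Q n r s)) has_real_derivative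
            rl_weight2 a1 a2 t s * E n r s) (at r)"
          by (rule DERIV_cmult[OF E_deriv[OF r(1)]])
        show "\<bar>rl_weight2 a1 a2 t s * E n r s\<bar> \<le> rl_weight2 a1 a2 t s * B"
        proof (cases "s \<in> {0..fst t} \<times> {0..snd t}")
          case True
          from mult_left_mono[OF B[OF r(2) True] rl_weight2_nonneg[OF \<alpha>(1,3), of t s]] show ?thesis
            using rl_weight2_nonneg[OF \<alpha>(1,3), of t s] by (simp add: abs_mult)
        next
          case False
          then have "rl_weight2 a1 a2 t s = 0"
            by (cases s) (auto simp: rl_weight2_def rl_weight_def rl_kernel_def)
          then show ?thesis by simp
        qed
      qed
    qed
    then show "((\<lambda>r. rl_int2 a1 a2 (\<lambda>s. r powr \<beta> * (\<Sum>k\<le>n. (\<beta> gchoose k) * (-1) ^ k * p (n - k) r s)) t)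
      has_real_derivative \<beta> / l * ((if n = 0 then 1 else 0) - p n l t)) (at l)"
      unfolding main[OF l] by (simp add: Q_def c_def)
  qed
  then show ?thesis by (simp add: p_def[abs_def])
qed

section \<open>The endpoint of convergence and the Wright series\<close>

text \<open>Summation by parts with the tails R n, which tend to 0, writes the sum of b k \<rho>^k
  as R 0 minus 1 - \<rho> times the sum of R (k + 1) \<rho>^k. The terms from m on contribute at
  most e / 2, since 1 - \<rho> cancels the geometric sum; the first m terms disappear as \<rho> ->
  1.\<close>

theorem Abel_limit_at_left_1:
  fixes b :: "nat \<Rightarrow> real"
  assumes b: "summable b"
  shows "((\<lambda>\<rho>. \<Sum>k. b k * \<rho> ^ k) \<longlongrightarrow> (\<Sum>k. b k)) (at_left 1)"
proof -
  define R where "R n = (\<Sum>k. b (k + n))" for n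
  have R_Suc: "b n = R n - R (Suc n)" for n
  proof -
    have "summable (\<lambda>k. b (k + n))" using b by (subst summable_iff_shift)
    from suminf_split_head[OF this] show ?thesis by (simp add: R_def)
  qed
  have R_lim: "R \<longlonglongrightarrow> 0"
    unfolding R_def LIMSEQ_def dist_real_def using suminf_exist_split[OF _ b] by simp
  then obtain D where D: "\<And>n. \<bar>R n\<bar> \<le> D"
    using convergent_imp_Bseq[of R] by (auto simp: convergent_def Bseq_def)
  have D0: "0 \<le> D" using D[of 0] by linarith
  show ?thesis
  proof (rule tendstoI)
    fix e :: real assume e: "0 < e"
    obtain m where m: "\<And>n. n \<ge> m \<Longrightarrow> \<bar>R n\<bar> < e / 2"
      using R_lim e unfolding LIMSEQ_def dist_real_def by (metis diff_zero half_gt_zero)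
    have bound: "\<bar>(\<Sum>k. b k * \<rho> ^ k) - (\<Sum>k. b k)\<bar> \<le> e / 2 + (1 - \<rho>) * (D * real m)"
      if \<rho>: "0 < \<rho>" "\<rho> < 1" for \<rho>
    proof -
      have g: "(\<lambda>k. \<rho> ^ k) sums (1 / (1 - \<rho>))" using \<rho> by (intro geometric_sums) auto
      have sR: "summable (\<lambda>k. \<bar>R (k + i) * \<rho> ^ k\<bar>)" for i
        by (rule summable_comparison_test[OF _ summable_mult[OF sums_summable[OF g], of D]])
          (use D \<rho> in \<open>auto simp: abs_mult mult_right_mono intro!: exI\<close>)
      have R1: "summable (\<lambda>k. R k * \<rho> ^ k)" "summable (\<lambda>k. R (Suc k) * \<rho> ^ k)"
        using summable_rabs_cancel[OF sR[of 0]] summable_rabs_cancel[OF sR[of 1]] by simp_all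
      have "(\<Sum>k. R k * \<rho> ^ k) = R 0 + (\<Sum>k. R (Suc k) * \<rho> ^ Suc k)"
        using suminf_split_head[OF R1(1)] by simp
      also have "(\<Sum>k. R (Suc k) * \<rho> ^ Suc k) = \<rho> * (\<Sum>k. R (Suc k) * \<rho> ^ k)"
        by (subst suminf_mult[OF R1(2), symmetric]) (simp add: mult_ac)
      finally have "(\<Sum>k. b k * \<rho> ^ k) = R 0 - (1 - \<rho>) * (\<Sum>k. R (Suc k) * \<rho> ^ k)"
        unfolding R_Suc using suminf_diff[OF R1] by (simp add: left_diff_distrib)
      then have "\<bar>(\<Sum>k. b k * \<rho> ^ k) - (\<Sum>k. b k)\<bar> = (1 - \<rho>) * \<bar>\<Sum>k. R (Suc k) * \<rho> ^ k\<bar>"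
        using \<rho> by (simp add: R_def[of 0] abs_mult)
      also have "\<bar>\<Sum>k. R (Suc k) * \<rho> ^ k\<bar> \<le> (\<Sum>k. \<bar>R (Suc k) * \<rho> ^ k\<bar>)"
        using sR[of 1] by (intro summable_rabs) simp
      also have "\<dots> \<le> (\<Sum>k. e / 2 * \<rho> ^ k + (if k \<in> {..<m} then D else 0))"
      proof (rule suminf_le)
        show "summable (\<lambda>k. \<bar>R (Suc k) * \<rho> ^ k\<bar>)" using sR[of 1] by simp
        show "summable (\<lambda>k. e / 2 * \<rho> ^ k + (if k \<in> {..<m} then D else 0))"
          by (intro summable_add summable_mult sums_summable[OF g] summable_If_finite_set) auto
        fix k
        show "\<bar>R (Suc k) * \<rho> ^ k\<bar> \<le> e / 2 * \<rho> ^ k + (if k \<in> {..<m} then D else 0)"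
        proof (cases "k < m")
          case True
          have "\<bar>R (Suc k) * \<rho> ^ k\<bar> \<le> D"
            using D[of "Suc k"] D0 \<rho> by (auto simp: abs_mult power_le_one intro!: order_trans[OF mult_left_le])
          moreover have "0 \<le> e / 2 * \<rho> ^ k" using e \<rho> by simp
          ultimately show ?thesis using True by simp
        next
          case False
          then show ?thesis using m[of "Suc k"] \<rho> by (simp add: abs_mult mult_right_mono)
        qed
      qed
      also have "\<dots> = e / 2 * (1 / (1 - \<rho>)) + D * real m"
      proof -
        have "(\<lambda>k. if k \<in> {..<m} then D else 0) sums (\<Sum>k\<in>{..<m}. D)"
          by (rule sums_If_finite_set) simp
        from sums_add[OF sums_mult[OF g, of "e / 2"] this] show ?thesis
          by (simp add: sums_iff mult.commute)
      qed
      finally have "\<bar>(\<Sum>k. b k * \<rho> ^ k) - (\<Sum>k. b k)\<bar> \<le> (1 - \<rho>) * (e / 2 * (1 / (1 - \<rho>)) + D * real m)"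
        using \<rho> by (simp add: mult_left_mono)
      also have "\<dots> = e / 2 * ((1 - \<rho>) * (1 / (1 - \<rho>))) + (1 - \<rho>) * (D * real m)"
        by (simp only: distrib_left mult.left_commute)
      also have "(1 - \<rho>) * (1 / (1 - \<rho>)) = 1" using \<rho> by simp
      finally show ?thesis by simp
    qed
    have "((\<lambda>\<rho>. (1 - \<rho>) * (D * real m)) \<longlongrightarrow> (1 - 1) * (D * real m)) (at_left 1)"
      by (intro tendsto_intros)
    then have "eventually (\<lambda>\<rho>. (1 - \<rho>) * (D * real m) < e / 2) (at_left 1)"
      using e by (intro order_tendstoD) auto
    moreover have "eventually (\<lambda>\<rho>::real. \<rho> \<in> {0<..<1}) (at_left 1)"
      by (rule eventually_at_leftI[of 0]) auto
    ultimately show "eventually (\<lambda>\<rho>. dist (\<Sum>k. b k * \<rho> ^ k) (\<Sum>k. b k) < e) (at_left 1)"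
    proof eventually_elim
      case (elim \<rho>)
      then show ?case using bound[of \<rho>] by (simp add: dist_real_def)
    qed
  qed
qed

text \<open>Summability at the single argument y already bounds
  \<open>stf_coeff a1 a2 k * y ^ k\<close>, so \<open>pn_sums\<close> applies with Y = y at all
  arguments \<rho> y with \<rho> < 1. As \<rho> -> 1, Abel's theorem handles the series and
  continuity in l handles \<open>p n\<close>.\<close>

lemma (in poisson_field_system) pn_eq_suminf:
  assumes t: "0 < fst t" "0 < snd t" and l: "0 < l"
    and summ: "summable (\<lambda>k. stf_coeff a1 a2 k * (- (fst t powr a1 * snd t powr a2 * l powr \<beta>)) ^ k *
      (\<beta> * real k gchoose n))"
  shows "p n l t = (-1) ^ n *
    (\<Sum>k. stf_coeff a1 a2 k * (- (fst t powr a1 * snd t powr a2 * l powr \<beta>)) ^ k * (\<beta> * real k gchoose n))"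
proof -
  define T where "T = fst t powr a1 * snd t powr a2"
  have T: "0 < T" using t by (simp add: T_def)
  define y where "y = T * l powr \<beta>"
  have y: "0 < y" using T l by (simp add: y_def)
  let ?a = "stf_coeff a1 a2"
  have a0: "0 < ?a k" for k by (rule stf_coeff_pos[OF pos(1,2)])
  define b where "b k = ?a k * (- y) ^ k * (\<beta> * real k gchoose n)" for k
  have b: "summable b" using summ by (simp add: b_def[abs_def] y_def T_def)
  text \<open>Eventually the binomial coefficient is at least \<open>1 / fact n\<close>, so that the terms dominate
    \<open>stf_coeff a1 a2 k * y ^ k / fact n\<close>.\<close>
  obtain A where A: "\<And>k. ?a k * y ^ k \<le> A"
  proof -
    have "Bseq (\<lambda>k. fact n * b k)"
      using summable_LIMSEQ_zero[OF summable_mult[OF b]] by (intro convergent_imp_Bseq) (auto simp: convergent_def)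
    moreover have "eventually (\<lambda>k. norm (?a k * y ^ k) \<le> norm (fact n * b k)) sequentially"
    proof (rule eventually_sequentiallyI)
      \<comment> \<open>From k \<ge> n / \<beta> on, each factor \<beta> k - i with i < n is at
        least 1.\<close>
      fix k assume "nat \<lceil>real n / \<beta>\<rceil> \<le> k"
      then have "real n / \<beta> \<le> real k" by linarith
      then have k: "real n \<le> \<beta> * real k" using pos by (simp add: field_simps)
      have "(\<Prod>i=0..<n. 1 :: real) \<le> (\<Prod>i=0..<n. \<beta> * real k - real i)"
      proof (rule prod_mono)
        fix i assume "i \<in> {0..<n}"
        then have "real i + 1 \<le> real n" by auto
        then show "0 \<le> (1 :: real) \<and> 1 \<le> \<beta> * real k - real i" using k by linarith
      qed
      then have 1: "1 \<le> fact n * (\<beta> * real k gchoose n)" by (simp add: gbinomial_mult_fact)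
      have "norm (fact n * b k) = ?a k * y ^ k * \<bar>fact n * (\<beta> * real k gchoose n)\<bar>"
        using a0[of k] y by (simp add: b_def abs_mult power_abs mult_ac)
      also have "\<dots> \<ge> ?a k * y ^ k * 1"
        using 1 a0[of k] y by (intro mult_left_mono) auto
      finally show "norm (?a k * y ^ k) \<le> norm (fact n * b k)" using a0[of k] y by simp
    qed
    ultimately have "Bseq (\<lambda>k. ?a k * y ^ k)" by (rule Bseq_eventually_mono[rotated])
    then show ?thesis using that by (auto simp: Bseq_def abs_le_iff)
  qed
  \<comment> \<open>Scaling l by \<rho>^(1/\<beta>) scales the argument of the series by
    \<rho>.\<close>
  define L where "L \<rho> = \<rho> powr (1 / \<beta>) * l" for \<rho>
  have L: "0 < L \<rho>" "L \<rho> powr \<beta> = \<rho> * l powr \<beta>" if "0 < \<rho>" for \<rho>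
    using that l pos by (auto simp: L_def powr_mult powr_powr)
  have inner: "p n (L \<rho>) t = (-1) ^ n * (\<Sum>k. b k * \<rho> ^ k)" if \<rho>: "0 < \<rho>" "\<rho> < 1" for \<rho>
  proof -
    have e: "T * L \<rho> powr \<beta> = \<rho> * y" using L[OF \<rho>(1)] by (simp add: y_def)
    then have "fst t powr a1 * snd t powr a2 * L \<rho> powr \<beta> < y" using \<rho> y by (simp add: T_def)
    from pn_sums[OF t L(1)[OF \<rho>(1)] A this, of n]
    have "(\<lambda>k. ?a k * (- (\<rho> * y)) ^ k * (\<beta> * real k gchoose n)) sums ((-1) ^ n * p n (L \<rho>) t)"
      by (simp only: T_def[symmetric] e)
    moreover have "?a k * (- (\<rho> * y)) ^ k * (\<beta> * real k gchoose n) = b k * \<rho> ^ k" for k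
    proof -
      have "- (\<rho> * y) = \<rho> * (- y)" by simp
      then show ?thesis by (simp only: b_def power_mult_distrib mult_ac)
    qed
    ultimately have "(\<Sum>k. b k * \<rho> ^ k) = (-1) ^ n * p n (L \<rho>) t" by (simp add: sums_iff)
    then show ?thesis by simp
  qed
  have "((\<lambda>\<rho>. p n (L \<rho>) t) \<longlongrightarrow> p n (L 1) t) (at_left 1)"
  proof -
    have "continuous_on {0<..} (\<lambda>\<rho>. (\<lambda>(l, s). p n l s) (L \<rho>, t))"
      by (rule continuous_on_compose2[OF cont])
        (use l in \<open>auto simp: L_def intro!: continuous_intros\<close>)
    then have "isCont (\<lambda>\<rho>. p n (L \<rho>) t) 1"
      by (simp add: continuous_on_eq_continuous_at)
    then show ?thesis
      by (simp add: isCont_def filterlim_at_split)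
  qed
  moreover have "((\<lambda>\<rho>. p n (L \<rho>) t) \<longlongrightarrow> (-1) ^ n * (\<Sum>k. b k)) (at_left 1)"
  proof (rule Lim_transform_eventually)
    show "((\<lambda>\<rho>. (-1) ^ n * (\<Sum>k. b k * \<rho> ^ k)) \<longlongrightarrow> (-1) ^ n * (\<Sum>k. b k)) (at_left 1)"
      by (intro tendsto_intros Abel_limit_at_left_1[OF b])
    show "\<forall>\<^sub>F \<rho> in at_left 1. (-1) ^ n * (\<Sum>k. b k * \<rho> ^ k) = p n (L \<rho>) t"
      by (rule eventually_at_leftI[of 0]) (use inner in auto)
  qed
  ultimately have "p n (L 1) t = (-1) ^ n * (\<Sum>k. b k)"
    by (rule tendsto_unique[rotated]) simp
  then show ?thesis by (simp add: L_def b_def y_def T_def)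
qed

section \<open>Growth of the coefficients\<close>

lemma Gamma_ratio_le:
  fixes z \<alpha> :: real assumes "0 < z" "0 < \<alpha>" "\<alpha> \<le> 1"
  shows "Gamma z / Gamma (z + \<alpha>) \<le> (z + \<alpha>) powr (1 - \<alpha>) / z"
proof -
  have G: "0 < Gamma z" "0 < Gamma (z + \<alpha>)" "0 < Gamma (z + \<alpha> + 1)" using assms by auto
  \<comment> \<open>z + 1 is the convex combination of z + \<alpha> and z + \<alpha> + 1 with
    weights \<alpha> and 1 - \<alpha>. Log-convexity of Gamma at these points and its functional
    equation give the estimate.\<close>
  have "(ln \<circ> Gamma) ((1 - (1 - \<alpha>)) *\<^sub>R (z + \<alpha>) + (1 - \<alpha>) *\<^sub>R (z + \<alpha> + 1)) \<le>
      (1 - (1 - \<alpha>)) * (ln \<circ> Gamma) (z + \<alpha>) + (1 - \<alpha>) * (ln \<circ> Gamma) (z + \<alpha> + 1)"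
    by (rule convex_onD[OF log_convex_Gamma_real]) (use assms in auto)
  also have "(1 - (1 - \<alpha>)) *\<^sub>R (z + \<alpha>) + (1 - \<alpha>) *\<^sub>R (z + \<alpha> + 1) = z + 1"
    by (simp add: algebra_simps)
  finally have "ln (Gamma (z + 1)) \<le> \<alpha> * ln (Gamma (z + \<alpha>)) + (1 - \<alpha>) * ln (Gamma (z + \<alpha> + 1))"
    by simp
  also have "Gamma (z + \<alpha> + 1) = (z + \<alpha>) * Gamma (z + \<alpha>)"
    using assms by (intro Gamma_plus1) (auto simp: nonpos_Ints_def)
  also have "ln ((z + \<alpha>) * Gamma (z + \<alpha>)) = ln (z + \<alpha>) + ln (Gamma (z + \<alpha>))"
    using assms G by (intro ln_mult_pos) auto
  also have "\<alpha> * ln (Gamma (z + \<alpha>)) + (1 - \<alpha>) * (ln (z + \<alpha>) + ln (Gamma (z + \<alpha>))) =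
      ln (Gamma (z + \<alpha>)) + (1 - \<alpha>) * ln (z + \<alpha>)"
    by (simp add: algebra_simps)
  also have "Gamma (z + 1) = z * Gamma z"
    using assms by (intro Gamma_plus1) (auto simp: nonpos_Ints_def)
  finally have "ln (z * Gamma z) \<le> ln (Gamma (z + \<alpha>)) + (1 - \<alpha>) * ln (z + \<alpha>)" .
  also have "\<dots> = ln (Gamma (z + \<alpha>) * (z + \<alpha>) powr (1 - \<alpha>))"
    using assms G by (subst ln_mult_pos) (auto simp: ln_powr)
  finally have "z * Gamma z \<le> Gamma (z + \<alpha>) * (z + \<alpha>) powr (1 - \<alpha>)"
    using assms G by (subst (asm) ln_le_cancel_iff) auto
  then show ?thesis using assms G by (simp add: field_simps)
qed

text \<open>The ratio of consecutive coefficients is O(k^(1 - a1 - a2)): the factorial contributes k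
  and each Gamma quotient k^-a1 or k^-a2. It tends to 0 because a1 + a2 > 1.\<close>

lemma summable_stf_coeff:
  assumes \<alpha>: "0 < a1" "a1 \<le> 1" "0 < a2" "a2 \<le> 1" "1 < a1 + a2"
  shows "summable (\<lambda>k. stf_coeff a1 a2 k * z ^ k)"
proof -
  let ?a = "stf_coeff a1 a2"
  have a0: "0 < ?a k" for k by (rule stf_coeff_pos[OF \<alpha>(1,3)])
  define g where "g \<alpha> k = Gamma (1 + \<alpha> * real k) / Gamma (1 + \<alpha> * real (Suc k))" for \<alpha> k
  \<comment> \<open>The constant 2 / \<alpha> comes from 1 + \<alpha> k + \<alpha> \<le> 2 (k + 1),
    from 1 + \<alpha> k \<ge> \<alpha> (k + 1), and from bounding 2^(1 - \<alpha>) by 2.\<close>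
  have g_le: "g \<alpha> k \<le> 2 / \<alpha> * real (Suc k) powr - \<alpha>" if "0 < \<alpha>" "\<alpha> \<le> 1" for \<alpha> k
  proof -
    have z: "0 < 1 + \<alpha> * real k" using that by (simp add: add_pos_nonneg)
    have "g \<alpha> k \<le> (1 + \<alpha> * real k + \<alpha>) powr (1 - \<alpha>) / (1 + \<alpha> * real k)"
      using Gamma_ratio_le[OF z that] by (simp add: g_def algebra_simps)
    also have "\<dots> \<le> (2 * real (Suc k)) powr (1 - \<alpha>) / (\<alpha> * real (Suc k))"
    proof (rule frac_le)
      have "\<alpha> * real k \<le> 1 * real k" using that by (intro mult_right_mono) auto
      then show "(1 + \<alpha> * real k + \<alpha>) powr (1 - \<alpha>) \<le> (2 * real (Suc k)) powr (1 - \<alpha>)"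
        using that z by (intro powr_mono2) auto
      show "\<alpha> * real (Suc k) \<le> 1 + \<alpha> * real k" using that by (simp add: algebra_simps)
    qed (use that in auto)
    also have "\<dots> \<le> 2 * real (Suc k) powr (1 - \<alpha>) / (\<alpha> * real (Suc k))"
    proof (rule divide_right_mono)
      have "(2 :: real) powr (1 - \<alpha>) \<le> 2 powr 1" using that by (intro powr_mono) auto
      then have "2 powr (1 - \<alpha>) * real (Suc k) powr (1 - \<alpha>) \<le> 2 * real (Suc k) powr (1 - \<alpha>)"
        by (intro mult_right_mono) auto
      then show "(2 * real (Suc k)) powr (1 - \<alpha>) \<le> 2 * real (Suc k) powr (1 - \<alpha>)"
        by (simp only: powr_mult)
    qed (use that in auto)
    also have "real (Suc k) powr (1 - \<alpha>) = real (Suc k) * real (Suc k) powr - \<alpha>"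
      by (simp add: powr_diff powr_minus field_simps)
    also have "2 * (real (Suc k) * real (Suc k) powr - \<alpha>) / (\<alpha> * real (Suc k)) = 2 / \<alpha> * real (Suc k) powr - \<alpha>"
      using that by simp
    finally show ?thesis .
  qed
  have g0: "0 \<le> g \<alpha> k" if "0 < \<alpha>" for \<alpha> k
  proof -
    have "0 < Gamma (1 + \<alpha> * real j)" for j using that by (intro Gamma_real_pos add_pos_nonneg) auto
    then show ?thesis unfolding g_def by (intro divide_nonneg_pos less_imp_le)
  qed
  define C where "C = 4 / (a1 * a2) * \<bar>z\<bar>"
  have ratio: "?a (Suc k) * \<bar>z\<bar> \<le> C * real (Suc k) powr (1 - a1 - a2) * ?a k" for k
  proof -
    have G: "0 < Gamma (1 + a1 * real j)" "0 < Gamma (1 + a2 * real j)" for j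
      using \<alpha> by (auto intro!: Gamma_real_pos add_pos_nonneg)
    have "?a (Suc k) = ?a k * (real (Suc k) * (g a1 k * g a2 k))"
      using G[of k] G[of "Suc k"] by (simp add: stf_coeff_def g_def)
    also have "\<dots> \<le> ?a k * (real (Suc k) * ((2 / a1 * real (Suc k) powr - a1) * (2 / a2 * real (Suc k) powr - a2)))"
      using g_le[OF \<alpha>(1,2), of k] g_le[OF \<alpha>(3,4), of k] g0[OF \<alpha>(1), of k] g0[OF \<alpha>(3), of k] a0[of k] \<alpha>
      by (intro mult_left_mono mult_mono) auto
    also have "\<dots> = ?a k * (4 / (a1 * a2) * (real (Suc k) powr 1 * real (Suc k) powr - a1 * real (Suc k) powr - a2))"
      using \<alpha> by (simp add: field_simps)
    also have "real (Suc k) powr 1 * real (Suc k) powr - a1 * real (Suc k) powr - a2 =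
        real (Suc k) powr (1 - a1 - a2)"
      by (simp only: powr_add[symmetric] diff_conv_add_uminus)
    finally have "?a (Suc k) * \<bar>z\<bar> \<le> ?a k * (4 / (a1 * a2) * real (Suc k) powr (1 - a1 - a2)) * \<bar>z\<bar>"
      by (rule mult_right_mono) simp
    then show ?thesis by (simp add: C_def mult_ac)
  qed
  have "(\<lambda>k. C * real (Suc k) powr (1 - a1 - a2)) \<longlonglongrightarrow> C * 0"
    using \<alpha>(5) filterlim_compose[OF filterlim_real_sequentially filterlim_Suc]
    by (intro tendsto_mult tendsto_const tendsto_neg_powr) auto
  then have "eventually (\<lambda>k. C * real (Suc k) powr (1 - a1 - a2) < 1 / 2) sequentially"
    by (intro order_tendstoD) auto
  then obtain m where m: "\<And>k. k \<ge> m \<Longrightarrow> C * real (Suc k) powr (1 - a1 - a2) < 1 / 2"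
    by (auto simp: eventually_sequentially)
  show ?thesis
  proof (rule summable_ratio_test[of "1 / 2" m])
    fix k assume k: "k \<ge> m"
    have "norm (?a (Suc k) * z ^ Suc k) = ?a (Suc k) * \<bar>z\<bar> * \<bar>z\<bar> ^ k"
      using a0[of "Suc k"] by (simp add: abs_mult power_abs)
    also have "\<dots> \<le> 1 / 2 * ?a k * \<bar>z\<bar> ^ k"
      using order_trans[OF ratio[of k] mult_right_mono[of _ "1 / 2" "?a k"]] m[OF k] a0[of k]
      by (intro mult_right_mono) auto
    also have "\<dots> = 1 / 2 * norm (?a k * z ^ k)"
      using a0[of k] by (simp add: abs_mult power_abs)
    finally show "norm (?a (Suc k) * z ^ Suc k) \<le> 1 / 2 * norm (?a k * z ^ k)" .
  qed simp
qed

text \<open>The recursion of \<open>rGamma\<close> holds at the poles of Gamma too, so no case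
  distinction arises: when 1 - n + z is a nonpositive integer, z is an integer below n and both
  sides are 0.\<close>

lemma Gamma_mult_rGamma_eq_gbinomial:
  fixes z :: real assumes "0 \<le> z"
  shows "Gamma (1 + z) * rGamma (1 - real n + z) = fact n * (z gchoose n)"
proof -
  have "Gamma (1 + z) * rGamma (1 - real n + z) = (\<Prod>i=0..<n. z - real i)"
  proof (induction n)
    case 0
    have "0 < Gamma (1 + z)" using assms by (intro Gamma_real_pos) auto
    then show ?case by (simp add: rGamma_inverse_Gamma)
  next
    case (Suc n)
    have "rGamma (1 - real (Suc n) + z) = (z - real n) * rGamma (1 - real n + z)"
      using rGamma_plus1[of "z - real n"] by (simp add: algebra_simps)
    then show ?case using Suc.IH by (simp add: mult_ac)
  qed
  then show ?thesis by (simp add: gbinomial_mult_fact)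
qed

text \<open>The formula is asserted wherever the series converges, and convergence wherever
  \<alpha>1 + \<alpha>2 > 1; for \<alpha>1 + \<alpha>2 = 1 the radius of convergence is finite, and
  below 1 the series diverges off the axes. The form with quotients of Gamma agrees term by term
  with the one using \<open>rGamma\<close>, since Gamma is 0 at its poles and division by 0 gives
  0.\<close>

theorem theorem5p3:
  fixes \<alpha>1 \<alpha>2 \<beta> l t1 t2 :: real and n :: nat
    and M :: "real \<Rightarrow> 'a measure"
    and N :: "real \<Rightarrow> real \<Rightarrow> real \<Rightarrow> 'a \<Rightarrow> nat"
  assumes "0 < \<alpha>1" "\<alpha>1 \<le> 1" "0 < \<alpha>2" "\<alpha>2 \<le> 1" "0 < \<beta>" "\<beta> \<le> 1"
    and "stfprf \<alpha>1 \<alpha>2 \<beta> M N"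
    and "l > 0" "t1 \<ge> 0" "t2 \<ge> 0"
  shows
    "(\<alpha>1 + \<alpha>2 > 1 \<longrightarrow>
        summable (gen_wright_term [(1, \<beta>), (1, 1), (1, 1)] [(1 - real n, \<beta>), (1, \<alpha>1), (1, \<alpha>2)]
          (- (t1 powr \<alpha>1 * t2 powr \<alpha>2 * l powr \<beta>)))) \<and>
     (summable (gen_wright_term [(1, \<beta>), (1, 1), (1, 1)] [(1 - real n, \<beta>), (1, \<alpha>1), (1, \<alpha>2)]
          (- (t1 powr \<alpha>1 * t2 powr \<alpha>2 * l powr \<beta>))) \<longrightarrow>
        measure (M l) {\<omega> \<in> space (M l). N l t1 t2 \<omega> = n} =
          (-1) ^ n / fact n *
            gen_wright [(1, \<beta>), (1, 1), (1, 1)] [(1 - real n, \<beta>), (1, \<alpha>1), (1, \<alpha>2)]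
              (- (t1 powr \<alpha>1 * t2 powr \<alpha>2 * l powr \<beta>)) \<and>
        measure (M l) {\<omega> \<in> space (M l). N l t1 t2 \<omega> = n} =
          (-1) ^ n / fact n *
            (\<Sum>k. Gamma (1 + \<beta> * real k) * Gamma (1 + real k) * Gamma (1 + real k)
                   / (Gamma (1 - real n + \<beta> * real k) * Gamma (1 + \<alpha>1 * real k)
                      * Gamma (1 + \<alpha>2 * real k) * fact k)
                   * (- (t1 powr \<alpha>1 * t2 powr \<alpha>2 * l powr \<beta>)) ^ k))"
proof -
  define y where "y = t1 powr \<alpha>1 * t2 powr \<alpha>2 * l powr \<beta>"
  have y: "0 \<le> y" by (simp add: y_def)
  let ?a = "stf_coeff \<alpha>1 \<alpha>2"
  have a0: "0 < ?a k" for k by (rule stf_coeff_pos) fact+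
  define W where "W k = fact n * (?a k * (- y) ^ k * (\<beta> * real k gchoose n))" for k
  have fact_Gamma: "Gamma (1 + real k) = fact k" for k by (simp add: Gamma_fact)
  have GG: "Gamma (1 + \<beta> * real k) * rGamma (1 - real n + \<beta> * real k) = fact n * (\<beta> * real k gchoose n)" for k
    using assms by (intro Gamma_mult_rGamma_eq_gbinomial) auto
  have term1: "gen_wright_term [(1, \<beta>), (1, 1), (1, 1)] [(1 - real n, \<beta>), (1, \<alpha>1), (1, \<alpha>2)] (- y) k = W k" for k
  proof -
    have "gen_wright_term [(1, \<beta>), (1, 1), (1, 1)] [(1 - real n, \<beta>), (1, \<alpha>1), (1, \<alpha>2)] (- y) k =
        (Gamma (1 + \<beta> * real k) * rGamma (1 - real n + \<beta> * real k)) *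
          (fact k * rGamma (1 + \<alpha>1 * real k) * rGamma (1 + \<alpha>2 * real k)) * (- y) ^ k"
      by (simp add: gen_wright_term_def fact_Gamma mult_ac)
    also have "fact k * rGamma (1 + \<alpha>1 * real k) * rGamma (1 + \<alpha>2 * real k) = ?a k"
      by (simp add: stf_coeff_def rGamma_inverse_Gamma divide_inverse)
    finally show ?thesis unfolding GG by (simp add: W_def)
  qed
  have term2: "Gamma (1 + \<beta> * real k) * Gamma (1 + real k) * Gamma (1 + real k)
      / (Gamma (1 - real n + \<beta> * real k) * Gamma (1 + \<alpha>1 * real k) * Gamma (1 + \<alpha>2 * real k) * fact k)
      * (- y) ^ k = W k" for k
  proof -
    have "Gamma (1 + \<beta> * real k) * Gamma (1 + real k) * Gamma (1 + real k)
      / (Gamma (1 - real n + \<beta> * real k) * Gamma (1 + \<alpha>1 * real k) * Gamma (1 + \<alpha>2 * real k) * fact k) =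
        (Gamma (1 + \<beta> * real k) * rGamma (1 - real n + \<beta> * real k)) * ?a k"
      by (simp add: fact_Gamma stf_coeff_def rGamma_inverse_Gamma divide_inverse)
    then show ?thesis unfolding GG by (simp add: W_def)
  qed
  have summable_W: "summable W" if "1 < \<alpha>1 + \<alpha>2"
  proof (rule summable_comparison_test)
    \<comment> \<open>The product n! times the binomial coefficient is at most (k + n)^n \<le> n!
      exp (k + n). The exponential in k is absorbed into the argument, at no loss because the
      coefficient series converges everywhere.\<close>
    show "summable (\<lambda>k. fact n * exp (real n) * (?a k * (exp 1 * y) ^ k))"
      using assms that by (intro summable_mult summable_stf_coeff)
    have "norm (W k) \<le> fact n * exp (real n) * (?a k * (exp 1 * y) ^ k)" for k
    proof -
      have "\<bar>fact n * (\<beta> * real k gchoose n)\<bar> = (\<Prod>i=0..<n. \<bar>\<beta> * real k - real i\<bar>)"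
        by (simp add: gbinomial_mult_fact abs_prod)
      also have "\<dots> \<le> (\<Prod>i=0..<n. real k + real n)"
      proof (rule prod_mono)
        fix i assume "i \<in> {0..<n}"
        moreover have "\<beta> * real k \<le> 1 * real k" "0 \<le> \<beta> * real k"
          using assms mult_right_mono[of \<beta> 1 "real k"] by auto
        ultimately show "0 \<le> \<bar>\<beta> * real k - real i\<bar> \<and> \<bar>\<beta> * real k - real i\<bar> \<le> real k + real n"
          by auto
      qed
      also have "\<dots> = (real k + real n) ^ n" by simp
      also have "\<dots> \<le> fact n * exp (real k + real n)"
      proof -
        have "(\<Sum>i\<in>{n}. (real k + real n) ^ i /\<^sub>R fact i) \<le> (\<Sum>i. (real k + real n) ^ i /\<^sub>R fact i)"
          by (intro sum_le_suminf summable_exp_generic) auto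
        then show ?thesis by (simp add: exp_def field_simps)
      qed
      also have "\<dots> = fact n * exp (real n) * exp 1 ^ k"
        by (simp add: exp_add exp_of_nat_mult[symmetric])
      finally have *: "\<bar>fact n * (\<beta> * real k gchoose n)\<bar> \<le> fact n * exp (real n) * exp 1 ^ k" .
      have "norm (W k) = ?a k * y ^ k * \<bar>fact n * (\<beta> * real k gchoose n)\<bar>"
        using a0[of k] y by (simp add: W_def abs_mult power_abs mult_ac)
      also have "\<dots> \<le> ?a k * y ^ k * (fact n * exp (real n) * exp 1 ^ k)"
        using a0[of k] y by (intro mult_left_mono[OF *]) auto
      finally show ?thesis by (simp add: power_mult_distrib mult_ac)
    qed
    then show "\<exists>N. \<forall>k\<ge>N. norm (W k) \<le> fact n * exp (real n) * (?a k * (exp 1 * y) ^ k)" by blast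
  qed
  interpret poisson_field_system \<alpha>1 \<alpha>2 \<beta> "\<lambda>n l s. field_dist M N (int n) l (max 0 (fst s)) (max 0 (snd s))"
    by (rule stfprf_imp_poisson_field_system) fact+
  have eq: "field_dist M N (int n) l t1 t2 = (-1) ^ n / fact n * suminf W" if W: "summable W"
  proof (cases "t1 = 0 \<or> t2 = 0")
    case False
    then have t: "0 < fst (t1, t2)" "0 < snd (t1, t2)" using assms by auto
    have "summable (\<lambda>k. W k / fact n)" using W by (rule summable_divide)
    then have s: "summable (\<lambda>k. ?a k * (- y) ^ k * (\<beta> * real k gchoose n))" by (simp add: W_def)
    have "field_dist M N (int n) l t1 t2 = (-1) ^ n * (\<Sum>k. ?a k * (- y) ^ k * (\<beta> * real k gchoose n))"
      using pn_eq_suminf[OF t \<open>l > 0\<close>, of n] s t by (simp add: y_def)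
    moreover have "suminf W = fact n * (\<Sum>k. ?a k * (- y) ^ k * (\<beta> * real k gchoose n))"
      unfolding W_def by (rule suminf_mult[OF s])
    ultimately show ?thesis by simp
  next
    \<comment> \<open>On the axes the argument is 0 and only the term k = 0 is left, which matches a
      distribution concentrated at 0.\<close>
    case True
    then have y0: "y = 0" by (auto simp: y_def)
    have p0: "field_dist M N 0 l t1 t2 = 1"
      using assms True by (auto simp: stfprf_def stfprf_system_def)
    have "suminf W = (\<Sum>k\<in>{0}. W k)"
      by (rule suminf_finite) (auto simp: W_def y0)
    also have "\<dots> = (if n = 0 then 1 else 0)"
      by (cases n) (auto simp: W_def stf_coeff_def)
    finally have sW: "suminf W = (if n = 0 then 1 else 0)" .
    show ?thesis
    proof (cases "n = 0")
      case True
      then show ?thesis using sW p0 by simp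
    next
      case False
      have s: "(\<lambda>i. field_dist M N (int i) l t1 t2) sums 1"
        using total[OF \<open>l > 0\<close>, of "(t1, t2)"] assms by simp
      have nn: "0 \<le> field_dist M N i l t1 t2" for i by (simp add: field_dist_def)
      have "(\<Sum>i\<in>{0, n}. field_dist M N (int i) l t1 t2) \<le> (\<Sum>i. field_dist M N (int i) l t1 t2)"
        using s nn by (intro sum_le_suminf) (auto simp: sums_iff)
      then have "field_dist M N (int n) l t1 t2 \<le> 0" using False p0 s by (simp add: sums_iff)
      then show ?thesis using nn[of "int n"] sW False by simp
    qed
  qed
  have fd: "measure (M l) {\<omega> \<in> space (M l). N l t1 t2 \<omega> = n} = field_dist M N (int n) l t1 t2"
    by (simp add: field_dist_def)
  have t1: "gen_wright_term [(1, \<beta>), (1, 1), (1, 1)] [(1 - real n, \<beta>), (1, \<alpha>1), (1, \<alpha>2)] (- y) = W"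
    using term1 by (intro ext)
  show ?thesis
    unfolding y_def[symmetric] fd gen_wright_def t1 term2 using summable_W eq by blast
qed

end
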